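(* For any $0<\varepsilon<1$ there is a Dirichlet series $f$ mapping $\mathbb{C}_0$ to $\mathbb{D}$ such that the limit $\lim_{T\to\infty} N_f(\xi,T)$ fails to exist for quasi-every $\xi$ with $\varepsilon < |\xi| < 1$.
   Context: $\mathbb{C}_\kappa=\{s:\mathrm{Re}\,s>\kappa\}$ and $\mathbb{D}$ is the open unit disc. A "Dirichlet series mapping $\mathbb{C}_0$ to $\mathbb{D}$" is an analytic function $f:\mathbb{C}_0\to\mathbb{D}$ represented by a Dirichlet series $\sum_{n\ge1}a_nn^{-s}$ converging in $\mathbb{C}_\kappa$ for some $\kappa>0$. For $T>0$ and $\xi\in\mathbb{D}$, $N_f(\xi,T)=\frac{\pi}{T}\sum\mathrm{Re}\,s$, summing over all $s\in\mathbb{C}_0$ with $f(s)=\xi$ and $|\mathrm{Im}\,s|<T$, with multiplicity. "Quasi-every" means outside a set of logarithmic capacity zero. *)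

theory Defs
  imports "HOL-Complex_Analysis.Complex_Analysis"
begin

definition halfplane :: "real \<Rightarrow> complex set" where
  "halfplane \<kappa> = {s. Re s > \<kappa>}"

definition dirichlet_series_to_disc :: "(complex \<Rightarrow> complex) \<Rightarrow> bool" where
  "dirichlet_series_to_disc f \<longleftrightarrow>
     f analytic_on halfplane 0 \<and>
     f ` halfplane 0 \<subseteq> ball 0 1 \<and>
     (\<exists>a :: nat \<Rightarrow> complex. \<exists>\<kappa>>0. \<forall>s\<in>halfplane \<kappa>.
        (\<lambda>n. a (Suc n) * of_nat (Suc n) powr (- s)) sums f s)"

text \<open>N_f(xi,T) = (pi/T) * sum of Re s over the xi-points of f in C_0 with |Im s| < T,
  counted with multiplicity (order of the zero of f - xi). Valued in ennreal so that
  no summability side condition is hidden.\<close>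
definition Nf :: "(complex \<Rightarrow> complex) \<Rightarrow> complex \<Rightarrow> real \<Rightarrow> ennreal" where
  "Nf f \<xi> T = ennreal (pi / T) *
     (\<Sum>\<^sub>\<infinity> s \<in> {s\<in>halfplane 0. f s = \<xi> \<and> \<bar>Im s\<bar> < T}.
        ennreal (of_nat (nat (zorder (\<lambda>z. f z - \<xi>) s)) * Re s))"

definition log_kernel_pos :: "complex \<Rightarrow> complex \<Rightarrow> ennreal" where
  "log_kernel_pos z w = (if z = w then \<infinity> else ennreal (- ln (cmod (z - w))))"

text \<open>Polar sets = sets of logarithmic capacity zero (Ransford): every nonzero finite
  Borel measure with compact support contained in E has logarithmic energy -infinity.
  For compactly supported finite measures this is equivalent to the positive part of
  log(1/|z-w|) having infinite double integral.\<close>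
definition log_capacity_zero :: "complex set \<Rightarrow> bool" where
  "log_capacity_zero E \<longleftrightarrow>
     (\<forall>\<mu> K. finite_measure \<mu> \<and> sets \<mu> = sets borel \<and> emeasure \<mu> (space \<mu>) \<noteq> 0 \<and>
        compact K \<and> K \<subseteq> E \<and> emeasure \<mu> (space \<mu> - K) = 0 \<longrightarrow>
        (\<integral>\<^sup>+ z. (\<integral>\<^sup>+ w. log_kernel_pos z w \<partial>\<mu>) \<partial>\<mu>) = \<infinity>)"

end

theory Submission
  imports Defs
begin

text \<open>
  The function is an infinite composition \<open>f = \<phi>\<^sub>0 \<circ> \<phi>\<^sub>1 \<circ> \<phi>\<^sub>2 \<circ> \<dots>\<close> of the maps
  \<open>\<phi>\<^sub>k(x) = (a\<^sub>k + Z\<^sub>k\<^sup>2 x) / (1 + a\<^sub>k x)\<close>, where \<open>Z\<^sub>k(s) = exp(-\<Lambda>\<^sub>k s)\<close> and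
  \<open>a\<^sub>k(s) = Z\<^sub>k(s) P\<^sub>k(cosh(u\<^sub>k s))\<close> is a Dirichlet polynomial. On the imaginary axis
  \<open>a\<^sub>k(it) = Z\<^sub>k(it) P\<^sub>k(cos(u\<^sub>k t))\<close> with a real factor, so \<open>\<phi>\<^sub>k\<close> is there an automorphism of
  the disc. The polynomial \<open>P\<^sub>k\<close> is close to 1 for \<open>u\<^sub>k t \<in> [\<delta>\<^sub>k, 2\<delta>\<^sub>k]\<close> and tiny unless \<open>u\<^sub>k t\<close> is within
  \<open>3\<delta>\<^sub>k\<close> of \<open>2\<pi>\<int>\<close>; the \<open>\<delta>\<^sub>k\<close> have a small sum and \<open>u\<^sub>k\<close> decreases rapidly.

  At the scale \<open>T = 2\<pi>/u\<^sub>k\<close> the function is smaller than \<open>\<epsilon>\<close> except over a proportion of about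
  \<open>\<Sum>\<delta>\<^sub>j\<close> of the heights, and a Blaschke estimate bounds the contribution of these, whence
  \<open>N\<^sub>f(\<xi>,T) \<le> (1-|\<xi>|)/500\<close>. At the scale \<open>T = 2\<delta>\<^sub>k/u\<^sub>k\<close> half of the heights lie in the \<open>k\<close>-th window,
  where \<open>f\<close> is nearly an automorphism of the disc applied to \<open>exp(-\<Lambda>\<^sub>k s)\<close> and takes the value \<open>\<xi>\<close> about
  once per period; this gives \<open>N\<^sub>f(\<xi>,T) \<ge> (1-|\<xi>|)/200\<close> for large \<open>k\<close>. So the limit
  exists for no \<open>\<xi>\<close> in the annulus.
\<close>

section \<open>A Blaschke bound in the half-plane\<close>

text \<open>A Dirichlet series is almost periodic, so nothing can be switched on over one range of
  heights only. The switch is therefore the beat of two neighbouring frequencies \<open>ln N\<close>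
  and \<open>ln (N + 1)\<close>, whose windows recur with a long period; the two scales see either
  one window or the average over a period. Windows start at \<delta> k and not at 0, so that later
  levels are still dormant where an earlier level is observed.

  Moebius maps, rather than sums, keep the values in the disc. For a real envelope this is an exact
  identity; off the axis the envelope is only nearly real, but the error vanishes linearly in
  \<open>Re s\<close>, as does the gain from \<open>Z k\<close>, so the margin \<open>dip k\<close>
  below 1 absorbs it. On the axis a map with negligible \<open>a k\<close> is almost a rotation, so
  the levels before \<open>k\<close> hardly distort level \<open>k\<close>, once its frequency is so
  high that they barely move over one period.

  Both estimates carry the factor \<open>1 - norm \<xi>\<close>: it is the size of the Blaschke
  bound at a point of small value, and up to the frequency also a lower bound for the real part of a
  solution. Hence one function serves the whole annulus.\<close>

lemma mem_halfplane [simp]: "s \<in> halfplane c \<longleftrightarrow> Re s > c"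
  by (simp add: halfplane_def)

lemma open_halfplane [simp]: "open (halfplane c)"
  unfolding halfplane_def by (rule open_halfspace_Re_gt)

lemma connected_halfplane [simp]: "connected (halfplane c)"
  unfolding halfplane_def by (rule convex_connected, rule convex_halfspace_Re_gt)

definition blaschke :: "complex \<Rightarrow> complex \<Rightarrow> complex" where
  "blaschke p s = (s - p) / (s + cnj p)"

lemma blaschke_denom_nonzero:
  "Re p > 0 \<Longrightarrow> Re s > 0 \<Longrightarrow> s + cnj p \<noteq> 0"
  by (auto simp: complex_eq_iff)

lemma norm_blaschke_sq:
  assumes "Re p > 0" "Re s > 0"
  shows "(norm (blaschke p s))\<^sup>2 = 1 - 4 * Re s * Re p / (norm (s + cnj p))\<^sup>2"
proof -
  have nz: "(norm (s + cnj p))\<^sup>2 \<noteq> 0"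
    using blaschke_denom_nonzero[OF assms] by simp
  have "(norm (s - p))\<^sup>2 = (norm (s + cnj p))\<^sup>2 - 4 * Re s * Re p"
    unfolding cmod_power2 by (simp add: power2_eq_square algebra_simps)
  with nz show ?thesis
    by (simp add: blaschke_def norm_divide power_divide field_simps)
qed

lemma norm_blaschke_less_1:
  assumes "Re p > 0" "Re s > 0"
  shows "norm (blaschke p s) < 1"
proof -
  have "4 * Re s * Re p / (norm (s + cnj p))\<^sup>2 > 0"
    using assms blaschke_denom_nonzero[OF assms] by simp
  then have "(norm (blaschke p s))\<^sup>2 < 1\<^sup>2"
    by (simp add: norm_blaschke_sq[OF assms])
  then show ?thesis
    by (meson one_power2 power_less_imp_less_base zero_le_one)
qed

text \<open>The Schwarz lemma transported by the Cayley map \<open>\<phi>\<close>, the inverse of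
  \<open>blaschke p\<close>, which sends 0 to \<open>p\<close>.\<close>

lemma Schwarz_halfplane:
  assumes hol: "g holomorphic_on halfplane 0"
    and bd: "\<And>s. Re s > 0 \<Longrightarrow> norm (g s) \<le> 1"
    and p: "Re p > 0" "g p = 0" and s: "Re s > 0"
  shows "norm (g s) \<le> norm (blaschke p s)"
proof -
  define \<phi> where "\<phi> z = (p + cnj p * z) / (1 - z)" for z
  have Re_\<phi>: "Re (\<phi> z) > 0" if "norm z < 1" for z
  proof -
    have nz: "1 - z \<noteq> 0" using that by auto
    have "Re (\<phi> z) = Re ((p + cnj p * z) * cnj (1 - z)) / (norm (1 - z))\<^sup>2"
      unfolding \<phi>_def cmod_power2 by (simp add: Re_divide)
    also have "Re ((p + cnj p * z) * cnj (1 - z)) = Re p * (1 - (norm z)\<^sup>2)"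
      unfolding cmod_power2 by (simp add: power2_eq_square algebra_simps)
    finally show ?thesis
      using p that nz by (simp add: power_less_one_iff abs_square_less_1)
  qed
  \<comment> \<open>The bound on \<open>g\<close> is not strict, while the Schwarz lemma on the disc
    asks for values of modulus below 1; hence the factor \<open>c < 1\<close>, removed at the end by
    letting \<open>c\<close> tend to 1.\<close>
  have scaled: "c * norm (g s) \<le> norm (blaschke p s)" if c: "0 < c" "c < 1" for c
  proof -
    define G where "G z = of_real c * g (\<phi> z)" for z
    have "\<phi> holomorphic_on ball 0 1"
      unfolding \<phi>_def by (intro holomorphic_intros) auto
    moreover have "\<phi> ` ball 0 1 \<subseteq> halfplane 0"
      using Re_\<phi> by (auto)
    ultimately have "G holomorphic_on ball 0 1"
      unfolding G_def using hol
      by (intro holomorphic_intros holomorphic_on_compose_gen[unfolded o_def, of \<phi> _ g "halfplane 0"]) auto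
    moreover have "G 0 = 0" using p by (simp add: G_def \<phi>_def)
    moreover have "norm (G z) < 1" if "norm z < 1" for z
    proof -
      have "norm (G z) = c * norm (g (\<phi> z))" using c by (simp add: G_def norm_mult)
      also have "\<dots> \<le> c * 1" using c bd[OF Re_\<phi>[OF that]] by (intro mult_left_mono) auto
      finally show ?thesis using c by simp
    qed
    ultimately have *: "norm (G (blaschke p s)) \<le> norm (blaschke p s)"
      using Schwarz_Lemma(1)[of G "blaschke p s"] norm_blaschke_less_1[OF p(1) s] by blast
    have nz: "s + cnj p \<noteq> 0" "p + cnj p \<noteq> 0"
      using blaschke_denom_nonzero[OF p(1) s] blaschke_denom_nonzero[OF p(1) p(1)] .
    have "1 - blaschke p s = (p + cnj p) / (s + cnj p)"
      using nz by (simp add: blaschke_def field_simps)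
    moreover have "p + cnj p * blaschke p s = s * (p + cnj p) / (s + cnj p)"
      using nz by (simp add: blaschke_def field_simps)
    ultimately have "\<phi> (blaschke p s) = s"
      using nz by (simp add: \<phi>_def)
    with * c show ?thesis by (simp add: G_def norm_mult)
  qed
  have "((\<lambda>c. c * norm (g s)) \<longlongrightarrow> 1 * norm (g s)) (at_left (1::real))"
    by (intro tendsto_intros)
  moreover have "\<forall>\<^sub>F c in at_left (1::real). c * norm (g s) \<le> norm (blaschke p s)"
    using eventually_at_left_real[of 0 1] by (rule eventually_mono) (auto intro!: scaled)
  ultimately show ?thesis
    using tendsto_upperbound[of "\<lambda>c. c * norm (g s)" "1 * norm (g s)" "at_left (1::real)"] by simp
qed

text \<open>Off \<open>p\<close> the bound on the quotient is \<open>Schwarz_halfplane\<close>; at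
  \<open>p\<close>, where numerator and denominator both vanish, it follows by continuity.\<close>

lemma blaschke_division:
  assumes hol: "g holomorphic_on halfplane 0"
    and bd: "\<And>s. Re s > 0 \<Longrightarrow> norm (g s) \<le> 1"
    and p: "Re p > 0" "g p = 0"
  obtains h where "h holomorphic_on halfplane 0" "\<And>s. Re s > 0 \<Longrightarrow> norm (h s) \<le> 1"
    "\<And>s. Re s > 0 \<Longrightarrow> g s = blaschke p s * h s"
proof -
  define k where "k z = (if z = p then deriv g p else (g z - g p) / (z - p))" for z
  define h where "h s = k s * (s + cnj p)" for s
  have "k holomorphic_on halfplane 0"
    unfolding k_def by (rule pole_lemma[OF hol]) (use p in \<open>auto simp: interior_open\<close>)
  then have hhol: "h holomorphic_on halfplane 0"
    unfolding h_def by (intro holomorphic_intros)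
  have geq: "g s = blaschke p s * h s" if "Re s > 0" for s
    using blaschke_denom_nonzero[OF p(1) that] p
    by (auto simp: h_def k_def blaschke_def)
  have off: "norm (h s) \<le> 1" if "Re s > 0" "s \<noteq> p" for s
  proof -
    have "blaschke p s \<noteq> 0"
      using that blaschke_denom_nonzero[OF p(1) that(1)] by (simp add: blaschke_def)
    moreover have "norm (blaschke p s) * norm (h s) \<le> norm (blaschke p s) * 1"
      using Schwarz_halfplane[OF hol bd p that(1)] geq[OF that(1)] by (simp add: norm_mult)
    ultimately show ?thesis
      by (metis mult_le_cancel_left_pos zero_less_norm_iff)
  qed
  have "isCont h p"
    using hhol p by (intro continuous_on_interior[OF holomorphic_on_imp_continuous_on])
      (auto simp: interior_open)
  then have "((\<lambda>s. norm (h s)) \<longlongrightarrow> norm (h p)) (at p)"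
    by (intro tendsto_norm) (simp add: isCont_def)
  moreover have "\<forall>\<^sub>F s in at p. norm (h s) \<le> 1"
  proof -
    have "\<forall>\<^sub>F s in at p. s \<in> halfplane 0"
      using p by (intro eventually_at_in_open') (auto)
    then show ?thesis
      using eventually_neq_at_within[of p p UNIV]
      by eventually_elim (auto intro!: off)
  qed
  ultimately have "norm (h p) \<le> 1"
    by (intro tendsto_upperbound[of "\<lambda>s. norm (h s)" "norm (h p)" "at p"]) auto
  with off have "norm (h s) \<le> 1" if "Re s > 0" for s
    using that by (cases "s = p") auto
  with hhol geq show thesis by (intro that) auto
qed

lemma eventually_nonzero_at:
  assumes "g holomorphic_on S" "open S" "connected S" "w \<in> S" "g w \<noteq> 0" "q \<in> S"
  shows "\<forall>\<^sub>F z in at q. g z \<noteq> 0"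
  using non_zero_neighbour_alt[OF assms(1-3,6,4,5)] by (rule eventually_mono) auto

text \<open>Blaschke factors are divided out one at a time, by induction on the total multiplicity
  over \<open>F\<close>. The point \<open>w\<close> with \<open>g w \<noteq> 0\<close> excludes the
  zero function, so that all orders are meaningful.\<close>

lemma norm_le_prod_blaschke:
  assumes "g holomorphic_on halfplane 0" "\<And>s. Re s > 0 \<Longrightarrow> norm (g s) \<le> 1"
    and "finite F" "F \<subseteq> halfplane 0" "Re w > 0" "g w \<noteq> 0"
  shows "norm (g w) \<le> (\<Prod>p\<in>F. norm (blaschke p w) ^ nat (zorder g p))"
  using assms(1,2,6)
proof (induction "\<Sum>p\<in>F. nat (zorder g p)" arbitrary: g)
  case 0
  then have "\<forall>p\<in>F. nat (zorder g p) = 0" using \<open>finite F\<close> by simp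
  then show ?case using 0 \<open>Re w > 0\<close> by simp
next
  case (Suc n)
  have ana: "k analytic_on {q}" if "k holomorphic_on halfplane 0" "q \<in> F" for k q
    using that assms(4) open_halfplane[of 0] analytic_at by blast
  have ev: "\<forall>\<^sub>F z in at q. k z \<noteq> 0"
    if "k holomorphic_on halfplane 0" "q \<in> F" "k w \<noteq> 0" for k q
    by (rule eventually_nonzero_at[of _ "halfplane 0" w])
      (use that assms in \<open>auto\<close>)
  obtain p where p: "p \<in> F" "nat (zorder g p) > 0"
    using Suc(2) by (metis not_gr_zero sum.neutral zero_less_Suc)
  have Rep: "Re q > 0" if "q \<in> F" for q using that assms(4) by (auto)
  have "\<exists>\<^sub>F z in at p. g z \<noteq> 0"
    using ev[OF Suc(3) p(1) Suc(5)] by (rule eventually_frequently[rotated]) simp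
  with p have "g p = 0"
    using zorder_pos_iff'[OF ana[OF Suc(3) p(1)]] by simp
  then obtain h where h: "h holomorphic_on halfplane 0" "\<And>s. Re s > 0 \<Longrightarrow> norm (h s) \<le> 1"
    "\<And>s. Re s > 0 \<Longrightarrow> g s = blaschke p s * h s"
    using blaschke_division[OF Suc(3,4) Rep[OF p(1)]] by metis
  have hw: "h w \<noteq> 0" using h(3)[of w] Suc(5) assms(5) by auto
  have bhol: "blaschke p holomorphic_on halfplane 0"
    unfolding blaschke_def using blaschke_denom_nonzero Rep[OF p(1)]
    by (intro holomorphic_intros) (auto)
  have zg: "zorder g q = zorder (blaschke p) q + zorder h q" if "q \<in> F" for q
  proof -
    have e: "\<forall>\<^sub>F z in at q. z \<in> halfplane 0"
      using that assms(4) by (intro eventually_at_in_open') auto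
    then have "\<forall>\<^sub>F z in at q. g z = blaschke p z * h z"
      by eventually_elim (auto simp: h(3))
    then have "zorder g q = zorder (\<lambda>z. blaschke p z * h z) q"
      by (intro zorder_cong) auto
    moreover have "\<forall>\<^sub>F z in at q. blaschke p z * h z \<noteq> 0"
      using e ev[OF Suc(3) that Suc(5)] by eventually_elim (auto simp: h(3))
    ultimately show ?thesis
      using zorder_times_analytic[OF ana[OF bhol that] ana[OF h(1) that]] by simp
  qed
  have zb: "zorder (blaschke p) q = (if q = p then 1 else 0)" if "q \<in> F" for q
  proof (cases "q = p")
    case True
    have "zorder (blaschke p) p = 1"
    proof (rule zorder_eqI[where S = "halfplane 0" and g = "\<lambda>s. 1 / (s + cnj p)"])
      show "(\<lambda>s. 1 / (s + cnj p)) holomorphic_on halfplane 0"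
        using blaschke_denom_nonzero Rep[OF p(1)]
        by (intro holomorphic_intros) (auto)
    qed (use Rep[OF p(1)] blaschke_denom_nonzero[OF Rep[OF p(1)] Rep[OF p(1)]] in
        \<open>auto simp: blaschke_def\<close>)
    with True show ?thesis by simp
  next
    case False
    then have "blaschke p q \<noteq> 0"
      using blaschke_denom_nonzero[OF Rep[OF p(1)] Rep[OF that]] by (simp add: blaschke_def)
    with False show ?thesis using zorder_eq_0I[OF ana[OF bhol that]] by simp
  qed
  have zh0: "zorder h q \<ge> 0" if "q \<in> F" for q
    by (rule zorder_ge_0[OF ana[OF h(1) that]], rule eventually_frequently[OF _ ev[OF h(1) that hw]]) simp
  \<comment> \<open>One division lowers the multiplicity at \<open>p\<close> by exactly one and
    leaves the others alone.\<close>
  have nat_zg: "nat (zorder g q) = (if q = p then 1 else 0) + nat (zorder h q)" if "q \<in> F" for q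
    using zg[OF that] zb[OF that] zh0[OF that] by auto
  have "(\<Sum>q\<in>F. nat (zorder g q)) = (\<Sum>q\<in>F. (if q = p then 1 else 0) + nat (zorder h q))"
    by (intro sum.cong) (auto simp: nat_zg)
  also have "\<dots> = 1 + (\<Sum>q\<in>F. nat (zorder h q))"
    using p(1) \<open>finite F\<close> by (simp add: sum.distrib)
  finally have "n = (\<Sum>q\<in>F. nat (zorder h q))" using Suc(2) by simp
  from Suc(1)[OF this h(1,2) hw]
  have IH: "norm (h w) \<le> (\<Prod>q\<in>F. norm (blaschke q w) ^ nat (zorder h q))" by simp
  have "(\<Prod>q\<in>F. norm (blaschke q w) ^ nat (zorder g q)) =
      (\<Prod>q\<in>F. norm (blaschke q w) ^ (if q = p then 1 else 0) * norm (blaschke q w) ^ nat (zorder h q))"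
    by (intro prod.cong) (auto simp: nat_zg power_add)
  also have "\<dots> = (\<Prod>q\<in>F. norm (blaschke q w) ^ (if q = p then 1 else 0)) *
      (\<Prod>q\<in>F. norm (blaschke q w) ^ nat (zorder h q))"
    by (simp add: prod.distrib)
  also have "(\<Prod>q\<in>F. norm (blaschke q w) ^ (if q = p then 1 else 0)) =
      (\<Prod>q\<in>F. if q = p then norm (blaschke q w) else 1)"
    by (intro prod.cong) auto
  also have "\<dots> = norm (blaschke p w)"
    using p(1) \<open>finite F\<close> by simp
  finally show ?case
    using IH h(3)[OF assms(5)] by (simp add: norm_mult mult_left_mono)
qed

text \<open>A Jensen-type inequality: \<open>1 + y \<le> exp y\<close> turns each factor into an
  exponential, and the logarithm makes the product bound additive. For \<open>p\<close> within a
  distance of order \<open>Re w\<close> of \<open>w\<close> the weight is comparable to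
  \<open>Re p / Re w\<close>, which is what connects it with \<open>Nf\<close>.\<close>

lemma sum_zorder_halfplane_le:
  assumes "g holomorphic_on halfplane 0" "\<And>s. Re s > 0 \<Longrightarrow> norm (g s) \<le> 1"
    and "finite F" "F \<subseteq> halfplane 0" "Re w > 0" "g w \<noteq> 0"
  shows "(\<Sum>p\<in>F. nat (zorder g p) * (2 * Re w * Re p / (norm (w + cnj p))\<^sup>2)) \<le> - ln (norm (g w))"
proof -
  define x where "x p = 2 * Re w * Re p / (norm (w + cnj p))\<^sup>2" for p
  have fac: "norm (blaschke p w) \<le> exp (- x p)" if "p \<in> F" for p
  proof -
    have p: "Re p > 0" using that assms(4) by (auto)
    have "(norm (blaschke p w))\<^sup>2 = 1 + (- 2 * x p)"
      unfolding x_def by (subst norm_blaschke_sq[OF p assms(5)]) simp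
    also have "\<dots> \<le> exp (- 2 * x p)" by (rule exp_ge_add_one_self)
    also have "\<dots> = (exp (- x p))\<^sup>2" by (simp flip: exp_double)
    finally show ?thesis by (rule power2_le_imp_le) simp
  qed
  have "norm (g w) \<le> (\<Prod>p\<in>F. norm (blaschke p w) ^ nat (zorder g p))"
    by (rule norm_le_prod_blaschke) (use assms in auto)
  also have "\<dots> \<le> (\<Prod>p\<in>F. exp (- x p) ^ nat (zorder g p))"
    by (intro prod_mono conjI power_mono fac) auto
  also have "\<dots> = exp (- (\<Sum>p\<in>F. nat (zorder g p) * x p))"
    using \<open>finite F\<close> by (simp add: exp_sum exp_of_nat_mult[symmetric] sum_negf[symmetric])
  finally have "ln (norm (g w)) \<le> ln (exp (- (\<Sum>p\<in>F. nat (zorder g p) * x p)))"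
    using assms(6) by (subst ln_le_cancel_iff) auto
  then show ?thesis unfolding x_def by simp
qed

section \<open>Absolutely convergent Dirichlet series\<close>

text \<open>
  The frequencies \<open>\<nu>\<close> need not be distinct: this makes the closure under products and infinite sums a
  mere reindexing, and equal frequencies are collected only once, in \<open>abs_dirichlet_imp_sums\<close>.
\<close>
definition abs_dirichlet :: "(complex \<Rightarrow> complex) \<Rightarrow> real \<Rightarrow> bool" where
  "abs_dirichlet g B \<longleftrightarrow> (\<exists>(c :: nat \<Rightarrow> complex) (\<nu> :: nat \<Rightarrow> nat) S. (\<forall>i. \<nu> i \<ge> 1) \<and> S \<le> B \<and>
     ((\<lambda>i. norm (c i) / real (\<nu> i)) has_sum S) UNIV \<and>
     (\<forall>s. Re s \<ge> 1 \<longrightarrow> ((\<lambda>i. c i * of_nat (\<nu> i) powr (- s)) has_sum g s) UNIV))"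

lemma norm_nat_powr_le:
  assumes "n \<ge> 1" "Re s \<ge> 1"
  shows "norm (of_nat n powr (- s) :: complex) \<le> 1 / real n"
proof -
  have "norm (of_nat n powr (- s) :: complex) = real n powr (- Re s)"
    using assms norm_powr_real_powr[of "of_nat n" "- s"] by simp
  also have "\<dots> \<le> real n powr (- 1)" using assms by (intro powr_mono) auto
  finally show ?thesis using assms by (simp add: powr_minus_divide)
qed

lemma abs_dirichlet_norm_le:
  assumes "abs_dirichlet g B" "Re s \<ge> 1"
  shows "norm (g s) \<le> B"
proof -
  obtain c :: "nat \<Rightarrow> complex" and \<nu> S where *: "\<And>i. \<nu> i \<ge> 1" "S \<le> B"
    "((\<lambda>i. norm (c i) / real (\<nu> i)) has_sum S) UNIV"
    "((\<lambda>i. c i * of_nat (\<nu> i) powr (- s)) has_sum g s) UNIV"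
    using assms unfolding abs_dirichlet_def by metis
  have "norm (g s) \<le> S"
  proof (rule norm_infsum_le[OF *(4,3)])
    fix i show "norm (c i * of_nat (\<nu> i) powr (- s)) \<le> norm (c i) / real (\<nu> i)"
      using mult_left_mono[OF norm_nat_powr_le[OF *(1)[of i] assms(2)], of "norm (c i)"]
      by (simp add: norm_mult)
  qed
  with *(2) show ?thesis by simp
qed

lemma abs_dirichlet_cong:
  assumes "abs_dirichlet g B" "\<And>s. Re s \<ge> 1 \<Longrightarrow> h s = g s" "B \<le> B'"
  shows "abs_dirichlet h B'"
proof -
  obtain c :: "nat \<Rightarrow> complex" and \<nu> S where *: "\<forall>i. \<nu> i \<ge> (1::nat)" "S \<le> B"
    "((\<lambda>i. norm (c i) / real (\<nu> i)) has_sum S) UNIV"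
    "\<forall>s. Re s \<ge> 1 \<longrightarrow> ((\<lambda>i. c i * of_nat (\<nu> i) powr (- s)) has_sum g s) UNIV"
    using assms(1) unfolding abs_dirichlet_def by blast
  have "S \<le> B'" using *(2) assms(3) by simp
  moreover have "\<forall>s. Re s \<ge> 1 \<longrightarrow> ((\<lambda>i. c i * of_nat (\<nu> i) powr (- s)) has_sum h s) UNIV"
    using *(4) assms(2) by simp
  ultimately show ?thesis unfolding abs_dirichlet_def using *(1,3) by blast
qed

lemma abs_dirichlet_nat_powr:
  assumes "n \<ge> 1"
  shows "abs_dirichlet (\<lambda>s. of_nat n powr (- s)) (1 / real n)"
  unfolding abs_dirichlet_def
proof (intro exI conjI allI impI)
  show "((\<lambda>i. norm (if i = 0 then 1 else 0 :: complex) / real n) has_sum 1 / real n) UNIV"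
    by (rule has_sum_finite_neutralI[where B = "{0}"]) auto
  show "((\<lambda>i. (if i = (0::nat) then 1 else 0) * of_nat n powr (- s)) has_sum of_nat n powr (- s)) UNIV" for s :: complex
    by (rule has_sum_finite_neutralI[where B = "{0}"]) auto
qed (use assms in auto)

lemma abs_dirichlet_const: "abs_dirichlet (\<lambda>s. c) (norm c)"
  unfolding abs_dirichlet_def
proof (intro exI conjI allI impI)
  show "((\<lambda>i. norm (if i = (0::nat) then c else 0) / real 1) has_sum norm c) UNIV"
    by (rule has_sum_finite_neutralI[where B = "{0}"]) auto
  show "((\<lambda>i. (if i = (0::nat) then c else 0) * of_nat 1 powr (- s)) has_sum c) UNIV" for s :: complex
    by (rule has_sum_finite_neutralI[where B = "{0}"]) auto
qed auto

text \<open>Fubini for a double series that is absolutely summable with the weights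
  \<open>1 / \<nu>\<close>; \<open>prod_decode\<close> turns the pairs into one index. It plays the
  role of completeness of the algebra: sums, products, inverses and the limit of the tower all rest
  on it.\<close>

lemma abs_dirichlet_has_sum:
  assumes g: "\<And>n::nat. abs_dirichlet (g n) (B n)" and B: "(B has_sum C) UNIV"
    and h: "\<And>s. Re s \<ge> 1 \<Longrightarrow> ((\<lambda>n. g n s) has_sum h s) UNIV"
  shows "abs_dirichlet h C"
proof -
  obtain c :: "nat \<Rightarrow> nat \<Rightarrow> complex" and \<nu> S where *: "\<And>n i. \<nu> n i \<ge> (1::nat)" "\<And>n. S n \<le> B n"
    "\<And>n. ((\<lambda>i. norm (c n i) / real (\<nu> n i)) has_sum S n) UNIV"
    "\<And>n s. Re s \<ge> 1 \<Longrightarrow> ((\<lambda>i. c n i * of_nat (\<nu> n i) powr (- s)) has_sum g n s) UNIV"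
  proof -
    define P where "P n c \<nu> S \<longleftrightarrow> (\<forall>i. \<nu> i \<ge> 1) \<and> S \<le> B n \<and>
      ((\<lambda>i. norm (c i) / real (\<nu> i)) has_sum S) UNIV \<and>
      (\<forall>s. Re s \<ge> 1 \<longrightarrow> ((\<lambda>i. c i * of_nat (\<nu> i) powr (- s)) has_sum g n s) UNIV)"
      for n and c :: "nat \<Rightarrow> complex" and \<nu> :: "nat \<Rightarrow> nat" and S
    have "\<forall>n. \<exists>c \<nu> S. P n c \<nu> S" using g unfolding abs_dirichlet_def P_def by blast
    from choice[OF this] obtain c where "\<forall>n. \<exists>\<nu> S. P n (c n) \<nu> S" by blast
    from choice[OF this] obtain \<nu> where "\<forall>n. \<exists>S. P n (c n) (\<nu> n) S" by blast
    from choice[OF this] obtain S where "\<forall>n. P n (c n) (\<nu> n) (S n)" by blast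
    then show thesis by (intro that[of \<nu> S c]) (auto simp: P_def)
  qed
  have S0: "S n \<ge> 0" for n by (rule has_sum_nonneg[OF *(3)]) simp
  have "S summable_on UNIV"
    by (rule summable_on_comparison_test[OF has_sum_imp_summable[OF B]]) (use * S0 in auto)
  then obtain S' where S': "(S has_sum S') UNIV" by (auto simp: summable_on_def)
  have "S' \<le> C" by (rule has_sum_mono[OF S' B]) (use * in auto)
  define c' where "c' = (\<lambda>(n, i). c n i)"
  define \<nu>' where "\<nu>' = (\<lambda>(n, i). \<nu> n i)"
  have bij: "bij_betw prod_decode UNIV (UNIV \<times> UNIV)" using bij_prod_decode by simp
  have nsum: "(\<lambda>p. norm (c' p) / real (\<nu>' p)) summable_on (UNIV \<times> UNIV)"
    by (rule summable_on_SigmaI[where g = S])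
      (simp_all add: c'_def \<nu>'_def *(3) \<open>S summable_on UNIV\<close>)
  have "((\<lambda>p. norm (c' p) / real (\<nu>' p)) has_sum S') (UNIV \<times> UNIV)"
    by (rule has_sum_SigmaI[where g = S]) (use *(3) S' nsum in \<open>simp_all add: c'_def \<nu>'_def\<close>)
  then have 1: "((\<lambda>i. norm (c' (prod_decode i)) / real (\<nu>' (prod_decode i))) has_sum S') UNIV"
    using has_sum_reindex_bij_betw[OF bij, of "\<lambda>p. norm (c' p) / real (\<nu>' p)"] by simp
  have 2: "((\<lambda>i. c' (prod_decode i) * of_nat (\<nu>' (prod_decode i)) powr (- s)) has_sum h s) UNIV"
    if s: "Re s \<ge> 1" for s
  proof -
    have "(\<lambda>p. norm (c' p * of_nat (\<nu>' p) powr (- s))) summable_on (UNIV \<times> UNIV)"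
    proof (rule Infinite_Sum.abs_summable_on_comparison_test'[OF nsum])
      fix p
      have "\<nu>' p \<ge> 1" using *(1) by (cases p) (simp add: \<nu>'_def)
      from mult_left_mono[OF norm_nat_powr_le[OF this s], of "norm (c' p)"]
      show "norm (c' p * of_nat (\<nu>' p) powr (- s)) \<le> norm (c' p) / real (\<nu>' p)"
        by (simp add: norm_mult)
    qed
    then have "(\<lambda>p. c' p * of_nat (\<nu>' p) powr (- s)) summable_on (UNIV \<times> UNIV)"
      by (rule abs_summable_summable)
    then have "((\<lambda>p. c' p * of_nat (\<nu>' p) powr (- s)) has_sum h s) (UNIV \<times> UNIV)"
      by (rule has_sum_SigmaI[where g = "\<lambda>n. g n s", rotated 2])
        (simp_all add: c'_def \<nu>'_def *(4)[OF s] h[OF s])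
    then show ?thesis
      using has_sum_reindex_bij_betw[OF bij, of "\<lambda>p. c' p * of_nat (\<nu>' p) powr (- s)"] by simp
  qed
  show ?thesis
    unfolding abs_dirichlet_def
  proof (intro exI conjI allI impI)
    show "\<nu>' (prod_decode i) \<ge> 1" for i
      using *(1) by (cases "prod_decode i") (simp add: \<nu>'_def)
    show "S' \<le> C" by fact
    show "((\<lambda>i. norm (c' (prod_decode i)) / real (\<nu>' (prod_decode i))) has_sum S') UNIV" by (fact 1)
    show "((\<lambda>i. c' (prod_decode i) * of_nat (\<nu>' (prod_decode i)) powr (- s)) has_sum h s) UNIV"
      if "Re s \<ge> 1" for s by (rule 2[OF that])
  qed
qed

lemma abs_dirichlet_add:
  assumes "abs_dirichlet f A" "abs_dirichlet g B"
  shows "abs_dirichlet (\<lambda>s. f s + g s) (A + B)"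
proof (rule abs_dirichlet_has_sum)
  show "abs_dirichlet (if n = 0 then f else if n = 1 then g else (\<lambda>_. 0))
    (if n = 0 then A else if n = 1 then B else 0)" for n :: nat
    using assms abs_dirichlet_const[of 0] by auto
  show "((\<lambda>n::nat. if n = 0 then A else if n = 1 then B else 0) has_sum A + B) UNIV"
    by (rule has_sum_finite_neutralI[where B = "{0, 1}"]) auto
  show "((\<lambda>n::nat. (if n = 0 then f else if n = 1 then g else (\<lambda>_. 0)) s) has_sum f s + g s) UNIV" for s
    by (rule has_sum_finite_neutralI[where B = "{0, 1}"]) auto
qed

lemma abs_dirichlet_mult_nat_powr:
  assumes "abs_dirichlet g B" "n \<ge> 1"
  shows "abs_dirichlet (\<lambda>s. c * of_nat n powr (- s) * g s) (norm c / real n * B)"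
proof -
  obtain d :: "nat \<Rightarrow> complex" and \<nu> S where *: "\<And>i. \<nu> i \<ge> (1::nat)" "S \<le> B"
    "((\<lambda>i. norm (d i) / real (\<nu> i)) has_sum S) UNIV"
    "\<And>s. Re s \<ge> 1 \<Longrightarrow> ((\<lambda>i. d i * of_nat (\<nu> i) powr (- s)) has_sum g s) UNIV"
    using assms(1) unfolding abs_dirichlet_def by metis
  show ?thesis
    unfolding abs_dirichlet_def
  proof (intro exI conjI allI impI)
    show "n * \<nu> i \<ge> 1" for i using assms *(1)[of i] by simp
    show "norm c / real n * S \<le> norm c / real n * B" using *(2) by (intro mult_left_mono) auto
    show "((\<lambda>i. norm (c * d i) / real (n * \<nu> i)) has_sum norm c / real n * S) UNIV"
      using has_sum_cmult_right[OF *(3), of "norm c / real n"] by (simp add: norm_mult)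
    show "((\<lambda>i. c * d i * of_nat (n * \<nu> i) powr (- s)) has_sum c * of_nat n powr (- s) * g s) UNIV"
      if "Re s \<ge> 1" for s
    proof -
      have "(of_nat (n * \<nu> i) powr (- s) :: complex) = of_nat n powr (- s) * of_nat (\<nu> i) powr (- s)" for i
        using powr_times_real[of "of_nat n" "of_nat (\<nu> i)" "- s"] by simp
      then show ?thesis
        using has_sum_cmult_right[OF *(4)[OF that], of "c * of_nat n powr (- s)"] by (simp add: ac_simps)
    qed
  qed
qed

lemma abs_dirichlet_bound_nonneg: "abs_dirichlet g B \<Longrightarrow> B \<ge> 0"
  using abs_dirichlet_norm_le[of g B 1] norm_ge_zero[of "g 1"] by (smt (verit) one_complex.sel(1))

text \<open>The product is read as the infinite sum of the shifted copies
  \<open>d i * \<nu> i powr (- s) * g s\<close> of \<open>g\<close>, so the closure under infinite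
  sums does all the work.\<close>

lemma abs_dirichlet_mult:
  assumes "abs_dirichlet f A" "abs_dirichlet g B"
  shows "abs_dirichlet (\<lambda>s. f s * g s) (A * B)"
proof -
  obtain d :: "nat \<Rightarrow> complex" and \<nu> S where *: "\<And>i. \<nu> i \<ge> (1::nat)" "S \<le> A"
    "((\<lambda>i. norm (d i) / real (\<nu> i)) has_sum S) UNIV"
    "\<And>s. Re s \<ge> 1 \<Longrightarrow> ((\<lambda>i. d i * of_nat (\<nu> i) powr (- s)) has_sum f s) UNIV"
    using assms(1) unfolding abs_dirichlet_def by metis
  have "abs_dirichlet (\<lambda>s. f s * g s) (S * B)"
  proof (rule abs_dirichlet_has_sum)
    show "abs_dirichlet (\<lambda>s. d i * of_nat (\<nu> i) powr (- s) * g s) (norm (d i) / real (\<nu> i) * B)" for i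
      by (rule abs_dirichlet_mult_nat_powr[OF assms(2) *(1)])
    show "((\<lambda>i. norm (d i) / real (\<nu> i) * B) has_sum S * B) UNIV"
      by (rule has_sum_cmult_left[OF *(3)])
    show "((\<lambda>i. d i * of_nat (\<nu> i) powr (- s) * g s) has_sum f s * g s) UNIV" if "Re s \<ge> 1" for s
      by (rule has_sum_cmult_left[OF *(4)[OF that]])
  qed
  then show ?thesis
    by (rule abs_dirichlet_cong) (use *(2) abs_dirichlet_bound_nonneg[OF assms(2)] in \<open>auto intro: mult_right_mono\<close>)
qed

lemma abs_dirichlet_power:
  assumes "abs_dirichlet f A"
  shows "abs_dirichlet (\<lambda>s. f s ^ n) (A ^ n)"
proof (induction n)
  case 0
  show ?case using abs_dirichlet_const[of 1] by simp
next
  case (Suc n)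
  show ?case using abs_dirichlet_mult[OF assms Suc] by simp
qed

lemma abs_dirichlet_cmult:
  "abs_dirichlet f A \<Longrightarrow> abs_dirichlet (\<lambda>s. c * f s) (norm c * A)"
  by (rule abs_dirichlet_mult[OF abs_dirichlet_const])

lemma abs_dirichlet_diff:
  assumes "abs_dirichlet f A" "abs_dirichlet g B"
  shows "abs_dirichlet (\<lambda>s. f s - g s) (A + B)"
  using abs_dirichlet_add[OF assms(1) abs_dirichlet_cmult[OF assms(2), of "-1"]] by simp

lemma abs_dirichlet_sum:
  assumes "\<And>i. i \<in> I \<Longrightarrow> abs_dirichlet (f i) (A i)"
  shows "abs_dirichlet (\<lambda>s. \<Sum>i\<in>I. f i s) (\<Sum>i\<in>I. A i)"
  using assms
proof (induction I rule: infinite_finite_induct)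
  case (insert x F)
  then show ?case using abs_dirichlet_add[of "f x" "A x"] by simp
qed (use abs_dirichlet_const[of 0] in auto)

lemma has_sum_geometric_power:
  fixes z :: "'a :: {real_normed_field, banach}"
  assumes "norm z < 1"
  shows "((\<lambda>n. z ^ n) has_sum 1 / (1 - z)) UNIV"
proof (rule norm_summable_imp_has_sum)
  show "summable (\<lambda>n. norm (z ^ n))"
    using assms by (simp add: norm_power summable_geometric)
  show "(\<lambda>n. z ^ n) sums (1 / (1 - z))" by (rule geometric_sums[OF assms])
qed

text \<open>Neumann series in the algebra, convergent because \<open>b < 1\<close>.\<close>

lemma abs_dirichlet_inverse_one_plus:
  assumes "abs_dirichlet g b" "b < 1"
  shows "abs_dirichlet (\<lambda>s. 1 / (1 + g s)) (1 / (1 - b))"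
proof (rule abs_dirichlet_has_sum)
  have b: "b \<ge> 0" using abs_dirichlet_bound_nonneg[OF assms(1)] .
  show "abs_dirichlet (\<lambda>s. (- 1 * g s) ^ n) ((norm (- 1 :: complex) * b) ^ n)" for n
    by (intro abs_dirichlet_power abs_dirichlet_cmult assms)
  show "((\<lambda>n. (norm (- 1 :: complex) * b) ^ n) has_sum 1 / (1 - b)) UNIV"
    using has_sum_geometric_power[of b] b assms by simp
  show "((\<lambda>n. (- 1 * g s) ^ n) has_sum 1 / (1 + g s)) UNIV" if "Re s \<ge> 1" for s
    using has_sum_geometric_power[of "- 1 * g s"] abs_dirichlet_norm_le[OF assms(1) that] assms(2) by simp
qed

text \<open>Terms of equal frequency are collected here. On the fibre \<open>F n\<close> the weight
  \<open>1 / \<nu>\<close> is the constant \<open>1 / n\<close>, so summability of the weighted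
  coefficients gives that of \<open>c\<close> itself.\<close>

lemma abs_dirichlet_imp_sums:
  assumes "abs_dirichlet g B"
  obtains a :: "nat \<Rightarrow> complex" where
    "\<And>s. Re s > 1 \<Longrightarrow> (\<lambda>n. a (Suc n) * of_nat (Suc n) powr (- s)) sums g s"
proof -
  obtain c :: "nat \<Rightarrow> complex" and \<nu> S where *: "\<And>i. \<nu> i \<ge> (1::nat)"
    "((\<lambda>i. norm (c i) / real (\<nu> i)) has_sum S) UNIV"
    "\<And>s. Re s \<ge> 1 \<Longrightarrow> ((\<lambda>i. c i * of_nat (\<nu> i) powr (- s)) has_sum g s) UNIV"
    using assms unfolding abs_dirichlet_def by metis
  define F where "F n = {i. \<nu> i = n}" for n
  define a where "a n = infsum c (F n)" for n
  have sumc: "(c has_sum a n) (F n)" if "n \<ge> 1" for n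
  proof -
    have "(\<lambda>i. norm (c i) / real (\<nu> i)) summable_on F n"
      using has_sum_imp_summable[OF *(2)] by (rule summable_on_subset_banach) simp
    then have "(\<lambda>i. real n * (norm (c i) / real (\<nu> i))) summable_on F n"
      by (rule summable_on_cmult_right)
    also have "?this \<longleftrightarrow> (\<lambda>i. norm (c i)) summable_on F n"
      by (intro summable_on_cong) (use that in \<open>auto simp: F_def\<close>)
    finally have "(\<lambda>i. norm (c i)) summable_on F n" .
    then show ?thesis
      unfolding a_def by (intro has_sum_infsum) (rule abs_summable_summable)
  qed
  have bij: "bij_betw (\<lambda>i. (\<nu> i, i)) UNIV (Sigma {1..} F)"
    by (rule bij_betwI[where g = snd]) (use *(1) in \<open>auto simp: F_def\<close>)
  have bij': "bij_betw Suc UNIV {1..}"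
    by (rule bij_betwI[where g = "\<lambda>n. n - 1"]) auto
  show thesis
  proof (rule that)
    fix s :: complex assume s: "Re s > 1"
    have "((\<lambda>(n, i). c i * of_nat n powr (- s)) has_sum g s) (Sigma {1..} F)"
      using *(3)[of s] s has_sum_reindex_bij_betw[OF bij, of "\<lambda>(n, i). c i * of_nat n powr (- s)"] by simp
    then have "((\<lambda>n. a n * of_nat n powr (- s)) has_sum g s) {1..}"
      by (rule has_sum_SigmaD) (auto intro!: has_sum_cmult_left sumc)
    then have "((\<lambda>n. a (Suc n) * of_nat (Suc n) powr (- s)) has_sum g s) UNIV"
      using has_sum_reindex_bij_betw[OF bij', of "\<lambda>n. a n * of_nat n powr (- s)"] by simp
    then show "(\<lambda>n. a (Suc n) * of_nat (Suc n) powr (- s)) sums g s"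
      by (rule has_sum_imp_sums)
  qed
qed

section \<open>Windowed Dirichlet polynomials\<close>

text \<open>Reads \<open>arccos (cos \<theta>)\<close> as a distance from \<theta> to a multiple of
  \<open>2 * pi\<close>, so that an even periodic window can be built as a function of the
  cosine.\<close>

lemma arccos_cos_eq_abs:
  obtains l :: int where "arccos (cos \<theta>) = \<bar>\<theta> - 2 * pi * of_int l\<bar>"
proof -
  have *: "arccos (cos \<theta>) \<in> {0..pi}" by (simp add: arccos_lbound arccos_ubound)
  have "cos \<theta> = cos (arccos (cos \<theta>))" by simp
  then obtain n where n: "n \<in> \<int>"
    "\<theta> = arccos (cos \<theta>) + 2 * n * pi \<or> \<theta> = - arccos (cos \<theta>) + 2 * n * pi"
    unfolding cos_eq by blast
  from n(1) obtain l where "n = of_int l" by (auto elim: Ints_cases)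
  with n(2) * show thesis by (intro that[of l]) (auto simp: algebra_simps)
qed

text \<open>A trapezoid in the angle, supported in \<open>{\<delta>/2..3*\<delta>}\<close> and equal
  to 1 on \<open>{\<delta>..2*\<delta>}\<close>, becomes a continuous function of
  \<open>cos \<theta>\<close> through \<open>arccos\<close>; Weierstrass approximation makes it a
  polynomial.\<close>

lemma window_cosine_polynomial:
  fixes \<delta> \<eta> \<tau> :: real
  assumes \<delta>: "0 < \<delta>" "\<delta> \<le> 1" and \<eta>: "0 < \<eta>" "\<eta> \<le> 1/2" and \<tau>: "0 < \<tau>"
  obtains c :: "nat \<Rightarrow> real" and n where
    "\<And>\<theta>. \<bar>\<Sum>i\<le>n. c i * cos \<theta> ^ i\<bar> \<le> 1 - \<eta>"
    "\<And>\<theta>. \<theta> \<in> {\<delta>..2*\<delta>} \<Longrightarrow> (\<Sum>i\<le>n. c i * cos \<theta> ^ i) \<ge> 1 - 2 * \<eta>"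
    "\<And>\<theta>. (\<forall>l::int. \<bar>\<theta> - 2 * pi * of_int l\<bar> \<ge> 3 * \<delta>) \<Longrightarrow> \<bar>\<Sum>i\<le>n. c i * cos \<theta> ^ i\<bar> \<le> \<tau>"
    "\<And>\<theta>. \<bar>\<theta>\<bar> \<le> \<delta> / 2 \<Longrightarrow> \<bar>\<Sum>i\<le>n. c i * cos \<theta> ^ i\<bar> \<le> \<tau>"
proof -
  define h where "h \<theta> = max 0 (min 1 (min ((\<theta> - \<delta>/2) / (\<delta>/2)) ((3*\<delta> - \<theta>) / \<delta>)))" for \<theta> :: real
  \<comment> \<open>Height \<open>1 - 3*\<eta>/2\<close> with approximation error below
    \<open>\<eta>/2\<close> lands between \<open>1 - 2*\<eta>\<close> and \<open>1 - \<eta>\<close>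
    on the plateau.\<close>
  define \<psi> where "\<psi> x = (1 - 3*\<eta>/2) * h (arccos x)" for x
  have "continuous_on {-1..1} \<psi>"
    unfolding \<psi>_def h_def using \<delta> by (intro continuous_intros) auto
  moreover have "min (\<eta>/2) \<tau> > 0" using \<eta> \<tau> by simp
  ultimately obtain g where g: "real_polynomial_function g" "\<And>x. x \<in> {-1..1} \<Longrightarrow> \<bar>\<psi> x - g x\<bar> < min (\<eta>/2) \<tau>"
    using Stone_Weierstrass_real_polynomial_function[of "{-1..1}" \<psi> "min (\<eta>/2) \<tau>"] by auto
  from g(1) obtain c n where gc: "g = (\<lambda>x. \<Sum>i\<le>n. c i * x ^ i)"
    unfolding real_polynomial_function_iff_sum by blast
  have appr: "\<bar>\<psi> (cos \<theta>) - (\<Sum>i\<le>n. c i * cos \<theta> ^ i)\<bar> < min (\<eta>/2) \<tau>" for \<theta>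
    using g(2)[of "cos \<theta>"] by (simp add: gc)
  have h01: "0 \<le> h \<theta>" "h \<theta> \<le> 1" for \<theta> by (auto simp: h_def)
  have \<psi>01: "0 \<le> \<psi> x" "\<psi> x \<le> 1 - 3*\<eta>/2" for x
    using \<eta> h01[of "arccos x"] mult_left_mono[of "h (arccos x)" 1 "1 - 3*\<eta>/2"] by (auto simp: \<psi>_def)
  show thesis
  proof (rule that[of c n])
    fix \<theta>
    show "\<bar>\<Sum>i\<le>n. c i * cos \<theta> ^ i\<bar> \<le> 1 - \<eta>"
      using appr[of \<theta>] \<psi>01[of "cos \<theta>"] \<eta> by linarith
  next
    fix \<theta> assume \<theta>: "\<theta> \<in> {\<delta>..2*\<delta>}"
    then have "arccos (cos \<theta>) = \<theta>" using \<delta> pi_gt3 by (intro arccos_cos) auto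
    moreover have "h \<theta> = 1"
    proof -
      have "(\<theta> - \<delta>/2) / (\<delta>/2) \<ge> 1" "(3*\<delta> - \<theta>) / \<delta> \<ge> 1" using \<theta> \<delta> by (auto simp: field_simps)
      then show ?thesis unfolding h_def by simp
    qed
    ultimately have "\<psi> (cos \<theta>) = 1 - 3*\<eta>/2" by (simp add: \<psi>_def)
    then show "(\<Sum>i\<le>n. c i * cos \<theta> ^ i) \<ge> 1 - 2 * \<eta>"
      using appr[of \<theta>] by linarith
  next
    fix \<theta> assume \<theta>: "\<forall>l::int. \<bar>\<theta> - 2 * pi * of_int l\<bar> \<ge> 3 * \<delta>"
    obtain l :: int where "arccos (cos \<theta>) = \<bar>\<theta> - 2 * pi * of_int l\<bar>" by (rule arccos_cos_eq_abs)
    with \<theta> have "arccos (cos \<theta>) \<ge> 3 * \<delta>" by simp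
    then have "(3*\<delta> - arccos (cos \<theta>)) / \<delta> \<le> 0" using \<delta> by (simp add: divide_nonpos_pos)
    then have "h (arccos (cos \<theta>)) = 0" unfolding h_def by simp
    then show "\<bar>\<Sum>i\<le>n. c i * cos \<theta> ^ i\<bar> \<le> \<tau>" using appr[of \<theta>] by (simp add: \<psi>_def)
  next
    fix \<theta> assume \<theta>: "\<bar>\<theta>\<bar> \<le> \<delta> / 2"
    have "arccos (cos \<theta>) = arccos (cos \<bar>\<theta>\<bar>)" by (simp add: abs_if)
    also have "\<dots> = \<bar>\<theta>\<bar>" using \<theta> \<delta> pi_gt3 by (intro arccos_cos) auto
    finally have "arccos (cos \<theta>) \<le> \<delta> / 2" using \<theta> by simp
    then have "(arccos (cos \<theta>) - \<delta>/2) / (\<delta>/2) \<le> 0" using \<delta> by (simp add: divide_nonpos_pos)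
    then have "h (arccos (cos \<theta>)) = 0" unfolding h_def by simp
    then show "\<bar>\<Sum>i\<le>n. c i * cos \<theta> ^ i\<bar> \<le> \<tau>" using appr[of \<theta>] by (simp add: \<psi>_def)
  qed
qed

section \<open>Bounded Lipschitz functions on the closed half-plane\<close>

definition bounded_lipschitz :: "(complex \<Rightarrow> complex) \<Rightarrow> bool" where
  "bounded_lipschitz g \<longleftrightarrow> (\<exists>D\<ge>0. \<forall>s s'. Re s \<ge> 0 \<longrightarrow> Re s' \<ge> 0 \<longrightarrow>
     norm (g s) \<le> D \<and> norm (g s - g s') \<le> D * norm (s - s'))"

lemma bounded_lipschitz_const: "bounded_lipschitz (\<lambda>_. c)"
  unfolding bounded_lipschitz_def by (intro exI[of _ "norm c"]) auto

lemma bounded_lipschitz_add: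
  assumes "bounded_lipschitz f" "bounded_lipschitz g"
  shows "bounded_lipschitz (\<lambda>s. f s + g s)"
proof -
  obtain D E where D: "D \<ge> 0" "\<And>s s'. Re s \<ge> 0 \<Longrightarrow> Re s' \<ge> 0 \<Longrightarrow> norm (f s) \<le> D \<and> norm (f s - f s') \<le> D * norm (s - s')"
    and E: "E \<ge> 0" "\<And>s s'. Re s \<ge> 0 \<Longrightarrow> Re s' \<ge> 0 \<Longrightarrow> norm (g s) \<le> E \<and> norm (g s - g s') \<le> E * norm (s - s')"
    using assms unfolding bounded_lipschitz_def by blast
  show ?thesis unfolding bounded_lipschitz_def
  proof (intro exI[of _ "D + E"] conjI allI impI)
    fix s s' assume s: "Re s \<ge> 0" "Re s' \<ge> 0"
    show "norm (f s + g s) \<le> D + E"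
      using D(2)[OF s] E(2)[OF s] norm_triangle_ineq[of "f s" "g s"] by linarith
    have "norm (f s + g s - (f s' + g s')) \<le> norm (f s - f s') + norm (g s - g s')"
      by (rule norm_diff_triangle_ineq)
    also have "\<dots> \<le> D * norm (s - s') + E * norm (s - s')" using D(2)[OF s] E(2)[OF s] by linarith
    finally show "norm (f s + g s - (f s' + g s')) \<le> (D + E) * norm (s - s')" by (simp add: algebra_simps)
  qed (use D E in auto)
qed

lemma bounded_lipschitz_mult:
  assumes "bounded_lipschitz f" "bounded_lipschitz g"
  shows "bounded_lipschitz (\<lambda>s. f s * g s)"
proof -
  obtain D E where D: "D \<ge> 0" "\<And>s s'. Re s \<ge> 0 \<Longrightarrow> Re s' \<ge> 0 \<Longrightarrow> norm (f s) \<le> D \<and> norm (f s - f s') \<le> D * norm (s - s')"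
    and E: "E \<ge> 0" "\<And>s s'. Re s \<ge> 0 \<Longrightarrow> Re s' \<ge> 0 \<Longrightarrow> norm (g s) \<le> E \<and> norm (g s - g s') \<le> E * norm (s - s')"
    using assms unfolding bounded_lipschitz_def by blast
  show ?thesis unfolding bounded_lipschitz_def
  proof (intro exI[of _ "2 * (D * E)"] conjI allI impI)
    fix s s' assume s: "Re s \<ge> 0" "Re s' \<ge> 0"
    have "norm (f s * g s) \<le> D * E"
      unfolding norm_mult using D E D(2)[OF s] E(2)[OF s] by (intro mult_mono) auto
    also have "\<dots> \<le> 2 * (D * E)" using D(1) E(1) by simp
    finally show "norm (f s * g s) \<le> 2 * (D * E)" .
    have "f s * g s - f s' * g s' = f s * (g s - g s') + (f s - f s') * g s'"
      by (simp add: algebra_simps)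
    then have "norm (f s * g s - f s' * g s') \<le> norm (f s) * norm (g s - g s') + norm (f s - f s') * norm (g s')"
      by (metis norm_mult norm_triangle_ineq)
    also have "\<dots> \<le> D * (E * norm (s - s')) + (D * norm (s - s')) * E"
      using D(2)[OF s] E(2)[OF s] E(2)[OF s(2,1)] D(1) E(1) by (intro add_mono mult_mono) auto
    finally show "norm (f s * g s - f s' * g s') \<le> 2 * (D * E) * norm (s - s')" by (simp add: algebra_simps)
  qed (use D E in auto)
qed

lemma bounded_lipschitz_power: "bounded_lipschitz f \<Longrightarrow> bounded_lipschitz (\<lambda>s. f s ^ n)"
  by (induction n) (auto intro: bounded_lipschitz_const bounded_lipschitz_mult)

lemma bounded_lipschitz_sum:
  "(\<And>i. i \<in> I \<Longrightarrow> bounded_lipschitz (f i)) \<Longrightarrow> bounded_lipschitz (\<lambda>s. \<Sum>i\<in>I. f i s)"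
  by (induction I rule: infinite_finite_induct)
    (auto intro: bounded_lipschitz_const bounded_lipschitz_add)

lemma bounded_lipschitz_exp:
  fixes c :: real
  assumes "c \<ge> 0"
  shows "bounded_lipschitz (\<lambda>s. exp (- c * s))"
  unfolding bounded_lipschitz_def
proof (intro exI[of _ "max 1 c"] conjI allI impI)
  have le1: "norm (exp (- c * s)) \<le> 1" if "Re s \<ge> 0" for s :: complex
    using assms that by (simp add: norm_exp_eq_Re)
  fix s s' :: complex assume s: "Re s \<ge> 0" "Re s' \<ge> 0"
  show "norm (exp (- c * s)) \<le> max 1 c" using le1[OF s(1)] by linarith
  have "norm (exp (- c * s) - exp (- c * s')) \<le> c * norm (s - s')"
  proof (rule field_differentiable_bound[where S = "{s. Re s \<ge> 0}" and f' = "\<lambda>s. of_real (- c) * exp (of_real (- c) * s)"])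
    show "convex {s. Re s \<ge> 0}" by (rule convex_halfspace_Re_ge)
    show "((\<lambda>a. exp (of_real (- c) * a)) has_field_derivative of_real (- c) * exp (of_real (- c) * z))
         (at z within {s. Re s \<ge> 0})" for z
      by (auto intro!: derivative_eq_intros)
    show "norm (of_real (- c) * exp (of_real (- c) * z)) \<le> c" if "z \<in> {s. Re s \<ge> 0}" for z
      using mult_left_mono[OF le1[of z], of c] that assms by (simp add: norm_mult)
  qed (use s in auto)
  also have "\<dots> \<le> max 1 c * norm (s - s')" by (intro mult_right_mono) auto
  finally show "norm (exp (- c * s) - exp (- c * s')) \<le> max 1 c * norm (s - s')" .
qed simp

section \<open>Dirichlet polynomials with a windowed envelope\<close>

definition cosine_poly :: "(nat \<Rightarrow> real) \<Rightarrow> nat \<Rightarrow> real \<Rightarrow> real" where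
  "cosine_poly c n \<theta> = (\<Sum>i\<le>n. c i * cos \<theta> ^ i)"

text \<open>
  With \<open>z = N\<^bsup>-s\<^esup>\<close> and \<open>w = (N+1)\<^bsup>-s\<^esup>\<close> one has \<open>z w cosh(u s) = (z\<^sup>2 + w\<^sup>2)/2\<close> for the gap
  \<open>u = ln(N+1) - ln N\<close>; the carrier \<open>(z w)\<^bsup>n+1\<^esup>\<close> thus turns a polynomial of degree \<open>n\<close> in \<open>cosh(u s)\<close>
  into a Dirichlet polynomial.
\<close>
definition block_gap :: "nat \<Rightarrow> real" where
  "block_gap N = ln (real N + 1) - ln (real N)"

definition block_freq :: "nat \<Rightarrow> nat \<Rightarrow> real" where
  "block_freq n N = real (Suc n) * (ln (real N + 1) + ln (real N))"

definition block_carrier :: "nat \<Rightarrow> nat \<Rightarrow> complex \<Rightarrow> complex" where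
  "block_carrier n N s = exp (of_real (- block_freq n N) * s)"

definition block_envelope :: "(nat \<Rightarrow> real) \<Rightarrow> nat \<Rightarrow> nat \<Rightarrow> complex \<Rightarrow> complex" where
  "block_envelope c n N s = (\<Sum>i\<le>n. of_real (c i) * ((exp (of_real (block_gap N) * s) + exp (of_real (- block_gap N) * s)) / 2) ^ i)"

definition block :: "(nat \<Rightarrow> real) \<Rightarrow> nat \<Rightarrow> nat \<Rightarrow> complex \<Rightarrow> complex" where
  "block c n N s = block_carrier n N s * block_envelope c n N s"

lemma block_gap_bounds:
  assumes "N \<ge> 3"
  shows "0 < block_gap N" "block_gap N \<le> 1 / real N" "block_gap N \<le> 1"
proof -
  have "block_gap N = ln (1 + 1 / real N)"
    using assms ln_div[of "real N + 1" "real N"] by (simp add: block_gap_def add_divide_distrib)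
  moreover have "ln (1 + 1 / real N) \<le> 1 / real N" by (rule ln_add_one_self_le_self) simp
  moreover have "ln (1 + 1 / real N) > 0" using assms by (intro ln_gt_zero) simp
  moreover have "1 / real N \<le> 1" using assms by simp
  ultimately show "0 < block_gap N" "block_gap N \<le> 1 / real N" "block_gap N \<le> 1" by linarith+
qed

text \<open>\<open>N \<ge> 3\<close> enters through \<open>ln N \<ge> 1\<close>. The first bound
  makes the carrier decay at twice the rate at which the envelope error can grow when the gap is at
  most 1; the second makes the frequency large by enlarging \<open>N\<close>.\<close>

lemma block_freq_ge:
  assumes "N \<ge> 3"
  shows "block_freq n N \<ge> 2 * real (Suc n)" "block_freq n N \<ge> ln (real N)"
proof -
  have "exp 1 \<le> (3::real)" using exp_le .
  then have "ln 3 \<ge> (1::real)" by (subst ln_ge_iff) auto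
  then have 1: "ln (real N) \<ge> 1" using assms ln_le_cancel_iff[of 3 "real N"] by linarith
  have "ln (real N + 1) \<ge> ln (real N)" using assms by simp
  with 1 have 2: "ln (real N + 1) + ln (real N) \<ge> 2" "ln (real N + 1) \<ge> 0" by linarith+
  then show "block_freq n N \<ge> 2 * real (Suc n)" unfolding block_freq_def
    using mult_left_mono[of 2 "ln (real N + 1) + ln (real N)" "real (Suc n)"] by (simp add: mult.commute)
  have "1 * (ln (real N + 1) + ln (real N)) \<le> block_freq n N"
    unfolding block_freq_def using 2 by (intro mult_right_mono) auto
  then have 3: "ln (real N + 1) + ln (real N) \<le> block_freq n N" by (simp only: mult_1)
  have "ln (real N) \<le> ln (real N + 1) + ln (real N)" using 2(2) by (rule add_increasing) simp
  from this 3 show "block_freq n N \<ge> ln (real N)" by (rule order_trans)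
qed

text \<open>Division by \<open>B\<close> brings both points into the unit disc, where
  \<open>norm_power_diff\<close> applies.\<close>

lemma norm_power_diff_le:
  fixes z w :: complex
  assumes "norm z \<le> B" "norm w \<le> B" "B \<ge> 1" "i \<le> n"
  shows "norm (z ^ i - w ^ i) \<le> real i * B ^ n * norm (z - w)"
proof -
  have B: "B > 0" using assms by simp
  have "norm ((z / B) ^ i - (w / B) ^ i) \<le> real i * norm (z / B - w / B)"
    by (rule norm_power_diff) (use assms B in \<open>auto simp: norm_divide\<close>)
  also have "(z / B) ^ i - (w / B) ^ i = (z ^ i - w ^ i) / B ^ i"
    by (simp add: power_divide diff_divide_distrib)
  also have "norm \<dots> = norm (z ^ i - w ^ i) / B ^ i" using B by (simp add: norm_divide norm_power)
  also have "z / B - w / B = (z - w) / B" by (simp add: diff_divide_distrib)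
  also have "norm \<dots> = norm (z - w) / B" using B by (simp add: norm_divide)
  finally have "norm (z ^ i - w ^ i) \<le> real i * (norm (z - w) / B) * B ^ i"
    using B by (simp add: pos_divide_le_eq)
  also have "\<dots> \<le> real i * (norm (z - w) / 1) * B ^ n"
    using assms B by (intro mult_mono mult_left_mono divide_left_mono power_increasing) auto
  finally show ?thesis by (simp add: ac_simps)
qed

text \<open>A bound on \<open>{-1..1}\<close> for the derivative of the polynomial with coefficients
  \<open>c\<close>.\<close>

definition cosine_poly_lip :: "(nat \<Rightarrow> real) \<Rightarrow> nat \<Rightarrow> real" where
  "cosine_poly_lip c n = (\<Sum>i\<le>n. \<bar>c i\<bar> * real i)"

lemma cosine_poly_lip_nonneg: "cosine_poly_lip c n \<ge> 0"
  by (auto simp: cosine_poly_lip_def intro!: sum_nonneg)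

lemma block_envelope_imag:
  "block_envelope c n N (\<i> * of_real t) = of_real (cosine_poly c n (block_gap N * t))"
proof -
  have "(exp (of_real (block_gap N) * (\<i> * of_real t)) + exp (of_real (- block_gap N) * (\<i> * of_real t))) / 2 =
      of_real (cos (block_gap N * t))"
    unfolding cos_of_real[symmetric] cos_exp_eq by (simp add: ac_simps)
  then show ?thesis by (simp add: block_envelope_def cosine_poly_def)
qed

text \<open>\<open>cosh (u * s)\<close> differs from \<open>cos (u * Im s)\<close> by at most
  \<open>x * exp x\<close> with \<open>x = u * Re s\<close>; the polynomial contributes its
  Lipschitz constant and further powers of \<open>exp x\<close>. The factor \<open>Re s\<close>
  makes the error vanish on the axis.\<close>

lemma block_envelope_diff_le:
  assumes s: "Re s \<ge> 0" and N: "N \<ge> 3"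
  shows "norm (block_envelope c n N s - of_real (cosine_poly c n (block_gap N * Im s)))
    \<le> cosine_poly_lip c n * (block_gap N * Re s) * exp (real (Suc n) * (block_gap N * Re s))"
proof -
  define u where "u = block_gap N"
  have u: "u > 0" using block_gap_bounds[OF N] by (simp add: u_def)
  define x where "x = u * Re s"
  have x: "x \<ge> 0" using u s by (simp add: x_def)
  define C where "C s = (exp (of_real u * s) + exp (of_real (- u) * s)) / 2" for s :: complex
  define c0 where "c0 = C (\<i> * of_real (Im s))"
  have s_eq: "s = of_real (Re s) + \<i> * of_real (Im s)" by (rule complex_eq)
  have n1: "norm (exp (of_real u * s)) = exp x" "norm (exp (of_real (- u) * s)) = exp (- x)"
    by (simp_all add: norm_exp_eq_Re x_def)
  have nC: "norm (C s) \<le> exp x"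
  proof -
    have "norm (C s) \<le> (norm (exp (of_real u * s)) + norm (exp (of_real (- u) * s))) / 2"
      unfolding C_def norm_divide by (simp only: norm_numeral) (intro divide_right_mono norm_triangle_ineq, simp)
    also have "\<dots> \<le> (exp x + exp x) / 2" unfolding n1 using x by (intro divide_right_mono add_mono) auto
    finally show ?thesis by simp
  qed
  have "norm c0 \<le> (norm (exp (of_real u * (\<i> * of_real (Im s)))) + norm (exp (of_real (- u) * (\<i> * of_real (Im s))))) / 2"
    unfolding c0_def C_def norm_divide by (simp only: norm_numeral) (intro divide_right_mono norm_triangle_ineq, simp)
  also have "\<dots> = 1" by (simp add: norm_exp_eq_Re)
  finally have nc0: "norm c0 \<le> exp x" using x by (smt (verit) one_le_exp_iff)
  have diff: "norm (C s - c0) \<le> x * exp x"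
  proof -
    have e1: "exp (of_real u * s) = exp (of_real x) * exp (of_real u * (\<i> * of_real (Im s)))"
      by (subst s_eq) (simp add: x_def distrib_left exp_add)
    have e2: "exp (of_real (- u) * s) = exp (- of_real x) * exp (of_real (- u) * (\<i> * of_real (Im s)))"
      by (subst s_eq) (simp add: x_def distrib_left exp_add exp_diff exp_minus field_simps)
    have "C s - c0 = ((exp (of_real x) - 1) * exp (of_real u * (\<i> * of_real (Im s)))
        + (exp (- of_real x) - 1) * exp (of_real (- u) * (\<i> * of_real (Im s)))) / 2"
      unfolding C_def c0_def e1 e2 by (simp add: algebra_simps add_divide_distrib diff_divide_distrib)
    also have "norm \<dots> \<le> (norm ((exp (of_real x) - 1) * exp (of_real u * (\<i> * of_real (Im s))))
        + norm ((exp (- of_real x) - 1) * exp (of_real (- u) * (\<i> * of_real (Im s))))) / 2"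
      unfolding norm_divide by (simp only: norm_numeral) (intro divide_right_mono norm_triangle_ineq, simp)
    also have "\<dots> = (norm (exp (complex_of_real x) - 1) + norm (exp (- complex_of_real x) - 1)) / 2"
      by (simp add: norm_mult norm_exp_eq_Re)
    also have "exp (complex_of_real x) - 1 = of_real (exp x - 1)" by (simp add: exp_of_real)
    also have "exp (- complex_of_real x) - 1 = of_real (exp (- x) - 1)" by (simp flip: exp_of_real)
    also have "(norm (complex_of_real (exp x - 1)) + norm (complex_of_real (exp (- x) - 1))) / 2
        = (\<bar>exp x - 1\<bar> + \<bar>exp (- x) - 1\<bar>) / 2" unfolding norm_of_real ..
    also have "\<dots> \<le> x * exp x"
    proof -
      have "1 - x \<le> exp (- x)" using exp_ge_add_one_self[of "- x"] by linarith
      moreover from this have "(1 - x) * exp x \<le> exp (- x) * exp x" by (intro mult_right_mono) auto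
      moreover have "exp (- x) * exp x = 1" by (simp flip: exp_add)
      moreover have "exp x \<ge> 1" "exp (- x) \<le> 1" using x by auto
      moreover have "x * 1 \<le> x * exp x" using x by (intro mult_left_mono) auto
      ultimately show ?thesis by (simp add: algebra_simps)
    qed
    finally show ?thesis .
  qed
  have r0: "of_real (cosine_poly c n (u * Im s)) = (\<Sum>i\<le>n. of_real (c i) * c0 ^ i)"
    using block_envelope_imag[of c n N "Im s"] by (simp add: block_envelope_def c0_def C_def u_def)
  have "block_envelope c n N s - of_real (cosine_poly c n (u * Im s)) = (\<Sum>i\<le>n. of_real (c i) * (C s ^ i - c0 ^ i))"
    unfolding r0 by (simp add: block_envelope_def C_def u_def sum_subtractf right_diff_distrib)
  also have "norm \<dots> \<le> (\<Sum>i\<le>n. norm (of_real (c i) * (C s ^ i - c0 ^ i)))" by (rule norm_sum)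
  also have "\<dots> \<le> (\<Sum>i\<le>n. \<bar>c i\<bar> * (real i * exp x ^ n * (x * exp x)))"
  proof (rule sum_mono)
    fix i assume "i \<in> {..n}"
    then have "norm (C s ^ i - c0 ^ i) \<le> real i * exp x ^ n * norm (C s - c0)"
      using nC nc0 x by (intro norm_power_diff_le) auto
    also have "\<dots> \<le> real i * exp x ^ n * (x * exp x)" using diff by (intro mult_left_mono) auto
    finally show "norm (of_real (c i) * (C s ^ i - c0 ^ i)) \<le> \<bar>c i\<bar> * (real i * exp x ^ n * (x * exp x))"
      unfolding norm_mult by (auto intro: mult_left_mono)
  qed
  also have "\<dots> = cosine_poly_lip c n * x * (exp x ^ n * exp x)"
    by (simp add: cosine_poly_lip_def sum_distrib_right sum_distrib_left ac_simps)
  also have "exp x ^ n * exp x = exp (real (Suc n) * x)"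
    by (simp add: exp_of_nat_mult[symmetric] distrib_right exp_add)
  finally show ?thesis by (simp add: x_def u_def)
qed

lemma norm_block_carrier: "norm (block_carrier n N s) = exp (- block_freq n N * Re s)"
  by (simp add: block_carrier_def norm_exp_eq_Re)

text \<open>Half of the decay of the carrier pays for the growth of the envelope error; the other
  half remains, together with the factor \<open>Re s\<close> on which
  \<open>block_moebius_contractive\<close> depends.\<close>

lemma block_approx:
  assumes s: "Re s \<ge> 0" and N: "N \<ge> 3"
  shows "norm (block c n N s - block_carrier n N s * of_real (cosine_poly c n (block_gap N * Im s)))
    \<le> cosine_poly_lip c n * block_gap N * Re s * exp (- block_freq n N * Re s / 2)"
proof -
  define u where "u = block_gap N"
  define L where "L = block_freq n N"
  have u: "0 < u" "u \<le> 1" using block_gap_bounds[OF N] by (auto simp: u_def)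
  have L: "L \<ge> 2 * real (Suc n)" using block_freq_ge[OF N] by (simp add: L_def)
  have "norm (block c n N s - block_carrier n N s * of_real (cosine_poly c n (u * Im s)))
    = exp (- L * Re s) * norm (block_envelope c n N s - of_real (cosine_poly c n (u * Im s)))"
    by (simp add: block_def norm_block_carrier L_def norm_mult flip: right_diff_distrib)
  also have "\<dots> \<le> exp (- L * Re s) * (cosine_poly_lip c n * (u * Re s) * exp (real (Suc n) * (u * Re s)))"
    using block_envelope_diff_le[OF s N, of c n] by (intro mult_left_mono) (auto simp: u_def)
  also have "\<dots> = cosine_poly_lip c n * (u * Re s) * exp (real (Suc n) * (u * Re s) - L * Re s)"
    by (simp add: exp_diff exp_minus field_simps)
  also have "\<dots> \<le> cosine_poly_lip c n * (u * Re s) * exp (- L * Re s / 2)"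
  proof -
    have "real (Suc n) * (u * Re s) \<le> real (Suc n) * (1 * Re s)"
      using u s by (intro mult_left_mono mult_right_mono) auto
    also have "\<dots> \<le> L / 2 * Re s" using L s mult_right_mono[of "real (Suc n)" "L/2" "Re s"] by simp
    finally have "real (Suc n) * (u * Re s) - L * Re s \<le> - L * Re s / 2" by (simp add: field_simps)
    then show ?thesis
      using u s cosine_poly_lip_nonneg by (intro mult_left_mono) auto
  qed
  finally show ?thesis by (simp add: u_def L_def ac_simps)
qed

lemma block_approx_uniform:
  assumes s: "Re s \<ge> 0" and N: "N \<ge> 3"
  shows "norm (block c n N s - block_carrier n N s * of_real (cosine_poly c n (block_gap N * Im s)))
    \<le> cosine_poly_lip c n * block_gap N"
proof -
  have L: "block_freq n N \<ge> 2" using block_freq_ge(1)[OF N, of n] by simp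
  have "exp (- block_freq n N * Re s / 2) \<le> exp (- Re s)"
    using L s mult_right_mono[of 2 "block_freq n N" "Re s"] by simp
  then have "Re s * exp (- block_freq n N * Re s / 2) \<le> Re s * exp (- Re s)"
    using s by (intro mult_left_mono)
  also have "\<dots> \<le> 1"
  proof -
    have "Re s \<le> exp (Re s)" using exp_ge_add_one_self[of "Re s"] by linarith
    then show ?thesis by (simp add: exp_minus field_simps)
  qed
  finally have "Re s * exp (- block_freq n N * Re s / 2) \<le> 1" .
  then have "cosine_poly_lip c n * block_gap N * (Re s * exp (- block_freq n N * Re s / 2))
      \<le> cosine_poly_lip c n * block_gap N * 1"
    using cosine_poly_lip_nonneg[of c n] block_gap_bounds[OF N] by (intro mult_left_mono) auto
  with block_approx[OF s N, of c n] show ?thesis by (simp add: mult.assoc)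
qed

text \<open>With \<open>v = Z * x\<close> and the real number \<open>r0\<close> as envelope, the
  numerator is \<open>Z * (r0 + v)\<close>, the denominator \<open>1 + r0 * v\<close>, and
  \<open>norm (r0 + v) \<le> norm (1 + r0 * v)\<close>. The factor \<open>Z\<close> leaves a gap of
  at least \<open>(1 - exp (- y)) * \<eta>\<close>, which is of order \<open>Re s\<close> near the
  axis; so is the error of \<open>block_approx\<close>, with a constant that \<open>small\<close>
  keeps below that of the gap.\<close>

lemma block_moebius_contractive:
  assumes s: "Re s > 0" and N: "N \<ge> 3" and x: "norm x \<le> 1" and \<eta>: "0 < \<eta>" "\<eta> \<le> 1"
    and r: "\<bar>cosine_poly c n (block_gap N * Im s)\<bar> \<le> 1 - \<eta>"
    and small: "4 * cosine_poly_lip c n * block_gap N \<le> \<eta>"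
  shows "norm (block c n N s + block_carrier n N s ^ 2 * x) < norm (1 + block c n N s * x)"
proof -
  define r0 where "r0 = cosine_poly c n (block_gap N * Im s)"
  define Z where "Z = block_carrier n N s"
  define a where "a = block c n N s"
  define L where "L = block_freq n N"
  define E where "E = norm (a - Z * of_real r0)"
  define v where "v = Z * x"
  have L: "L \<ge> 2" using block_freq_ge(1)[OF N, of n] by (simp add: L_def)
  define y where "y = L * Re s"
  have y: "y > 0" using L s by (simp add: y_def)
  have nZ: "norm Z = exp (- y)" by (simp add: Z_def norm_block_carrier y_def L_def)
  have nv: "norm v \<le> exp (- y)" using x by (simp add: v_def norm_mult nZ mult_left_le)
  then have nv1: "norm v \<le> 1" using y by (smt (verit) exp_le_one_iff)
  have id: "(norm (1 + r0 * v))\<^sup>2 - (norm (r0 + v))\<^sup>2 = (1 - r0\<^sup>2) * (1 - (norm v)\<^sup>2)"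
    unfolding cmod_power2 by (simp add: power2_eq_square algebra_simps)
  have "r0\<^sup>2 \<le> 1" using r \<eta> by (simp add: abs_square_le_1 r0_def)
  moreover have "(norm v)\<^sup>2 \<le> 1" using nv1 by (simp add: abs_square_le_1)
  ultimately have "(norm (r0 + v))\<^sup>2 \<le> (norm (1 + r0 * v))\<^sup>2" using id by (smt (verit) mult_nonneg_nonneg)
  then have A: "norm (r0 + v) \<le> norm (1 + r0 * v)" by (rule power2_le_imp_le) simp
  have "norm (r0 * v) \<le> 1 - \<eta>"
    using r nv1 mult_mono[of "\<bar>r0\<bar>" "1 - \<eta>" "norm v" 1] \<eta> by (simp add: norm_mult r0_def)
  then have B: "norm (1 + r0 * v) \<ge> \<eta>"
    using norm_diff_ineq[of 1 "r0 * v"] by simp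
  have "a + Z^2 * x = Z * (r0 + v) + (a - Z * of_real r0)"
    by (simp add: v_def power2_eq_square algebra_simps)
  then have 1: "norm (a + Z^2 * x) \<le> exp (- y) * norm (r0 + v) + E"
    by (metis E_def nZ norm_mult norm_triangle_ineq)
  have "1 + r0 * v = (1 + a * x) - (a - Z * of_real r0) * x"
    by (simp add: v_def algebra_simps)
  then have "norm (1 + r0 * v) \<le> norm (1 + a * x) + E * norm x"
    by (metis E_def norm_mult norm_triangle_ineq4)
  then have 2: "norm (1 + r0 * v) \<le> norm (1 + a * x) + E"
    using mult_left_le[of "norm x" E] x by (smt (verit) E_def norm_ge_zero)
  \<comment> \<open>Both sides are compared after multiplication by \<open>1 + y\<close>:
    \<open>exp (- y / 2) * (1 + y) \<le> 2\<close> for the error, and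
    \<open>(1 - exp (- y)) * (1 + y) \<ge> y\<close> for the gap.\<close>
  have 3: "2 * E < (1 - exp (- y)) * \<eta>"
  proof -
    have E: "E \<le> cosine_poly_lip c n * block_gap N * Re s * exp (- y / 2)"
      using block_approx[OF less_imp_le[OF s] N, of c n]
      by (simp add: E_def a_def Z_def r0_def y_def L_def)
    have "exp (- y / 2) * (1 + y) \<le> 2"
    proof -
      have "1 + y \<le> 2 * exp (y / 2)" using exp_ge_add_one_self[of "y / 2"] by linarith
      then have "exp (- (y / 2)) * (1 + y) \<le> exp (- (y / 2)) * (2 * exp (y / 2))" by (intro mult_left_mono) auto
      also have "\<dots> = 2" by (simp add: exp_minus)
      finally show ?thesis by simp
    qed
    moreover have "cosine_poly_lip c n * block_gap N * Re s \<ge> 0"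
      using cosine_poly_lip_nonneg[of c n] block_gap_bounds[OF N] s by simp
    ultimately have "cosine_poly_lip c n * block_gap N * Re s * (exp (- y / 2) * (1 + y))
        \<le> cosine_poly_lip c n * block_gap N * Re s * 2" by (intro mult_left_mono)
    moreover have "E * (1 + y) \<le> cosine_poly_lip c n * block_gap N * Re s * exp (- y / 2) * (1 + y)"
      using E y by (intro mult_right_mono) auto
    ultimately have "4 * (E * (1 + y)) \<le> 2 * (4 * cosine_poly_lip c n * block_gap N) * Re s"
      by (simp add: algebra_simps)
    also have "\<dots> \<le> 2 * \<eta> * Re s" using small s by (intro mult_right_mono mult_left_mono) auto
    also have "\<dots> \<le> \<eta> * y" using L s \<eta> by (simp add: y_def)
    finally have 4: "2 * (2 * (E * (1 + y))) \<le> \<eta> * y" by simp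
    have "exp (- y) * (1 + y) \<le> 1"
      by (simp add: exp_minus field_simps)
    then have "y \<le> (1 - exp (- y)) * (1 + y)" by (simp add: algebra_simps)
    then have "\<eta> * y \<le> \<eta> * ((1 - exp (- y)) * (1 + y))" using \<eta> by (intro mult_left_mono) auto
    with 4 have "2 * (2 * E) * (1 + y) \<le> ((1 - exp (- y)) * \<eta>) * (1 + y)" by (simp add: algebra_simps)
    then have "2 * (2 * E) \<le> (1 - exp (- y)) * \<eta>" using y by (simp add: mult_le_cancel_right_pos)
    moreover have "(1 - exp (- y)) * \<eta> > 0" using y \<eta> by simp
    moreover have "E \<ge> 0" by (simp add: E_def)
    ultimately show ?thesis by linarith
  qed
  have "exp (- y) * norm (r0 + v) \<le> exp (- y) * norm (1 + r0 * v)" using A by (intro mult_left_mono) auto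
  moreover have "(1 - exp (- y)) * \<eta> \<le> (1 - exp (- y)) * norm (1 + r0 * v)"
    using B y by (intro mult_left_mono) auto
  ultimately have "norm (a + Z^2 * x) < norm (1 + a * x)"
    using 1 2 3 left_diff_distrib[of 1 "exp (- y)" "norm (1 + r0 * v)"] by linarith
  then show ?thesis by (simp add: a_def Z_def)
qed

text \<open>Each power of the hyperbolic cosine absorbs one of the \<open>Suc n\<close> factors
  \<open>z * w\<close>, so that no growing exponential remains.\<close>

lemma block_eq_sum:
  assumes "N \<ge> 3"
  defines "z \<equiv> \<lambda>s::complex. exp (of_real (- ln (real N)) * s)"
    and "w \<equiv> \<lambda>s::complex. exp (of_real (- ln (real N + 1)) * s)"
  shows "block_carrier n N s = (z s * w s) ^ Suc n"
    and "block c n N s = (\<Sum>i\<le>n. of_real (c i) * ((z s * w s) ^ (Suc n - i) * ((z s ^ 2 + w s ^ 2) / 2) ^ i))"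
proof -
  have zw: "z s * w s = exp (of_real (- (ln (real N + 1) + ln (real N))) * s)"
    unfolding z_def w_def by (simp add: algebra_simps flip: exp_add)
  show carrier: "block_carrier n N s = (z s * w s) ^ Suc n"
    unfolding zw block_carrier_def block_freq_def exp_of_nat_mult[symmetric] by (simp add: algebra_simps)
  define C where "C = (exp (of_real (block_gap N) * s) + exp (of_real (- block_gap N) * s)) / 2"
  have "(z s * w s) * exp (of_real (block_gap N) * s) = z s ^ 2"
    unfolding z_def w_def block_gap_def by (simp add: algebra_simps flip: exp_add exp_double)
  moreover have "(z s * w s) * exp (of_real (- block_gap N) * s) = w s ^ 2"
    unfolding z_def w_def block_gap_def by (simp add: algebra_simps flip: exp_add exp_double)
  ultimately have zwC: "(z s * w s) * C = (z s ^ 2 + w s ^ 2) / 2"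
    unfolding C_def by (simp add: distrib_left)
  have "block c n N s = (\<Sum>i\<le>n. of_real (c i) * ((z s * w s) ^ Suc n * C ^ i))"
    unfolding block_def carrier block_envelope_def C_def by (simp add: sum_distrib_left ac_simps)
  also have "\<dots> = (\<Sum>i\<le>n. of_real (c i) * ((z s * w s) ^ (Suc n - i) * ((z s ^ 2 + w s ^ 2) / 2) ^ i))"
  proof (rule sum.cong)
    fix i assume "i \<in> {..n}"
    then have "(z s * w s) ^ Suc n = (z s * w s) ^ (Suc n - i) * (z s * w s) ^ i"
      by (subst power_add[symmetric]) auto
    then show "of_real (c i) * ((z s * w s) ^ Suc n * C ^ i) =
        of_real (c i) * ((z s * w s) ^ (Suc n - i) * ((z s ^ 2 + w s ^ 2) / 2) ^ i)"
      unfolding zwC[symmetric] by (simp add: power_mult_distrib)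
  qed simp
  finally show "block c n N s = (\<Sum>i\<le>n. of_real (c i) * ((z s * w s) ^ (Suc n - i) * ((z s ^ 2 + w s ^ 2) / 2) ^ i))" .
qed

lemma bounded_lipschitz_block:
  assumes "N \<ge> 3"
  shows "bounded_lipschitz (block c n N)" "bounded_lipschitz (\<lambda>s. block_carrier n N s ^ 2)"
proof -
  define z where "z s = exp (of_real (- ln (real N)) * s)" for s :: complex
  define w where "w s = exp (of_real (- ln (real N + 1)) * s)" for s :: complex
  have z: "bounded_lipschitz z" unfolding z_def using assms by (intro bounded_lipschitz_exp) simp
  have w: "bounded_lipschitz w" unfolding w_def using assms by (intro bounded_lipschitz_exp) simp
  have half: "bounded_lipschitz (\<lambda>s. (z s ^ 2 + w s ^ 2) / 2)"
    using bounded_lipschitz_mult[OF bounded_lipschitz_const[of "1/2"]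
        bounded_lipschitz_add[OF bounded_lipschitz_power[OF z, of 2] bounded_lipschitz_power[OF w, of 2]]]
    by simp
  have eq: "block c n N = (\<lambda>s. \<Sum>i\<le>n. of_real (c i) * ((z s * w s) ^ (Suc n - i) * ((z s ^ 2 + w s ^ 2) / 2) ^ i))"
    unfolding z_def w_def using block_eq_sum(2)[OF assms] by (intro ext)
  show "bounded_lipschitz (block c n N)"
    unfolding eq by (intro bounded_lipschitz_sum bounded_lipschitz_mult bounded_lipschitz_const
        bounded_lipschitz_power half z w)
  have "block_carrier n N = (\<lambda>s. (z s * w s) ^ Suc n)"
    unfolding z_def w_def using block_eq_sum(1)[OF assms] by (intro ext)
  then show "bounded_lipschitz (\<lambda>s. block_carrier n N s ^ 2)"
    by (simp only:) (intro bounded_lipschitz_mult bounded_lipschitz_power z w)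
qed

text \<open>Every term has total degree \<open>2 * Suc n\<close> in quantities of norm at most
  \<open>1 / N\<close>. Keeping one factor \<open>1 / N\<close> suffices, since \<open>N\<close> may
  be taken large in terms of \<open>c\<close>.\<close>

lemma abs_dirichlet_block:
  assumes "N \<ge> 3"
  shows "abs_dirichlet (block c n N) ((\<Sum>i\<le>n. \<bar>c i\<bar>) / real N)"
    and "abs_dirichlet (\<lambda>s. block_carrier n N s ^ 2) (1 / real N)"
proof -
  define z where "z s = exp (of_real (- ln (real N)) * s)" for s :: complex
  define w where "w s = exp (of_real (- ln (real N + 1)) * s)" for s :: complex
  define q where "q = 1 / real N"
  have q: "0 < q" "q \<le> 1" using assms by (auto simp: q_def)
  have z_eq: "z s = of_nat N powr (- s)" for s
    using assms by (simp add: z_def powr_def Ln_of_nat mult.commute)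
  have w_eq: "w s = of_nat (Suc N) powr (- s)" for s
    unfolding w_def powr_def using Ln_of_nat[of "Suc N"] of_nat_neq_0[of N, where 'a = complex]
    by (simp add: mult.commute add.commute)
  have z: "abs_dirichlet z q"
    using abs_dirichlet_nat_powr[of N] assms by (simp add: q_def z_eq[abs_def])
  have w: "abs_dirichlet w q"
    by (rule abs_dirichlet_cong[OF abs_dirichlet_nat_powr[of "Suc N"]])
      (use assms in \<open>auto simp: w_eq q_def field_simps\<close>)
  have half: "abs_dirichlet (\<lambda>s. (z s ^ 2 + w s ^ 2) / 2) (q\<^sup>2)"
    by (rule abs_dirichlet_cong[OF abs_dirichlet_cmult[OF abs_dirichlet_add[OF abs_dirichlet_power[OF z, of 2]
          abs_dirichlet_power[OF w, of 2]], of "1/2"]]) auto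
  have zw: "abs_dirichlet (\<lambda>s. z s * w s) (q\<^sup>2)"
    using abs_dirichlet_mult[OF z w] by (simp add: power2_eq_square)
  have small: "q ^ k \<le> q" if "k \<ge> 1" for k using q that power_decreasing[of 1 k q] by simp
  have "abs_dirichlet (\<lambda>s. \<Sum>i\<le>n. of_real (c i) * ((z s * w s) ^ (Suc n - i) * ((z s ^ 2 + w s ^ 2) / 2) ^ i))
     (\<Sum>i\<le>n. norm (complex_of_real (c i)) * ((q\<^sup>2) ^ (Suc n - i) * (q\<^sup>2) ^ i))"
    by (intro abs_dirichlet_sum abs_dirichlet_cmult abs_dirichlet_mult abs_dirichlet_power half zw)
  then show "abs_dirichlet (block c n N) ((\<Sum>i\<le>n. \<bar>c i\<bar>) / real N)"
  proof (rule abs_dirichlet_cong)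
    fix s show "block c n N s = (\<Sum>i\<le>n. of_real (c i) * ((z s * w s) ^ (Suc n - i) * ((z s ^ 2 + w s ^ 2) / 2) ^ i))"
      unfolding z_def w_def by (rule block_eq_sum(2)[OF assms])
    have "(\<Sum>i\<le>n. norm (complex_of_real (c i)) * ((q\<^sup>2) ^ (Suc n - i) * (q\<^sup>2) ^ i)) \<le> (\<Sum>i\<le>n. \<bar>c i\<bar> * q)"
    proof (rule sum_mono)
      fix i assume "i \<in> {..n}"
      then have "(q\<^sup>2) ^ (Suc n - i) * (q\<^sup>2) ^ i = (q\<^sup>2) ^ Suc n" by (subst power_add[symmetric]) auto
      also have "\<dots> = q ^ (2 * Suc n)" by (simp only: power_mult)
      also have "\<dots> \<le> q" by (rule small) simp
      finally show "norm (complex_of_real (c i)) * ((q\<^sup>2) ^ (Suc n - i) * (q\<^sup>2) ^ i) \<le> \<bar>c i\<bar> * q"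
        by (simp add: mult_left_mono)
    qed
    then show "(\<Sum>i\<le>n. norm (complex_of_real (c i)) * ((q\<^sup>2) ^ (Suc n - i) * (q\<^sup>2) ^ i)) \<le> (\<Sum>i\<le>n. \<bar>c i\<bar>) / real N"
      by (simp add: q_def sum_divide_distrib)
  qed
  show "abs_dirichlet (\<lambda>s. block_carrier n N s ^ 2) (1 / real N)"
  proof (rule abs_dirichlet_cong[OF abs_dirichlet_power[OF abs_dirichlet_power[OF zw, of "Suc n"], of 2]])
    fix s show "block_carrier n N s ^ 2 = ((z s * w s) ^ Suc n) ^ 2"
      unfolding z_def w_def by (subst block_eq_sum(1)[OF assms]) (rule refl)
    have "((q\<^sup>2) ^ Suc n) ^ 2 = q ^ (2 * Suc n * 2)" by (simp only: power_mult)
    also have "\<dots> \<le> q" by (rule small) simp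
    finally show "((q\<^sup>2) ^ Suc n) ^ 2 \<le> 1 / real N" by (simp add: q_def)
  qed
qed

lemma block_holomorphic: "block c n N holomorphic_on A"
  unfolding block_def block_carrier_def block_envelope_def by (intro holomorphic_intros) auto

lemma block_imag:
  "block c n N (\<i> * of_real t) =
    block_carrier n N (\<i> * of_real t) * of_real (cosine_poly c n (block_gap N * t))"
  unfolding block_def block_envelope_imag ..

section \<open>Estimates for counting integers and value points\<close>

lemma norm_exp_minus_one_ge:
  fixes h :: complex
  assumes "norm h \<le> 1/8"
  shows "norm (exp h - 1) \<ge> norm h / 2"
proof -
  have "norm (exp h - (\<Sum>k\<le>1. h ^ k / fact k)) \<le> exp \<bar>Re h\<bar> * norm h ^ Suc 1 / fact 1"
    by (rule Taylor_exp)
  then have 1: "norm (exp h - (1 + h)) \<le> exp \<bar>Re h\<bar> * norm h ^ 2" by (simp add: power2_eq_square)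
  have "exp \<bar>Re h\<bar> \<le> exp 1" using assms abs_Re_le_cmod[of h] by (subst exp_le_cancel_iff) linarith
  then have "exp \<bar>Re h\<bar> \<le> 3" using exp_le by linarith
  then have "exp \<bar>Re h\<bar> * norm h ^ 2 \<le> 3 * (norm h * (1/8))"
    unfolding power2_eq_square using assms by (intro mult_mono mult_left_mono) auto
  with 1 have "norm (exp h - (1 + h)) \<le> norm h / 2" using norm_ge_zero[of h] by linarith
  moreover have "norm h \<le> norm (exp h - 1) + norm (exp h - (1 + h))"
    using norm_triangle_ineq4[of "exp h - 1" "exp h - (1 + h)"] by simp
  ultimately show ?thesis by linarith
qed

text \<open>The assumption keeps the bound nonnegative when no integer lies in between.\<close>

lemma card_int_between_le:
  fixes x y :: real
  assumes "x \<le> y + 1"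
  shows "finite {l::int. x \<le> l \<and> l \<le> y}" "real (card {l::int. x \<le> l \<and> l \<le> y}) \<le> y - x + 1"
proof -
  have eq: "{l::int. x \<le> l \<and> l \<le> y} = {\<lceil>x\<rceil>..\<lfloor>y\<rfloor>}"
    by (auto simp: ceiling_le_iff le_floor_iff)
  show "finite {l::int. x \<le> l \<and> l \<le> y}" unfolding eq by simp
  have "real (card {\<lceil>x\<rceil>..\<lfloor>y\<rfloor>}) = real (nat (\<lfloor>y\<rfloor> - \<lceil>x\<rceil> + 1))" by simp
  also have "\<dots> \<le> max 0 (real_of_int (\<lfloor>y\<rfloor> - \<lceil>x\<rceil> + 1))" by (simp add: of_nat_nat max_def)
  also have "\<dots> \<le> y - x + 1"
  proof -
    have "real_of_int \<lfloor>y\<rfloor> \<le> y" "x \<le> real_of_int \<lceil>x\<rceil>" by (rule of_int_floor_le, rule le_of_int_ceiling)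
    then have "real_of_int \<lfloor>y\<rfloor> - real_of_int \<lceil>x\<rceil> + 1 \<le> y - x + 1" by linarith
    then show ?thesis using assms by (simp add: max_def)
  qed
  finally show "real (card {l::int. x \<le> l \<and> l \<le> y}) \<le> y - x + 1" unfolding eq .
qed

lemma card_int_between_ge:
  fixes x y :: real
  shows "real (card {l::int. x \<le> l \<and> l \<le> y}) \<ge> y - x - 1"
proof -
  have eq: "{l::int. x \<le> l \<and> l \<le> y} = {\<lceil>x\<rceil>..\<lfloor>y\<rfloor>}"
    by (auto simp: ceiling_le_iff le_floor_iff)
  have "y - x - 1 \<le> real_of_int (\<lfloor>y\<rfloor> - \<lceil>x\<rceil> + 1)"
    using floor_correct[of y] ceiling_correct[of x] by simp linarith
  also have "\<dots> \<le> real (nat (\<lfloor>y\<rfloor> - \<lceil>x\<rceil> + 1))" by (simp add: of_nat_nat max_def)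
  finally show ?thesis unfolding eq by simp
qed

text \<open>The \<xi>-points of \<open>f\<close> are the zeros of its Moebius transform
  \<open>g\<close>, with the same orders. The Blaschke sum is evaluated at
  \<open>w = Complex R t\<close>, where \<open>f\<close> is small and hence \<open>g\<close> is
  close to the unit circle when \<xi> is.\<close>

lemma sum_zorder_strip_le:
  assumes hol: "f holomorphic_on halfplane 0" and bd: "\<And>s. Re s > 0 \<Longrightarrow> norm (f s) < 1"
    and eps: "0 < \<epsilon>" "\<epsilon> < norm \<xi>" "norm \<xi> < 1" and R: "R > 0"
    and fw: "norm (f (Complex R t)) \<le> \<epsilon> / 2"
    and F: "finite F" "\<And>s. s \<in> F \<Longrightarrow> 0 < Re s \<and> Re s \<le> R \<and> \<bar>Im s - t\<bar> \<le> R"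
  shows "(\<Sum>s\<in>F. nat (zorder (\<lambda>z. f z - \<xi>) s) * Re s) \<le> 10 * R * (1 - norm \<xi>) / \<epsilon>\<^sup>2"
proof -
  define w where "w = Complex R t"
  define g where "g s = (f s - \<xi>) * (1 / (1 - cnj \<xi> * f s))" for s
  have den: "1 - cnj \<xi> * f s \<noteq> 0" if "Re s > 0" for s
  proof -
    have "norm (cnj \<xi> * f s) \<le> norm \<xi> * 1"
      unfolding norm_mult using bd[OF that] eps by (intro mult_mono) auto
    then show ?thesis using eps by (metis eq_iff_diff_eq_0 linorder_not_less norm_one mult.right_neutral)
  qed
  have id: "(norm (1 - cnj \<xi> * z))\<^sup>2 - (norm (z - \<xi>))\<^sup>2 = (1 - (norm \<xi>)\<^sup>2) * (1 - (norm z)\<^sup>2)" for z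
    unfolding cmod_power2 by (simp add: power2_eq_square algebra_simps)
  have xi2: "1 - (norm \<xi>)\<^sup>2 > 0" using eps by (simp add: abs_square_less_1)
  have uhol: "(\<lambda>s. 1 / (1 - cnj \<xi> * f s)) holomorphic_on halfplane 0"
    using den by (intro holomorphic_intros hol) auto
  have ghol: "g holomorphic_on halfplane 0" unfolding g_def by (intro holomorphic_intros hol uhol)
  have gle: "norm (g s) \<le> 1" if "Re s > 0" for s
  proof -
    have "(norm (f s))\<^sup>2 \<le> 1" using bd[OF that] by (simp add: abs_square_le_1)
    then have "(1 - (norm \<xi>)\<^sup>2) * (1 - (norm (f s))\<^sup>2) \<ge> 0" using xi2 by simp
    then have "(norm (f s - \<xi>))\<^sup>2 \<le> (norm (1 - cnj \<xi> * f s))\<^sup>2" using id[of "f s"] by linarith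
    then have "norm (f s - \<xi>) \<le> norm (1 - cnj \<xi> * f s)" by (rule power2_le_imp_le) simp
    then show ?thesis using den[OF that] by (simp add: g_def norm_mult norm_divide divide_le_eq)
  qed
  have Rw: "Re w > 0" using R by (simp add: w_def)
  define z where "z = f w"
  have z: "norm z \<le> \<epsilon> / 2" using fw by (simp add: z_def w_def)
  have dz: "norm (z - \<xi>) \<ge> \<epsilon> / 2" using norm_triangle_ineq2[of \<xi> z] z eps by (simp add: norm_minus_commute)
  have zx: "z - \<xi> \<noteq> 0" using dz eps by auto
  have gw: "g w \<noteq> 0" using zx den[OF Rw] by (simp add: g_def z_def)
  \<comment> \<open>The identity writes the inverse square of \<open>norm (g w)\<close> as 1 plus a
    multiple of \<open>1 - (norm \<xi>)\<^sup>2\<close>, so \<open>ln y \<le> y - 1\<close> produces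
    the factor \<open>1 - norm \<xi>\<close>.\<close>
  have lng: "- ln (norm (g w)) \<le> 4 * (1 - norm \<xi>) / \<epsilon>\<^sup>2"
  proof -
    have "(norm (1 - cnj \<xi> * z))\<^sup>2 / (norm (z - \<xi>))\<^sup>2 = 1 + (1 - (norm \<xi>)\<^sup>2) * (1 - (norm z)\<^sup>2) / (norm (z - \<xi>))\<^sup>2"
      using id[of z] zx by (simp add: field_simps)
    moreover have "ln ((norm (1 - cnj \<xi> * z))\<^sup>2 / (norm (z - \<xi>))\<^sup>2) = - 2 * ln (norm (g w))"
      using zx den[OF Rw] by (simp add: g_def z_def norm_mult norm_divide ln_div ln_mult ln_realpow)
    moreover have "(norm (1 - cnj \<xi> * z))\<^sup>2 / (norm (z - \<xi>))\<^sup>2 > 0" using zx den[OF Rw] by (simp add: z_def)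
    ultimately have "- 2 * ln (norm (g w)) \<le> (1 - (norm \<xi>)\<^sup>2) * (1 - (norm z)\<^sup>2) / (norm (z - \<xi>))\<^sup>2"
      using ln_le_minus_one[of "(norm (1 - cnj \<xi> * z))\<^sup>2 / (norm (z - \<xi>))\<^sup>2"] by simp
    also have "\<dots> \<le> (2 * (1 - norm \<xi>)) * 1 / (\<epsilon> / 2)\<^sup>2"
    proof (intro frac_le mult_mono)
      show "1 - (norm \<xi>)\<^sup>2 \<le> 2 * (1 - norm \<xi>)"
        using zero_le_power2[of "1 - norm \<xi>"] by (simp add: power2_eq_square algebra_simps)
      show "(\<epsilon> / 2)\<^sup>2 \<le> (norm (z - \<xi>))\<^sup>2" using dz eps by (intro power_mono) auto
    qed (use eps z in \<open>auto simp: abs_square_le_1\<close>)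
    finally show ?thesis using eps by (simp add: field_simps power2_eq_square)
  qed
  have zo: "zorder g s = zorder (\<lambda>z. f z - \<xi>) s" if "s \<in> F" for s
  proof -
    have s: "s \<in> halfplane 0" using F that by auto
    have "zorder g s = zorder (\<lambda>z. f z - \<xi>) s + zorder (\<lambda>s. 1 / (1 - cnj \<xi> * f s)) s"
      unfolding g_def
    proof (rule zorder_times_analytic)
      show "(\<lambda>z. f z - \<xi>) analytic_on {s}"
        using hol s by (auto simp: analytic_at intro!: holomorphic_intros exI[of _ "halfplane 0"])
      show "(\<lambda>s. 1 / (1 - cnj \<xi> * f s)) analytic_on {s}"
        using uhol s by (auto simp: analytic_at intro!: exI[of _ "halfplane 0"])
      show "\<forall>\<^sub>F z in at s. (f z - \<xi>) * (1 / (1 - cnj \<xi> * f z)) \<noteq> 0"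
        using eventually_nonzero_at[OF ghol, of w s] gw Rw s by (simp add: g_def)
    qed
    moreover have "zorder (\<lambda>s. 1 / (1 - cnj \<xi> * f s)) s = 0"
      using uhol s den by (intro zorder_eq_0I) (auto simp: analytic_at intro!: exI[of _ "halfplane 0"])
    ultimately show ?thesis by simp
  qed
  have "(\<Sum>s\<in>F. nat (zorder g s) * (2 * Re w * Re s / (norm (w + cnj s))\<^sup>2)) \<le> - ln (norm (g w))"
    by (rule sum_zorder_halfplane_le[OF ghol gle F(1) _ Rw gw]) (use F in auto)
  moreover have "(\<Sum>s\<in>F. nat (zorder (\<lambda>z. f z - \<xi>) s) * Re s) * (2 / (5 * R)) \<le>
     (\<Sum>s\<in>F. nat (zorder g s) * (2 * Re w * Re s / (norm (w + cnj s))\<^sup>2))"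
    unfolding sum_distrib_right
  proof (rule sum_mono)
    fix s assume s: "s \<in> F"
    note b = F(2)[OF s]
    \<comment> \<open>In the box given by \<open>F\<close> the squared distance is at most
      \<open>(2 * R)\<^sup>2 + R\<^sup>2\<close>, so each weight is at least
      \<open>2 / (5 * R)\<close> times \<open>Re s\<close>.\<close>
    have "(norm (w + cnj s))\<^sup>2 = (R + Re s)\<^sup>2 + (t - Im s)\<^sup>2" unfolding cmod_power2 by (simp add: w_def)
    also have "\<dots> \<le> (2 * R)\<^sup>2 + R\<^sup>2"
    proof (rule add_mono)
      show "(R + Re s)\<^sup>2 \<le> (2 * R)\<^sup>2" using b R by (intro power_mono) auto
      show "(t - Im s)\<^sup>2 \<le> R\<^sup>2" using b R by (subst abs_le_square_iff[symmetric]) (simp add: abs_minus_commute)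
    qed
    finally have n5: "(norm (w + cnj s))\<^sup>2 \<le> 5 * R\<^sup>2" by (simp add: power2_eq_square)
    have "w + cnj s \<noteq> 0" using b Rw by (auto simp: complex_eq_iff)
    then have "2 * R * Re s / (5 * R\<^sup>2) \<le> 2 * Re w * Re s / (norm (w + cnj s))\<^sup>2"
      using n5 b R by (intro frac_le) (auto simp: w_def)
    moreover have "2 * R * Re s / (5 * R\<^sup>2) = Re s * (2 / (5 * R))" using R by (simp add: power2_eq_square)
    ultimately have "Re s * (2 / (5 * R)) \<le> 2 * Re w * Re s / (norm (w + cnj s))\<^sup>2" by simp
    from mult_left_mono[OF this, of "real (nat (zorder g s))"]
    show "nat (zorder (\<lambda>z. f z - \<xi>) s) * Re s * (2 / (5 * R)) \<le>
        nat (zorder g s) * (2 * Re w * Re s / (norm (w + cnj s))\<^sup>2)"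
      unfolding zo[OF s, symmetric] by simp
  qed
  ultimately have "(\<Sum>s\<in>F. nat (zorder (\<lambda>z. f z - \<xi>) s) * Re s) * (2 / (5 * R)) \<le> 4 * (1 - norm \<xi>) / \<epsilon>\<^sup>2"
    using lng by linarith
  from mult_right_mono[OF this, of "5 * R / 2"]
  have "(\<Sum>s\<in>F. nat (zorder (\<lambda>z. f z - \<xi>) s) * Re s) \<le> 4 * (1 - norm \<xi>) / \<epsilon>\<^sup>2 * (5 * R / 2)"
    using R by simp
  also have "\<dots> = 10 * R * (1 - norm \<xi>) / \<epsilon>\<^sup>2" by (simp add: algebra_simps)
  finally show ?thesis .
qed

lemma infsum_ennreal_le:
  fixes g :: "'a \<Rightarrow> real"
  assumes "\<And>x. x \<in> A \<Longrightarrow> g x \<ge> 0" "\<And>F. finite F \<Longrightarrow> F \<subseteq> A \<Longrightarrow> sum g F \<le> C"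
  shows "(\<Sum>\<^sub>\<infinity>x\<in>A. ennreal (g x)) \<le> ennreal C"
proof -
  have "(\<Sum>\<^sub>\<infinity>x\<in>A. ennreal (g x)) = (SUP F\<in>{F. finite F \<and> F \<subseteq> A}. \<Sum>x\<in>F. ennreal (g x))"
    by (rule nonneg_infsum_complete) simp
  also have "\<dots> \<le> ennreal C"
  proof (rule SUP_least)
    fix F assume "F \<in> {F. finite F \<and> F \<subseteq> A}"
    then show "(\<Sum>x\<in>F. ennreal (g x)) \<le> ennreal C"
      using assms by (subst sum_ennreal) (auto intro: ennreal_leI)
  qed
  finally show ?thesis .
qed

lemma le_infsum_ennreal:
  fixes g :: "'a \<Rightarrow> real"
  assumes "\<And>x. x \<in> A \<Longrightarrow> g x \<ge> 0" "finite F" "F \<subseteq> A"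
  shows "ennreal (sum g F) \<le> (\<Sum>\<^sub>\<infinity>x\<in>A. ennreal (g x))"
proof -
  have "(\<Sum>\<^sub>\<infinity>x\<in>A. ennreal (g x)) = (SUP F\<in>{F. finite F \<and> F \<subseteq> A}. \<Sum>x\<in>F. ennreal (g x))"
    by (rule nonneg_infsum_complete) simp
  moreover have "ennreal (sum g F) = (\<Sum>x\<in>F. ennreal (g x))"
    using assms by (subst sum_ennreal) auto
  ultimately show ?thesis using assms by (auto intro!: SUP_upper)
qed

section \<open>The composition of the Moebius maps\<close>

text \<open>Window width \<open>\<delta>\<^sub>k\<close>, size of \<open>a\<^sub>k\<close> off its window, and distance of \<open>|a\<^sub>k|\<close> from 1 inside it.\<close>
definition win :: "real \<Rightarrow> nat \<Rightarrow> real" where "win \<epsilon> k = \<epsilon>\<^sup>2 / 100000 * (1/2) ^ Suc k"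
definition tol :: "real \<Rightarrow> nat \<Rightarrow> real" where "tol \<epsilon> k = \<epsilon> / 64 * (1/4) ^ k"
definition dip :: "nat \<Rightarrow> real" where "dip k = (1/2) ^ (k + 2)"

lemma dip_pos: "0 < dip k" and dip_le: "dip k \<le> 1/4"
  using power_decreasing[of 2 "k + 2" "1/2::real"] by (auto simp: dip_def power2_eq_square)

lemma win_bounds:
  assumes "0 < \<epsilon>" "\<epsilon> < 1"
  shows "win \<epsilon> k > 0" "win \<epsilon> k \<le> 1/100000"
proof -
  have e: "0 < \<epsilon>\<^sup>2" "\<epsilon>\<^sup>2 \<le> 1" using assms by (auto simp: abs_square_le_1)
  show "win \<epsilon> k > 0" using e by (simp add: win_def)
  have "\<epsilon>\<^sup>2 / 100000 * (1/2) ^ Suc k \<le> 1/100000 * 1"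
    using e by (intro mult_mono power_le_one) auto
  then show "win \<epsilon> k \<le> 1/100000" by (simp add: win_def)
qed

text \<open>What the analysis needs from the blocks, free of their construction. \<open>r k\<close>
  is the real envelope and \<open>D k\<close> a Lipschitz constant for the data of level
  \<open>k\<close>. \<open>u_Suc\<close> keeps level \<open>k + 1\<close> below its first window up
  to height \<open>2 * pi / u k\<close>; \<open>Lam_Suc\<close> makes all earlier maps vary little
  over a length \<open>1 / \<Lambda> k\<close>; \<open>Lam_win\<close> puts many periods of level
  \<open>k\<close> into its window; \<open>win_large\<close> makes windows at least comparable in
  width with the strip in which values beyond \<epsilon> can occur.\<close>

locale moebius_tower =
  fixes \<epsilon> :: real and a :: "nat \<Rightarrow> complex \<Rightarrow> complex" and r :: "nat \<Rightarrow> real \<Rightarrow> real"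
    and u \<Lambda> D :: "nat \<Rightarrow> real"
  assumes eps: "0 < \<epsilon>" "\<epsilon> < 1"
    and Lam_ge: "\<And>k. \<Lambda> k \<ge> real k + 2"
    and Lam_win: "\<And>k. \<Lambda> k * win \<epsilon> k \<ge> 1000 * (ln (2 / \<epsilon>) + 5)"
    and u_pos: "\<And>k. 0 < u k" and u_le: "\<And>k. u k \<le> 1"
    and win_large: "\<And>k. 4 * win \<epsilon> k / u k \<ge> ln (64 / \<epsilon>)"
    and u_Suc: "\<And>k. 2 * pi * u (Suc k) \<le> win \<epsilon> (Suc k) / 2 * u k"
    and D_nonneg: "\<And>k. D k \<ge> 0"
    and Lam_Suc: "\<And>k. \<Lambda> k \<ge> real k * (\<Sum>j<k. D j)"
    and a_hol: "\<And>k. a k holomorphic_on halfplane 0"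
    and a_lip: "\<And>k s s'. Re s \<ge> 0 \<Longrightarrow> Re s' \<ge> 0 \<Longrightarrow> norm (a k s - a k s') \<le> D k * norm (s - s')"
    and Z_lip: "\<And>k s s'. Re s \<ge> 0 \<Longrightarrow> Re s' \<ge> 0 \<Longrightarrow>
      norm (exp (of_real (- \<Lambda> k) * s) ^ 2 - exp (of_real (- \<Lambda> k) * s') ^ 2) \<le> D k * norm (s - s')"
    and a_approx_tol: "\<And>k s. Re s \<ge> 0 \<Longrightarrow>
      norm (a k s - exp (of_real (- \<Lambda> k) * s) * of_real (r k (Im s))) \<le> tol \<epsilon> k / 2"
    and a_approx_dip: "\<And>k s. Re s \<ge> 0 \<Longrightarrow>
      norm (a k s - exp (of_real (- \<Lambda> k) * s) * of_real (r k (Im s))) \<le> dip k / 2"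
    and a_imag: "\<And>k t. a k (\<i> * of_real t) = exp (of_real (- \<Lambda> k) * (\<i> * of_real t)) * of_real (r k t)"
    and contractive: "\<And>k s x. Re s > 0 \<Longrightarrow> norm x \<le> 1 \<Longrightarrow>
      norm (a k s + exp (of_real (- \<Lambda> k) * s) ^ 2 * x) < norm (1 + a k s * x)"
    and r_le: "\<And>k t. \<bar>r k t\<bar> \<le> 1 - dip k"
    and r_window: "\<And>k t. u k * t \<in> {win \<epsilon> k..2 * win \<epsilon> k} \<Longrightarrow> r k t \<ge> 1 - 2 * dip k"
    and r_off: "\<And>k t. (\<forall>l::int. \<bar>u k * t - 2 * pi * of_int l\<bar> \<ge> 3 * win \<epsilon> k) \<Longrightarrow> \<bar>r k t\<bar> \<le> tol \<epsilon> k / 2"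
    and r_near_0: "\<And>k t. \<bar>u k * t\<bar> \<le> win \<epsilon> k / 2 \<Longrightarrow> \<bar>r k t\<bar> \<le> tol \<epsilon> k / 2"
    and a_dirichlet: "\<And>k. abs_dirichlet (a k) (1/8)"
    and Z_dirichlet: "\<And>k. abs_dirichlet (\<lambda>s. exp (of_real (- \<Lambda> k) * s) ^ 2) (1/8)"
begin

abbreviation "\<delta> \<equiv> win \<epsilon>"
abbreviation "\<tau> \<equiv> tol \<epsilon>"

definition Z where "Z k s = exp (of_real (- \<Lambda> k) * s)" for k and s :: complex

definition \<phi> where "\<phi> k s x = (a k s + Z k s ^ 2 * x) / (1 + a k s * x)" for k s x

text \<open>The recursion peels off the outermost map, so the starting level shifts and inductions
  on the length run over all levels. The free innermost argument allows the limit of the remaining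
  tail to be inserted.\<close>

fun tower where
  "tower s k 0 x = x"
| "tower s k (Suc n) x = \<phi> k s (tower s (Suc k) n x)"

section \<open>Bounds for a single level\<close>

lemma tol_pos: "0 < \<tau> k" and tol_le: "\<tau> k \<le> \<epsilon> / 64" and tol_le': "\<tau> k \<le> 1 / 64"
  and tol_Suc: "\<tau> (Suc k) = \<tau> k / 4"
proof -
  show "0 < \<tau> k" using eps by (simp add: tol_def)
  show 1: "\<tau> k \<le> \<epsilon> / 64"
    using eps power_le_one[of "1/4::real" k] by (simp add: tol_def field_simps)
  then show "\<tau> k \<le> 1 / 64" using eps by simp
  show "\<tau> (Suc k) = \<tau> k / 4" by (simp add: tol_def)
qed

lemma Lam_pos: "\<Lambda> k > 0" using Lam_ge[of k] by simp

lemma norm_Z: "norm (Z k s) = exp (- \<Lambda> k * Re s)"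
  by (simp add: Z_def norm_exp_eq_Re)

lemma norm_Z_le: "Re s \<ge> 0 \<Longrightarrow> norm (Z k s) \<le> 1"
  using Lam_pos[of k] by (simp add: norm_Z)

lemma norm_Z2_le: "Re s \<ge> 0 \<Longrightarrow> norm (Z k s ^ 2) \<le> 1"
  using norm_Z_le[of s k] by (simp add: norm_power power_le_one)

lemma norm_a_le_sum:
  assumes "Re s \<ge> 0"
  shows "norm (a k s) \<le> norm (Z k s) * \<bar>r k (Im s)\<bar> + \<tau> k / 2"
    and "norm (a k s) \<le> norm (Z k s) * \<bar>r k (Im s)\<bar> + dip k / 2"
proof -
  have "norm (a k s) \<le> norm (Z k s * of_real (r k (Im s))) + norm (a k s - Z k s * of_real (r k (Im s)))"
    using norm_triangle_ineq[of "Z k s * of_real (r k (Im s))" "a k s - Z k s * of_real (r k (Im s))"] by simp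
  then show "norm (a k s) \<le> norm (Z k s) * \<bar>r k (Im s)\<bar> + \<tau> k / 2"
    "norm (a k s) \<le> norm (Z k s) * \<bar>r k (Im s)\<bar> + dip k / 2"
    using a_approx_tol[OF assms, of k] a_approx_dip[OF assms, of k] unfolding Z_def[symmetric] norm_mult norm_of_real
    by linarith+
qed

text \<open>Half of the margin \<open>dip k\<close> survives the approximation error. This keeps
  every denominator \<open>1 + a k s * x\<close> away from 0 on the closed half-plane.\<close>

lemma norm_a_le:
  assumes "Re s \<ge> 0"
  shows "norm (a k s) \<le> 1 - dip k / 2"
proof -
  have "norm (Z k s) * \<bar>r k (Im s)\<bar> \<le> 1 * (1 - dip k)"
    using norm_Z_le[OF assms] r_le[of k "Im s"] by (intro mult_mono) auto
  with norm_a_le_sum(2)[OF assms, of k] show ?thesis by simp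
qed

lemma norm_a_le_small_r:
  assumes "Re s \<ge> 0" "\<bar>r k (Im s)\<bar> \<le> \<tau> k / 2"
  shows "norm (a k s) \<le> \<tau> k"
proof -
  have "norm (Z k s) * \<bar>r k (Im s)\<bar> \<le> 1 * (\<tau> k / 2)"
    using norm_Z_le[OF assms(1)] assms(2) by (intro mult_mono) auto
  with norm_a_le_sum(1)[OF assms(1), of k] show ?thesis by simp
qed

lemma norm_a_le_decay:
  assumes "Re s \<ge> 0"
  shows "norm (a k s) \<le> exp (- \<Lambda> k * Re s) + \<tau> k"
proof -
  have "norm (Z k s) * \<bar>r k (Im s)\<bar> \<le> norm (Z k s) * 1"
    using r_le[of k "Im s"] dip_pos[of k] by (intro mult_left_mono) auto
  then have "norm (a k s) \<le> norm (Z k s) + \<tau> k"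
    using norm_a_le_sum(1)[OF assms, of k] tol_pos[of k] by linarith
  then show ?thesis unfolding norm_Z .
qed

lemma denom_ge:
  assumes "norm x \<le> 1"
  shows "norm (1 + a k s * x) \<ge> 1 - norm (a k s)"
proof -
  have "norm (a k s * x) \<le> norm (a k s)" using assms by (simp add: norm_mult mult_left_le)
  then show ?thesis using norm_diff_ineq[of 1 "a k s * x"] by simp
qed

lemma denom_nonzero:
  assumes "norm x \<le> 1" "Re s \<ge> 0"
  shows "1 + a k s * x \<noteq> 0"
  using denom_ge[OF assms(1), of k s] norm_a_le[OF assms(2), of k] dip_pos[of k] by auto

lemma norm_phi_less: "Re s > 0 \<Longrightarrow> norm x \<le> 1 \<Longrightarrow> norm (\<phi> k s x) < 1"
  using contractive[of s x k] denom_nonzero[of x s k] unfolding \<phi>_def norm_divide Z_def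
  by (simp add: divide_less_eq)

lemma phi_diff:
  assumes "norm x \<le> 1" "norm x' \<le> 1" "Re s \<ge> 0"
  shows "\<phi> k s x - \<phi> k s x' = (Z k s ^ 2 - a k s ^ 2) * (x - x') / ((1 + a k s * x) * (1 + a k s * x'))"
  unfolding \<phi>_def using denom_nonzero[OF assms(1,3)] denom_nonzero[OF assms(2,3)]
  by (simp add: diff_frac_eq) (simp add: algebra_simps power2_eq_square)

lemma phi_lip:
  assumes "norm x \<le> 1" "norm x' \<le> 1" "Re s \<ge> 0" "norm (a k s) \<le> \<beta>" "\<beta> < 1" "norm (Z k s ^ 2) \<le> \<gamma>"
  shows "norm (\<phi> k s x - \<phi> k s x') \<le> (\<gamma> + \<beta>\<^sup>2) / (1 - \<beta>)\<^sup>2 * norm (x - x')"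
proof -
  have "norm (Z k s ^ 2 - a k s ^ 2) \<le> norm (Z k s ^ 2) + norm (a k s) ^ 2"
    using norm_triangle_ineq4[of "Z k s ^ 2" "a k s ^ 2"] by (simp add: norm_power)
  also have "\<dots> \<le> \<gamma> + \<beta>\<^sup>2" using assms by (intro add_mono power_mono) auto
  finally have 1: "norm (Z k s ^ 2 - a k s ^ 2) \<le> \<gamma> + \<beta>\<^sup>2" .
  have d: "norm (1 + a k s * x) \<ge> 1 - \<beta>" "norm (1 + a k s * x') \<ge> 1 - \<beta>"
    using denom_ge[OF assms(1), of k s] denom_ge[OF assms(2), of k s] assms(4) by auto
  have "(1 - \<beta>)\<^sup>2 \<le> norm (1 + a k s * x) * norm (1 + a k s * x')"
    unfolding power2_eq_square using d assms(5) by (intro mult_mono) auto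
  then have "norm (Z k s ^ 2 - a k s ^ 2) * norm (x - x') / (norm (1 + a k s * x) * norm (1 + a k s * x'))
      \<le> (\<gamma> + \<beta>\<^sup>2) * norm (x - x') / (1 - \<beta>)\<^sup>2"
    using 1 assms(5) order_trans[OF norm_ge_zero 1] by (intro frac_le mult_right_mono mult_nonneg_nonneg) auto
  then show ?thesis unfolding phi_diff[OF assms(1-3)] norm_divide norm_mult by simp
qed

section \<open>Convergence of the composition\<close>

lemma norm_tower_le:
  assumes "Re s > 0" "norm x \<le> 1"
  shows "norm (tower s k n x) \<le> 1"
proof (cases n)
  case (Suc m)
  have "norm (tower s k (Suc m) x) < 1" for k
  proof (induction m arbitrary: k)
    case 0
    then show ?case using assms norm_phi_less by simp
  next
    case (Suc m)
    show ?case unfolding tower.simps(2)[of s k] by (rule norm_phi_less[OF assms(1) less_imp_le[OF Suc]])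
  qed
  then show ?thesis using Suc by (simp add: less_imp_le del: tower.simps)
qed (use assms in auto)

lemma tower_holomorphic: "(\<lambda>s. tower s k n 0) holomorphic_on halfplane 0"
proof (induction n arbitrary: k)
  case (Suc n)
  then show ?case unfolding tower.simps \<phi>_def Z_def
    using denom_nonzero norm_tower_le[of _ 0 "Suc k" n] by (intro holomorphic_intros a_hol) auto
qed auto

text \<open>A Lipschitz constant of \<open>\<phi> k s\<close> for
  \<open>Re s \<ge> \<sigma>\<close>. For each \<sigma> the contraction by 1/2 holds at all but
  finitely many levels; the crude value, from \<open>norm (a k s) \<le> 1 - dip k / 2\<close>,
  covers the others.\<close>

definition lipc where
  "lipc \<sigma> k = (if exp (- \<Lambda> k * \<sigma>) + \<tau> k \<le> 1/4 then 1/2 else 8 / (dip k)\<^sup>2)" for \<sigma> :: real and k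

lemma lipc_nonneg: "lipc \<sigma> k \<ge> 0" by (simp add: lipc_def)

lemma phi_lipc:
  assumes "norm x \<le> 1" "norm x' \<le> 1" "\<sigma> > 0" "Re s \<ge> \<sigma>"
  shows "norm (\<phi> k s x - \<phi> k s x') \<le> lipc \<sigma> k * norm (x - x')"
proof (cases "exp (- \<Lambda> k * \<sigma>) + \<tau> k \<le> 1/4")
  case True
  have s: "Re s \<ge> 0" using assms by simp
  have e: "exp (- \<Lambda> k * Re s) \<le> exp (- \<Lambda> k * \<sigma>)"
    using assms(4) Lam_pos[of k] by simp
  have b: "norm (a k s) \<le> 1/4" using norm_a_le_decay[OF s, of k] e True by linarith
  have "norm (Z k s) \<le> 1/4" unfolding norm_Z using e True tol_pos[of k] by linarith
  then have "norm (Z k s ^ 2) \<le> (1/4)^2" unfolding norm_power by (intro power_mono) auto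
  then have "norm (Z k s ^ 2) \<le> 1/16" by (simp add: power2_eq_square)
  from phi_lip[OF assms(1,2) s b _ this] have "norm (\<phi> k s x - \<phi> k s x') \<le> 2/9 * norm (x - x')"
    by (simp add: power2_eq_square)
  also have "\<dots> \<le> 1/2 * norm (x - x')" by simp
  finally show ?thesis using True by (simp add: lipc_def)
next
  case False
  have s: "Re s \<ge> 0" using assms by simp
  have d: "0 < dip k" "dip k \<le> 1/4" using dip_pos[of k] dip_le[of k] by auto
  have "norm (\<phi> k s x - \<phi> k s x') \<le> (1 + (1 - dip k / 2)\<^sup>2) / (1 - (1 - dip k / 2))\<^sup>2 * norm (x - x')"
    by (rule phi_lip[OF assms(1,2) s norm_a_le[OF s] _ norm_Z2_le[OF s]]) (use d in auto)
  also have "\<dots> \<le> 2 / (1 - (1 - dip k / 2))\<^sup>2 * norm (x - x')"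
    using d power_le_one[of "1 - dip k / 2" 2] by (intro mult_right_mono divide_right_mono) auto
  also have "2 / (1 - (1 - dip k / 2))\<^sup>2 = 8 / (dip k)\<^sup>2" by (simp add: power2_eq_square)
  finally show ?thesis using False by (simp add: lipc_def)
qed

text \<open>The two towers differ only in the innermost argument, \<open>\<phi> (k + n) s 0\<close>
  against 0; a difference of size at most 1 passes through \<open>n\<close> maps.\<close>

lemma tower_step_le:
  assumes "\<sigma> > 0" "Re s \<ge> \<sigma>"
  shows "norm (tower s k (Suc n) 0 - tower s k n 0) \<le> (\<Prod>j<n. lipc \<sigma> (k + j))"
proof (induction n arbitrary: k)
  case 0
  have "norm (tower s k (Suc 0) 0) \<le> 1" by (rule norm_tower_le) (use assms in auto)
  then show ?case by simp
next
  case (Suc n)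
  have "norm (tower s k (Suc (Suc n)) 0 - tower s k (Suc n) 0) \<le>
      lipc \<sigma> k * norm (tower s (Suc k) (Suc n) 0 - tower s (Suc k) n 0)"
    unfolding tower.simps(2)[of s k] by (rule phi_lipc) (use assms in \<open>auto intro!: norm_tower_le simp del: tower.simps\<close>)
  also have "\<dots> \<le> lipc \<sigma> k * (\<Prod>j<n. lipc \<sigma> (Suc k + j))"
    by (intro mult_left_mono Suc lipc_nonneg)
  also have "\<dots> = (\<Prod>j<Suc n. lipc \<sigma> (k + j))"
    by (subst prod.lessThan_Suc_shift) simp
  finally show ?case .
qed

lemma tol_tendsto: "\<tau> \<longlonglongrightarrow> 0"
proof -
  have "(\<lambda>k. \<epsilon> / 64 * (1/4) ^ k) \<longlonglongrightarrow> \<epsilon> / 64 * 0"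
    by (intro tendsto_intros LIMSEQ_power_zero) simp
  then show ?thesis by (simp add: tol_def[abs_def])
qed

lemma lipc_eventually:
  assumes "\<sigma> > 0"
  shows "\<forall>\<^sub>F k in sequentially. lipc \<sigma> k = 1/2"
proof -
  have "((\<lambda>k. exp (- \<sigma>) ^ k + \<tau> k) \<longlongrightarrow> 0 + 0) sequentially"
    using assms by (intro tendsto_add LIMSEQ_power_zero tol_tendsto) auto
  then have "\<forall>\<^sub>F k in sequentially. exp (- \<sigma>) ^ k + \<tau> k < 1/4"
    by (auto dest: order_tendstoD(2)[of _ _ _ "1/4"])
  then show ?thesis
  proof eventually_elim
    case (elim k)
    have "exp (- \<Lambda> k * \<sigma>) \<le> exp (real k * (- \<sigma>))"
      using Lam_ge[of k] assms by (simp add: mult_right_mono)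
    also have "\<dots> = exp (- \<sigma>) ^ k" by (rule exp_of_nat_mult)
    finally show ?case using elim by (simp add: lipc_def)
  qed
qed

text \<open>The telescoping form suits both the Weierstrass M-test and the summation of Dirichlet
  series.\<close>

definition tower_lim where "tower_lim k s = (\<Sum>n. tower s k (Suc n) 0 - tower s k n 0)" for k s

lemma summable_prod_lipc:
  assumes "\<sigma> > 0"
  shows "summable (\<lambda>n. \<Prod>j<n. lipc \<sigma> (k + j))"
proof -
  obtain K where K: "\<And>j. j \<ge> K \<Longrightarrow> lipc \<sigma> j = 1/2"
    using lipc_eventually[OF assms] unfolding eventually_sequentially by blast
  show ?thesis
  proof (rule summable_ratio_test[of "1/2" K])
    fix n assume "n \<ge> K"
    then have "lipc \<sigma> (k + n) = 1/2" using K[of "k + n"] by simp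
    then show "norm (\<Prod>j<Suc n. lipc \<sigma> (k + j)) \<le> 1/2 * norm (\<Prod>j<n. lipc \<sigma> (k + j))"
      by (simp only: prod.lessThan_Suc norm_mult) simp
  qed simp
qed

lemma uniform_limit_tower:
  assumes "\<sigma> > 0"
  shows "uniform_limit {s. Re s \<ge> \<sigma>} (\<lambda>n s. tower s k n 0) (tower_lim k) sequentially"
proof -
  have "uniform_limit {s. Re s \<ge> \<sigma>} (\<lambda>n s. \<Sum>i<n. tower s k (Suc i) 0 - tower s k i 0) (tower_lim k) sequentially"
    unfolding tower_lim_def
    by (rule Weierstrass_m_test[OF _ summable_prod_lipc[OF assms, of k]]) (use tower_step_le assms in auto)
  moreover have "(\<Sum>i<n. tower s k (Suc i) 0 - tower s k i 0) = tower s k n 0" for n s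
    using sum_lessThan_telescope[of "\<lambda>i. tower s k i 0" n] by (simp del: tower.simps(2))
  ultimately show ?thesis by (simp del: tower.simps)
qed

lemma tower_tendsto_lim: "Re s > 0 \<Longrightarrow> (\<lambda>n. tower s k n 0) \<longlonglongrightarrow> tower_lim k s"
  using tendsto_uniform_limitI[OF uniform_limit_tower[of "Re s" k], of s] by simp

lemma tower_lim_holomorphic: "tower_lim k holomorphic_on halfplane 0"
proof (rule holomorphic_uniform_sequence)
  show "(\<lambda>s. tower s k n 0) holomorphic_on halfplane 0" for n by (rule tower_holomorphic)
  fix x assume x: "x \<in> halfplane 0"
  define d where "d = Re x / 2"
  have d: "d > 0" using x by (simp add: d_def)
  have sub: "cball x d \<subseteq> {s. Re s \<ge> d}"
  proof
    fix y assume "y \<in> cball x d"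
    then have "\<bar>Re (x - y)\<bar> \<le> d" using abs_Re_le_cmod[of "x - y"] by (simp add: dist_norm)
    then have "Re x - Re y \<le> Re x / 2" unfolding d_def minus_complex.sel by linarith
    then show "y \<in> {s. Re s \<ge> d}" by (simp add: d_def)
  qed
  show "\<exists>d>0. cball x d \<subseteq> halfplane 0 \<and> uniform_limit (cball x d) (\<lambda>n s. tower s k n 0) (tower_lim k) sequentially"
  proof (intro exI[of _ d] conjI)
    show "cball x d \<subseteq> halfplane 0" using sub d by force
    show "uniform_limit (cball x d) (\<lambda>n s. tower s k n 0) (tower_lim k) sequentially"
      by (rule uniform_limit_on_subset[OF uniform_limit_tower[OF d] sub])
  qed (rule d)
qed simp

lemma norm_tower_lim_le:
  assumes "Re s > 0"
  shows "norm (tower_lim k s) \<le> 1"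
proof (rule tendsto_upperbound[OF tendsto_norm[OF tower_tendsto_lim[OF assms]]])
  show "\<forall>\<^sub>F n in sequentially. norm (tower s k n 0) \<le> 1"
    by (intro always_eventually allI norm_tower_le assms) simp
qed simp

lemma tower_lim_rec:
  assumes "Re s > 0"
  shows "tower_lim k s = \<phi> k s (tower_lim (Suc k) s)"
proof (rule LIMSEQ_unique)
  show "(\<lambda>n. tower s k (Suc n) 0) \<longlonglongrightarrow> tower_lim k s"
    by (rule LIMSEQ_Suc[OF tower_tendsto_lim[OF assms]])
  show "(\<lambda>n. tower s k (Suc n) 0) \<longlonglongrightarrow> \<phi> k s (tower_lim (Suc k) s)"
    unfolding tower.simps \<phi>_def using denom_nonzero[OF norm_tower_lim_le[OF assms]] assms
    by (intro tendsto_intros tower_tendsto_lim) auto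
qed

lemma norm_tower_lim_less: "Re s > 0 \<Longrightarrow> norm (tower_lim k s) < 1"
  by (subst tower_lim_rec) (auto intro: norm_phi_less norm_tower_lim_le)

lemma tower_lim_eq_tower:
  assumes "Re s > 0"
  shows "tower_lim j s = tower s j n (tower_lim (j + n) s)"
proof (induction n arbitrary: j)
  case (Suc n)
  have "tower_lim j s = \<phi> j s (tower_lim (Suc j) s)" by (rule tower_lim_rec[OF assms])
  also have "tower_lim (Suc j) s = tower s (Suc j) n (tower_lim (j + Suc n) s)" by (subst Suc) simp
  finally show ?case by simp
qed simp

section \<open>The limit is represented by a Dirichlet series\<close>

lemma tower_abs_dirichlet: "abs_dirichlet (\<lambda>s. tower s k n 0) (1/2)"
proof (induction n arbitrary: k)
  case 0
  show ?case by (rule abs_dirichlet_cong[OF abs_dirichlet_const[of 0]]) auto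
next
  case (Suc n)
  note x = Suc[of "Suc k"]
  \<comment> \<open>\<open>(1/8 + 1/16) / (1 - 1/16) = 1/5\<close>, so the ball of radius 1/2 in the
    algebra is preserved.\<close>
  have "abs_dirichlet (\<lambda>s. (a k s + Z k s ^ 2 * tower s (Suc k) n 0) * (1 / (1 + a k s * tower s (Suc k) n 0)))
      ((1/8 + 1/8 * (1/2)) * (1 / (1 - 1/8 * (1/2))))"
    unfolding Z_def by (intro abs_dirichlet_mult abs_dirichlet_add abs_dirichlet_inverse_one_plus
        a_dirichlet Z_dirichlet x) simp
  then show ?case by (rule abs_dirichlet_cong) (auto simp: \<phi>_def)
qed

text \<open>\<open>phi_diff\<close> inside the algebra: one level contracts by
  \<open>(1/8 + 1/64) / (1 - 1/16)^2 = 0.16\<close>, which is below 1/4.\<close>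

lemma tower_step_abs_dirichlet: "abs_dirichlet (\<lambda>s. tower s k (Suc n) 0 - tower s k n 0) ((1/4) ^ n)"
proof (induction n arbitrary: k)
  case 0
  show ?case by (rule abs_dirichlet_cong[OF tower_abs_dirichlet[of k "Suc 0"]]) auto
next
  case (Suc n)
  define x where "x s = tower s (Suc k) (Suc n) 0" for s
  define x' where "x' s = tower s (Suc k) n 0" for s
  have x: "abs_dirichlet x (1/2)" "abs_dirichlet x' (1/2)"
    unfolding x_def x'_def by (rule tower_abs_dirichlet)+
  have dx: "abs_dirichlet (\<lambda>s. x s - x' s) ((1/4) ^ n)" unfolding x_def x'_def by (rule Suc)
  have "abs_dirichlet (\<lambda>s. (Z k s ^ 2 - a k s * a k s) * (x s - x' s) *
      ((1 / (1 + a k s * x s)) * (1 / (1 + a k s * x' s))))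
      ((1/8 + 1/8 * (1/8)) * (1/4) ^ n * ((1 / (1 - 1/8 * (1/2))) * (1 / (1 - 1/8 * (1/2)))))"
    unfolding Z_def by (intro abs_dirichlet_mult abs_dirichlet_diff abs_dirichlet_inverse_one_plus
        a_dirichlet Z_dirichlet x dx) simp_all
  then show ?case
  proof (rule abs_dirichlet_cong)
    show "(1/8 + 1/8 * (1/8)) * (1/4) ^ n * ((1 / (1 - 1/8 * (1/2))) * (1 / (1 - 1/8 * (1/2)))) \<le> (1/4 :: real) ^ Suc n"
      by simp
  next
    fix s :: complex assume s: "Re s \<ge> 1"
    have "norm (x s) \<le> 1" "norm (x' s) \<le> 1" unfolding x_def x'_def using s by (auto intro!: norm_tower_le simp del: tower.simps)
    from phi_diff[OF this, of s k] s
    show "tower s k (Suc (Suc n)) 0 - tower s k (Suc n) 0 = (Z k s ^ 2 - a k s * a k s) * (x s - x' s) *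
      ((1 / (1 + a k s * x s)) * (1 / (1 + a k s * x' s)))"
      unfolding tower.simps(2)[of s k] x_def x'_def by (simp add: power2_eq_square del: tower.simps)
  qed
qed

lemma tower_lim_abs_dirichlet: "abs_dirichlet (tower_lim k) (4/3)"
proof (rule abs_dirichlet_has_sum)
  show "abs_dirichlet (\<lambda>s. tower s k (Suc n) 0 - tower s k n 0) ((1/4) ^ n)" for n
    by (rule tower_step_abs_dirichlet)
  show "((\<lambda>n. (1/4) ^ n) has_sum (4/3::real)) UNIV"
    using has_sum_geometric_power[of "1/4::real"] by simp
  fix s :: complex assume s: "Re s \<ge> 1"
  show "((\<lambda>n. tower s k (Suc n) 0 - tower s k n 0) has_sum tower_lim k s) UNIV"
  proof (rule norm_summable_imp_has_sum)
    show "summable (\<lambda>n. norm (tower s k (Suc n) 0 - tower s k n 0))"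
      by (rule summable_comparison_test_ev[OF always_eventually summable_prod_lipc[of 1 k]])
        (use s tower_step_le[of 1 s k] in auto)
    then show "(\<lambda>n. tower s k (Suc n) 0 - tower s k n 0) sums tower_lim k s"
      unfolding tower_lim_def by (rule summable_sums[OF summable_norm_cancel])
  qed
qed

lemma dirichlet_series_to_disc_tower_lim: "dirichlet_series_to_disc (tower_lim k)"
  unfolding dirichlet_series_to_disc_def
proof (intro conjI)
  show "tower_lim k analytic_on halfplane 0" using tower_lim_holomorphic by (simp add: analytic_on_open)
  show "tower_lim k ` halfplane 0 \<subseteq> ball 0 1" using norm_tower_lim_less by auto
  obtain c :: "nat \<Rightarrow> complex" where "\<And>s. Re s > 1 \<Longrightarrow> (\<lambda>n. c (Suc n) * of_nat (Suc n) powr (- s)) sums tower_lim k s"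
    using abs_dirichlet_imp_sums[OF tower_lim_abs_dirichlet] by blast
  then show "\<exists>c :: nat \<Rightarrow> complex. \<exists>\<kappa>>0. \<forall>s\<in>halfplane \<kappa>. (\<lambda>n. c (Suc n) * of_nat (Suc n) powr (- s)) sums tower_lim k s"
    by (intro exI[of _ c] exI[of _ 1]) auto
qed

section \<open>Smallness away from the windows\<close>

lemma norm_phi_le_add:
  assumes "norm (a k s) \<le> \<tau> k" "norm x \<le> 1" "Re s \<ge> 0"
  shows "norm (\<phi> k s x) \<le> norm x + 4 * \<tau> k"
proof -
  define t where "t = \<tau> k"
  have t: "0 < t" "t \<le> 1/64" using tol_pos[of k] tol_le'[of k] by (auto simp: t_def)
  have "norm (a k s + Z k s ^ 2 * x) \<le> t + norm x"
  proof -
    have "norm (Z k s ^ 2 * x) \<le> 1 * norm x"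
      unfolding norm_mult by (intro mult_right_mono norm_Z2_le assms) auto
    then show ?thesis using norm_triangle_ineq[of "a k s" "Z k s ^ 2 * x"] assms(1) by (simp add: t_def)
  qed
  moreover have "norm (1 + a k s * x) \<ge> 1 - t" using denom_ge[OF assms(2), of k s] assms(1) by (simp add: t_def)
  ultimately have "norm (\<phi> k s x) \<le> (t + norm x) / (1 - t)"
    unfolding \<phi>_def norm_divide using t by (intro frac_le) auto
  also have "\<dots> \<le> norm x + 4 * t"
  proof -
    have "norm x * t \<le> 1 * t" using assms t by (intro mult_right_mono) auto
    moreover have "t * t \<le> 1/64 * t" using t by (intro mult_right_mono) auto
    ultimately have "t + norm x \<le> (norm x + 4 * t) * (1 - t)" using t by (simp only: algebra_simps)
    then show ?thesis using t by (simp add: divide_le_eq)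
  qed
  finally show ?thesis by (simp add: t_def)
qed

text \<open>Each level adds at most \<open>4 * \<tau> k\<close>, and since \<tau> decays by the
  factor 4 one has \<open>4 * \<tau> k + 8 * \<tau> (Suc k) \<le> 8 * \<tau> k\<close>.\<close>

lemma norm_tower_le_tol:
  assumes "\<And>j. j \<ge> k \<Longrightarrow> norm (a j s) \<le> \<tau> j" "Re s > 0"
  shows "norm (tower s k n 0) \<le> 8 * \<tau> k"
  using assms(1)
proof (induction n arbitrary: k)
  case 0
  show ?case using tol_pos[of k] by simp
next
  case (Suc n)
  have "norm (tower s k (Suc n) 0) \<le> norm (tower s (Suc k) n 0) + 4 * \<tau> k"
    unfolding tower.simps using Suc.prems assms(2)
    by (intro norm_phi_le_add norm_tower_le) auto
  also have "norm (tower s (Suc k) n 0) \<le> 8 * \<tau> (Suc k)" using Suc.prems by (intro Suc.IH) auto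
  finally show ?case using tol_Suc[of k] tol_pos[of k] by simp
qed

lemma norm_tower_lim_le_tol:
  assumes "\<And>j. j \<ge> k \<Longrightarrow> norm (a j s) \<le> \<tau> j" "Re s > 0"
  shows "norm (tower_lim k s) \<le> 8 * \<tau> k"
proof (rule tendsto_upperbound[OF tendsto_norm[OF tower_tendsto_lim[OF assms(2)]]])
  show "\<forall>\<^sub>F n in sequentially. norm (tower s k n 0) \<le> 8 * \<tau> k"
    using norm_tower_le_tol[OF assms] by (intro always_eventually) auto
qed simp

text \<open>For large real part the outermost map alone decides: \<open>a 0 s\<close> and
  \<open>Z 0 s\<close> are small, whatever the inner value is. This confines the \<xi>-points to a
  strip and supplies the base points for \<open>sum_zorder_strip_le\<close>.\<close>

lemma norm_tower_lim_far:
  assumes "Re s \<ge> ln (64 / \<epsilon>)"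
  shows "norm (tower_lim 0 s) \<le> \<epsilon> / 2"
proof -
  have "ln (64 / \<epsilon>) > 0" using eps by (intro ln_gt_zero) (simp add: field_simps)
  then have s: "Re s > 0" using assms by simp
  have "exp (- \<Lambda> 0 * Re s) \<le> exp (- Re s)" using Lam_ge[of 0] s by simp
  also have "\<dots> \<le> exp (- ln (64 / \<epsilon>))" using assms by simp
  also have "\<dots> = \<epsilon> / 64" using eps by (simp add: exp_minus)
  finally have e: "exp (- \<Lambda> 0 * Re s) \<le> \<epsilon> / 64" .
  have a: "norm (a 0 s) \<le> \<epsilon> / 32" using norm_a_le_decay[of s 0] e tol_le[of 0] s by linarith
  have "norm (Z 0 s) * norm (Z 0 s) \<le> \<epsilon> / 64 * 1"
    using e norm_Z_le[of s 0] s eps by (intro mult_mono) (auto simp: norm_Z)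
  then have z: "norm (Z 0 s ^ 2) \<le> \<epsilon> / 64" unfolding power2_eq_square norm_mult by linarith
  define x where "x = tower_lim (Suc 0) s"
  have x: "norm x \<le> 1" unfolding x_def by (rule norm_tower_lim_le[OF s])
  have "norm (Z 0 s ^ 2 * x) \<le> \<epsilon> / 64 * 1" unfolding norm_mult using z x eps by (intro mult_mono) auto
  then have n: "norm (a 0 s + Z 0 s ^ 2 * x) \<le> \<epsilon> / 16"
    using norm_triangle_ineq[of "a 0 s" "Z 0 s ^ 2 * x"] a eps by linarith
  have "norm (1 + a 0 s * x) \<ge> 1/2" using denom_ge[OF x, of 0 s] a eps by linarith
  then have "norm (\<phi> 0 s x) \<le> (\<epsilon> / 16) / (1/2)"
    unfolding \<phi>_def norm_divide using n eps by (intro frac_le) auto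
  then show ?thesis unfolding tower_lim_rec[OF s, of 0] x_def using eps by simp
qed

section \<open>Stability of the composition, and its action on the imaginary axis\<close>

lemma phi_lip_tol:
  assumes "norm (a k s) \<le> \<tau> k" "norm x \<le> 1" "norm x' \<le> 1" "Re s \<ge> 0"
  shows "norm (\<phi> k s x - \<phi> k s x') \<le> (1 + 4 * \<tau> k) * norm (x - x')"
proof -
  define t where "t = \<tau> k"
  have t: "0 < t" "t \<le> 1/64" using tol_pos[of k] tol_le'[of k] by (auto simp: t_def)
  have "norm (\<phi> k s x - \<phi> k s x') \<le> (1 + t\<^sup>2) / (1 - t)\<^sup>2 * norm (x - x')"
    by (rule phi_lip) (use assms t norm_Z2_le in \<open>auto simp: t_def\<close>)
  also have "(1 + t\<^sup>2) / (1 - t)\<^sup>2 \<le> 1 + 4 * t"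
  proof -
    have "t * t \<le> 1/64 * t" using t by (intro mult_right_mono) auto
    moreover have "t * (t * t) \<ge> 0" using t by simp
    ultimately have "1 + t\<^sup>2 \<le> (1 + 4 * t) * (1 - t)\<^sup>2"
      using t by (simp only: power2_eq_square algebra_simps)
    then show ?thesis using t by (simp add: divide_le_eq)
  qed
  finally show ?thesis by (simp add: t_def mult_right_mono)
qed

text \<open>Errors add up: level \<open>j\<close> contributes the variation
  \<open>\<kappa> j\<close> of its map at a fixed argument, while the Lipschitz factors
  \<open>1 + 4 * \<tau> j\<close> multiply to at most \<open>1 + 8 * \<tau> i\<close> because \<tau>
  decays by the factor 4.\<close>

lemma tower_perturbation:
  assumes "Re s \<ge> 0"
    and small: "\<And>j. i \<le> j \<Longrightarrow> j < i + m \<Longrightarrow> norm (a j s) \<le> \<tau> j"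
    and xs: "\<And>j n. norm (tower s j n x) \<le> 1" and qs: "\<And>j n. norm (tower p j n q) \<le> 1"
    and \<kappa>: "\<And>j z. i \<le> j \<Longrightarrow> j < i + m \<Longrightarrow> norm z \<le> 1 \<Longrightarrow> norm (\<phi> j s z - \<phi> j p z) \<le> \<kappa> j"
    and \<kappa>0: "\<And>j. \<kappa> j \<ge> 0"
  shows "norm (tower s i m x - tower p i m q) \<le> (1 + 8 * \<tau> i) * (norm (x - q) + (\<Sum>j=i..<i+m. \<kappa> j))"
  using small \<kappa>
proof (induction m arbitrary: i)
  case 0
  have "1 * norm (x - q) \<le> (1 + 8 * \<tau> i) * norm (x - q)" using tol_pos[of i] by (intro mult_right_mono) auto
  then show ?case by simp
next
  case (Suc m)
  define E where "E = norm (x - q) + (\<Sum>j=Suc i..<Suc i+m. \<kappa> j)"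
  have E: "E \<ge> 0" unfolding E_def by (intro add_nonneg_nonneg sum_nonneg \<kappa>0) auto
  define t where "t = \<tau> i"
  have t: "0 < t" "t \<le> 1/64" using tol_pos[of i] tol_le'[of i] by (auto simp: t_def)
  have IH: "norm (tower s (Suc i) m x - tower p (Suc i) m q) \<le> (1 + 8 * \<tau> (Suc i)) * E"
    unfolding E_def by (rule Suc.IH) (use Suc.prems in auto)
  \<comment> \<open>The inner argument is changed under the map at \<open>s\<close>, and the base
    point at the inner argument belonging to \<open>p\<close>.\<close>
  have "norm (tower s i (Suc m) x - tower p i (Suc m) q) \<le>
      norm (\<phi> i s (tower s (Suc i) m x) - \<phi> i s (tower p (Suc i) m q)) +
      norm (\<phi> i s (tower p (Suc i) m q) - \<phi> i p (tower p (Suc i) m q))"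
    unfolding tower.simps
    using norm_triangle_ineq[of "\<phi> i s (tower s (Suc i) m x) - \<phi> i s (tower p (Suc i) m q)"
        "\<phi> i s (tower p (Suc i) m q) - \<phi> i p (tower p (Suc i) m q)"] by simp
  also have "\<dots> \<le> (1 + 4 * t) * norm (tower s (Suc i) m x - tower p (Suc i) m q) + \<kappa> i"
    unfolding t_def by (intro add_mono phi_lip_tol xs qs Suc.prems assms) auto
  also have "\<dots> \<le> (1 + 4 * t) * ((1 + 2 * t) * E) + \<kappa> i"
    using IH t by (intro add_mono mult_left_mono) (auto simp: tol_Suc t_def)
  also have "\<dots> \<le> (1 + 8 * t) * (E + \<kappa> i)"
  proof -
    have "t * t \<le> 1/64 * t" using t by (intro mult_right_mono) auto
    then have "(1 + 4 * t) * (1 + 2 * t) \<le> 1 + 8 * t" using t by (simp add: algebra_simps)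
    from mult_right_mono[OF this E] have "(1 + 4 * t) * ((1 + 2 * t) * E) \<le> (1 + 8 * t) * E" by simp
    moreover have "1 * \<kappa> i \<le> (1 + 8 * t) * \<kappa> i" using t \<kappa>0[of i] by (intro mult_right_mono) auto
    ultimately show ?thesis by (simp add: algebra_simps)
  qed
  also have "E + \<kappa> i = norm (x - q) + (\<Sum>j=i..<i + Suc m. \<kappa> j)"
    unfolding E_def by (simp add: sum.atLeast_Suc_lessThan)
  finally show ?case by (simp add: t_def)
qed

lemma norm_Z_imag: "Re p = 0 \<Longrightarrow> norm (Z k p) = 1"
  by (simp add: norm_Z)

lemma a_imag':
  assumes "Re p = 0"
  shows "a k p = Z k p * of_real (r k (Im p))"
proof -
  have "p = \<i> * of_real (Im p)" using assms by (simp add: complex_eq_iff)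
  then show ?thesis using a_imag[of k "Im p"] unfolding Z_def by metis
qed

text \<open>On the imaginary axis \<open>\<phi> k p\<close> is an automorphism of the disc.\<close>
lemma phi_imag_identity:
  assumes "Re p = 0"
  shows "(norm (1 + a k p * x))\<^sup>2 - (norm (a k p + Z k p ^ 2 * x))\<^sup>2 = (1 - (norm (a k p))\<^sup>2) * (1 - (norm x)\<^sup>2)"
proof -
  define c where "c = r k (Im p)"
  define v where "v = Z k p * x"
  have Z: "norm (Z k p) = 1" using norm_Z_imag[OF assms] .
  have a: "a k p = Z k p * of_real c" unfolding c_def by (rule a_imag'[OF assms])
  have nv: "norm v = norm x" by (simp add: v_def norm_mult Z)
  have "norm (a k p + Z k p ^ 2 * x) = norm (Z k p * (of_real c + v))"
    by (simp add: a v_def power2_eq_square algebra_simps)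
  also have "\<dots> = norm (of_real c + v)" by (simp add: norm_mult Z)
  finally have 1: "norm (a k p + Z k p ^ 2 * x) = norm (of_real c + v)" .
  have 2: "norm (1 + a k p * x) = norm (1 + of_real c * v)" by (simp add: a v_def ac_simps)
  have 3: "norm (a k p) = \<bar>c\<bar>" by (simp add: a norm_mult Z)
  show ?thesis unfolding 1 2 3 nv[symmetric] unfolding cmod_power2
    by (simp add: power2_eq_square algebra_simps)
qed

lemma norm_a_imag_less: "Re p = 0 \<Longrightarrow> norm (a k p) < 1"
  using norm_a_le[of p k] dip_pos[of k] by simp

lemma norm_phi_imag_le:
  assumes "Re p = 0" "norm x \<le> 1"
  shows "norm (\<phi> k p x) \<le> 1"
proof -
  have "(norm (a k p))\<^sup>2 \<le> 1" "(norm x)\<^sup>2 \<le> 1"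
    using norm_a_imag_less[OF assms(1), of k] assms(2) by (auto simp: abs_square_le_1)
  then have "(norm (a k p + Z k p ^ 2 * x))\<^sup>2 \<le> (norm (1 + a k p * x))\<^sup>2"
    using phi_imag_identity[OF assms(1), of k x] by (smt (verit) mult_nonneg_nonneg)
  then have "norm (a k p + Z k p ^ 2 * x) \<le> norm (1 + a k p * x)" by (rule power2_le_imp_le) simp
  then show ?thesis unfolding \<phi>_def norm_divide using denom_nonzero[OF assms(2), of p k] assms(1)
    by (simp add: divide_le_eq)
qed

lemma norm_tower_imag_le: "Re p = 0 \<Longrightarrow> norm x \<le> 1 \<Longrightarrow> norm (tower p k n x) \<le> 1"
  by (induction n arbitrary: k) (auto intro: norm_phi_imag_le)

text \<open>On the axis \<open>norm (Z k p) = 1\<close>, so a small \<open>a k p\<close> gives a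
  perturbed rotation; the difference formula \<open>phi_diff\<close> is estimated from
  below.\<close>

lemma phi_imag_expand:
  assumes "Re p = 0" "norm (a k p) \<le> \<tau> k" "norm x \<le> 1" "norm x' \<le> 1"
  shows "norm (\<phi> k p x - \<phi> k p x') \<ge> (1 - 2 * \<tau> k) * norm (x - x')"
proof -
  define t where "t = \<tau> k"
  have t: "0 < t" "t \<le> 1/64" using tol_pos[of k] tol_le'[of k] by (auto simp: t_def)
  have up: "norm (1 + a k p * x) \<le> 1 + t" if "norm x \<le> 1" for x
  proof -
    have "norm (a k p * x) \<le> t * 1" unfolding norm_mult using assms that t by (intro mult_mono) (auto simp: t_def)
    then show ?thesis using norm_triangle_ineq[of 1 "a k p * x"] by simp
  qed
  have nz: "norm (1 + a k p * x) > 0" if "norm x \<le> 1" for x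
    using denom_nonzero[OF that, of p k] assms(1) by simp
  have "norm (a k p) ^ 2 \<le> t\<^sup>2" using assms t by (intro power_mono) (auto simp: t_def)
  then have 1: "norm (Z k p ^ 2 - a k p ^ 2) \<ge> 1 - t\<^sup>2"
    using norm_triangle_ineq2[of "Z k p ^ 2" "a k p ^ 2"] norm_Z_imag[OF assms(1), of k] by (simp add: norm_power)
  have t2: "t\<^sup>2 \<le> 1" using t by (simp add: abs_square_le_1)
  have "(1 - 2 * t) * norm (x - x') \<le> (1 - t\<^sup>2) / (1 + t)\<^sup>2 * norm (x - x')"
  proof (rule mult_right_mono)
    have "(1 - 2 * t) * (1 + t)\<^sup>2 \<le> 1 - t\<^sup>2"
    proof -
      have "t * (t * t) \<ge> 0" "t * t \<ge> 0" using t by auto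
      then show ?thesis by (simp add: power2_eq_square algebra_simps)
    qed
    then show "1 - 2 * t \<le> (1 - t\<^sup>2) / (1 + t)\<^sup>2" using t by (simp add: le_divide_eq)
  qed simp
  also have "\<dots> = (1 - t\<^sup>2) * norm (x - x') / ((1 + t) * (1 + t))" by (simp add: power2_eq_square)
  also have "\<dots> \<le> norm (Z k p ^ 2 - a k p ^ 2) * norm (x - x') / (norm (1 + a k p * x) * norm (1 + a k p * x'))"
    using 1 t t2 up[OF assms(3)] up[OF assms(4)] nz[OF assms(3)] nz[OF assms(4)]
    by (intro frac_le mult_mono mult_right_mono mult_pos_pos) auto
  also have "\<dots> = norm (\<phi> k p x - \<phi> k p x')"
    using assms by (subst phi_diff) (auto simp: norm_divide norm_mult)
  finally show ?thesis by (simp add: t_def)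
qed

lemma tower_imag_expand:
  assumes "Re p = 0" "\<And>j. i \<le> j \<Longrightarrow> j < i + m \<Longrightarrow> norm (a j p) \<le> \<tau> j" "norm x \<le> 1" "norm x' \<le> 1"
  shows "norm (tower p i m x - tower p i m x') \<ge> (1 - 8 * \<tau> i) * norm (x - x')"
  using assms(2)
proof (induction m arbitrary: i)
  case 0
  have "(1 - 8 * \<tau> i) * norm (x - x') \<le> 1 * norm (x - x')" using tol_pos[of i] by (intro mult_right_mono) auto
  then show ?case by simp
next
  case (Suc m)
  define t where "t = \<tau> i"
  have t: "0 < t" "t \<le> 1/64" using tol_pos[of i] tol_le'[of i] by (auto simp: t_def)
  have IH: "(1 - 2 * t) * norm (x - x') \<le> norm (tower p (Suc i) m x - tower p (Suc i) m x')"
    using Suc.IH[of "Suc i"] Suc.prems by (simp add: tol_Suc t_def)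
  have "(1 - 8 * t) * norm (x - x') \<le> ((1 - 2 * t) * (1 - 2 * t)) * norm (x - x')"
    using t by (intro mult_right_mono) (auto simp: algebra_simps)
  also have "\<dots> = (1 - 2 * t) * ((1 - 2 * t) * norm (x - x'))" by simp
  also have "\<dots> \<le> (1 - 2 * t) * norm (tower p (Suc i) m x - tower p (Suc i) m x')"
    using IH t by (intro mult_left_mono) auto
  also have "\<dots> \<le> norm (tower p i (Suc m) x - tower p i (Suc m) x')"
    unfolding tower.simps t_def by (intro phi_imag_expand norm_tower_imag_le assms Suc.prems) auto
  finally show ?case by (simp add: t_def)
qed

text \<open>The inverse Moebius map is explicit. By \<open>phi_imag_identity\<close> the defect
  \<open>1 - (norm x)\<^sup>2\<close> loses at most a factor near 1 against that of \<xi>, so the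
  preimage does not drift to the unit circle.\<close>

lemma phi_imag_surj:
  assumes "Re p = 0" "norm (a k p) \<le> \<tau> k" "norm \<xi> < 1"
  obtains x where "norm x < 1" "\<phi> k p x = \<xi>"
    "1 - (norm x)\<^sup>2 \<ge> (1 - 2 * \<tau> k) * (1 - (norm \<xi>)\<^sup>2)" "norm x \<ge> norm \<xi> - 4 * \<tau> k"
proof -
  define t where "t = \<tau> k"
  have t: "0 < t" "t \<le> 1/64" using tol_pos[of k] tol_le'[of k] by (auto simp: t_def)
  define A where "A = a k p"
  define Y where "Y = Z k p ^ 2"
  have A: "norm A \<le> t" using assms(2) by (simp add: A_def t_def)
  have Y: "norm Y = 1" using norm_Z_imag[OF assms(1), of k] by (simp add: Y_def norm_power)
  have Ax: "norm (A * \<xi>) < 1" using A t assms(3) mult_mono[of "norm A" t "norm \<xi>" 1] by (simp add: norm_mult)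
  then have d: "Y - A * \<xi> \<noteq> 0" using Y by auto
  have dA: "Y - A\<^sup>2 \<noteq> 0"
  proof -
    have "norm (A\<^sup>2) \<le> t\<^sup>2" using A t by (simp add: norm_power power_mono)
    also have "\<dots> < 1" using t by (simp add: abs_square_less_1)
    finally show ?thesis using Y by auto
  qed
  define x where "x = (\<xi> - A) / (Y - A * \<xi>)"
  have e1: "1 + A * x = (Y - A\<^sup>2) / (Y - A * \<xi>)"
    using d by (simp add: x_def field_simps power2_eq_square)
  have e2: "A + Y * x = \<xi> * (Y - A\<^sup>2) / (Y - A * \<xi>)"
    using d by (simp add: x_def field_simps power2_eq_square)
  have "(A + Y * x) / (1 + A * x) = \<xi>" unfolding e1 e2 using d dA by simp
  then have phix: "\<phi> k p x = \<xi>" by (simp add: \<phi>_def A_def Y_def)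
  have "A + Y * x = \<xi> * (1 + A * x)" unfolding e1 e2 by simp
  then have nn: "norm (A + Y * x) = norm \<xi> * norm (1 + A * x)" by (simp add: norm_mult)
  have id: "(1 - (norm \<xi>)\<^sup>2) * (norm (1 + A * x))\<^sup>2 = (1 - (norm A)\<^sup>2) * (1 - (norm x)\<^sup>2)"
    using phi_imag_identity[OF assms(1), of k x] nn unfolding A_def[symmetric] Y_def[symmetric]
    by (simp add: algebra_simps power_mult_distrib)
  have n1: "norm (1 + A * x) > 0" unfolding e1 using d dA by simp
  have xi2: "1 - (norm \<xi>)\<^sup>2 > 0" using assms(3) by (simp add: abs_square_less_1)
  have A2: "(norm A)\<^sup>2 \<le> t\<^sup>2" using A by (intro power_mono) auto
  have t2: "t\<^sup>2 < 1" using t by (simp add: abs_square_less_1)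
  have "(1 - (norm A)\<^sup>2) * (1 - (norm x)\<^sup>2) > 0"
    unfolding id[symmetric] using xi2 n1 by simp
  then have x2: "1 - (norm x)\<^sup>2 > 0" using A2 t2 by (simp add: zero_less_mult_iff)
  then have "(norm x)\<^sup>2 < 1\<^sup>2" by simp
  then have x1: "norm x < 1" by (rule power_less_imp_less_base) simp
  have "norm (1 + A * x) \<ge> 1 - t" using denom_ge[of x k p] x1 A by (simp add: A_def)
  then have "(1 - t)\<^sup>2 \<le> (norm (1 + A * x))\<^sup>2" using t by (intro power_mono) auto
  then have "(1 - (norm \<xi>)\<^sup>2) * (1 - t)\<^sup>2 \<le> (1 - (norm A)\<^sup>2) * (1 - (norm x)\<^sup>2)"
    unfolding id[symmetric] using xi2 by (intro mult_left_mono) auto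
  also have "\<dots> \<le> 1 * (1 - (norm x)\<^sup>2)" using x2 by (intro mult_right_mono) auto
  finally have "(1 - (norm \<xi>)\<^sup>2) * (1 - t)\<^sup>2 \<le> 1 - (norm x)\<^sup>2" by simp
  moreover have "(1 - (norm \<xi>)\<^sup>2) * (1 - 2 * t) \<le> (1 - (norm \<xi>)\<^sup>2) * (1 - t)\<^sup>2"
    using xi2 by (intro mult_left_mono) (auto simp: power2_eq_square algebra_simps)
  ultimately have 3: "(1 - 2 * t) * (1 - (norm \<xi>)\<^sup>2) \<le> 1 - (norm x)\<^sup>2" by (simp add: mult.commute)
  have "norm \<xi> \<le> norm x + 4 * t"
    using norm_phi_le_add[OF assms(2), of x] x1 assms(1) phix by (simp add: t_def)
  then show thesis using that[OF x1 phix] 3 by (simp add: t_def)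
qed

lemma tower_imag_surj:
  assumes "Re p = 0" "\<And>j. i \<le> j \<Longrightarrow> j < i + m \<Longrightarrow> norm (a j p) \<le> \<tau> j" "norm \<xi> < 1"
  shows "\<exists>x. norm x < 1 \<and> tower p i m x = \<xi> \<and>
    1 - (norm x)\<^sup>2 \<ge> (1 - 8 * \<tau> i) * (1 - (norm \<xi>)\<^sup>2) \<and> norm x \<ge> norm \<xi> - 8 * \<tau> i"
  using assms(2,3)
proof (induction m arbitrary: i \<xi>)
  case 0
  have "1 - (norm \<xi>)\<^sup>2 \<ge> 0" using 0 by (simp add: abs_square_le_1)
  then have "(1 - 8 * \<tau> i) * (1 - (norm \<xi>)\<^sup>2) \<le> 1 * (1 - (norm \<xi>)\<^sup>2)"
    using tol_pos[of i] by (intro mult_right_mono) auto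
  then show ?case using 0 tol_pos[of i] by (intro exI[of _ \<xi>]) auto
next
  case (Suc m)
  define t where "t = \<tau> i"
  have t: "0 < t" "t \<le> 1/64" using tol_pos[of i] tol_le'[of i] by (auto simp: t_def)
  obtain x where x: "norm x < 1" "\<phi> i p x = \<xi>"
    "1 - (norm x)\<^sup>2 \<ge> (1 - 2 * t) * (1 - (norm \<xi>)\<^sup>2)" "norm x \<ge> norm \<xi> - 4 * t"
    using phi_imag_surj[OF assms(1), of i \<xi>] Suc.prems unfolding t_def by auto
  obtain x' where x': "norm x' < 1" "tower p (Suc i) m x' = x"
    "1 - (norm x')\<^sup>2 \<ge> (1 - 2 * t) * (1 - (norm x)\<^sup>2)" "norm x' \<ge> norm x - 2 * t"
    using Suc.IH[of "Suc i" x] Suc.prems x(1) by (auto simp: tol_Suc t_def)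
  have xi: "1 - (norm \<xi>)\<^sup>2 \<ge> 0" using Suc.prems by (simp add: abs_square_le_1)
  have "(1 - 8 * t) * (1 - (norm \<xi>)\<^sup>2) \<le> ((1 - 2 * t) * (1 - 2 * t)) * (1 - (norm \<xi>)\<^sup>2)"
    using t xi by (intro mult_right_mono) (auto simp: algebra_simps)
  also have "\<dots> = (1 - 2 * t) * ((1 - 2 * t) * (1 - (norm \<xi>)\<^sup>2))" by simp
  also have "\<dots> \<le> (1 - 2 * t) * (1 - (norm x)\<^sup>2)" using x(3) t by (intro mult_left_mono) auto
  also have "\<dots> \<le> 1 - (norm x')\<^sup>2" by (rule x'(3))
  finally show ?case using x x' t by (intro exI[of _ x']) (auto simp: t_def)
qed

text \<open>Radius, in units of \<open>1 / \<Lambda> k\<close>, of the neighbourhood of a node in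
  which a \<xi>-point is sought. A logarithm of the preimage has real part at most
  \<open>ln (2 / \<epsilon>)\<close> and imaginary part at most \<open>pi\<close> in modulus; the
  disc around it has radius at most 1/8, and 5 exceeds \<open>pi + 1/8\<close>.\<close>

definition V where "V = ln (2 / \<epsilon>) + 5"

lemma V_ge: "V \<ge> 5"
  unfolding V_def using eps by (simp add: field_simps)

section \<open>The local model in a window\<close>

lemma phi_variation:
  assumes s: "Re s \<ge> 0" "Re p \<ge> 0" and z: "norm z \<le> 1"
    and a: "norm (a j s) \<le> \<tau> j" "norm (a j p) \<le> \<tau> j"
  shows "norm (\<phi> j s z - \<phi> j p z) \<le> 16 * D j * norm (s - p)"
proof -
  define A where "A = a j s"
  define A' where "A' = a j p"
  define Y where "Y = Z j s ^ 2"
  define Y' where "Y' = Z j p ^ 2"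
  define d where "d = D j * norm (s - p)"
  have t: "\<tau> j \<le> 1/2" using tol_le'[of j] by simp
  have dA: "norm (A - A') \<le> d" unfolding A_def A'_def d_def by (rule a_lip[OF s])
  have dY: "norm (Y - Y') \<le> d" unfolding Y_def Y'_def Z_def d_def by (rule Z_lip[OF s])
  have nA: "norm A \<le> 1/2" "norm A' \<le> 1/2" using a t by (auto simp: A_def A'_def)
  have nY: "norm Y' \<le> 1" using norm_Z2_le[OF s(2), of j] by (simp add: Y'_def)
  have nz: "1 + A * z \<noteq> 0" "1 + A' * z \<noteq> 0"
    using denom_nonzero[OF z s(1), of j] denom_nonzero[OF z s(2), of j] by (auto simp: A_def A'_def)
  have den: "norm (1 + A * z) \<ge> 1/2" "norm (1 + A' * z) \<ge> 1/2"
    using denom_ge[OF z, of j s] denom_ge[OF z, of j p] nA by (auto simp: A_def A'_def)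
  have "\<phi> j s z - \<phi> j p z = (A + Y * z) / (1 + A * z) - (A' + Y' * z) / (1 + A' * z)"
    by (simp add: \<phi>_def A_def A'_def Y_def Y'_def)
  also have "\<dots> = ((A - A') + ((Y - Y') * z + (((Y - Y') * A' - Y' * (A - A')) * z\<^sup>2))) / ((1 + A * z) * (1 + A' * z))"
    using nz by (simp add: diff_frac_eq) (simp add: algebra_simps power2_eq_square)
  finally have eq: "\<phi> j s z - \<phi> j p z = \<dots>" .
  have b1: "norm ((Y - Y') * z) \<le> d" using dY z mult_mono[of "norm (Y - Y')" d "norm z" 1] order_trans[OF norm_ge_zero dY]
    by (simp add: norm_mult)
  have b2: "norm (((Y - Y') * A' - Y' * (A - A')) * z\<^sup>2) \<le> 2 * d"
  proof -
    have d0: "d \<ge> 0" using order_trans[OF norm_ge_zero dY] .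
    have "norm ((Y - Y') * A') \<le> d * 1" unfolding norm_mult using dY nA d0 by (intro mult_mono) auto
    moreover have "norm (Y' * (A - A')) \<le> 1 * d" unfolding norm_mult using dA nY d0 by (intro mult_mono) auto
    ultimately have "norm ((Y - Y') * A' - Y' * (A - A')) \<le> 2 * d"
      using norm_triangle_ineq4[of "(Y - Y') * A'" "Y' * (A - A')"] by simp
    moreover have "norm (z\<^sup>2) \<le> 1" using z by (simp add: norm_power power_le_one)
    ultimately have "norm ((Y - Y') * A' - Y' * (A - A')) * norm (z\<^sup>2) \<le> (2 * d) * 1"
      using d0 by (intro mult_mono) auto
    then show ?thesis by (simp add: norm_mult)
  qed
  have "norm ((A - A') + ((Y - Y') * z + (((Y - Y') * A' - Y' * (A - A')) * z\<^sup>2))) \<le> 4 * d"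
    by (rule order_trans[OF norm_triangle_ineq], rule order_trans[OF add_left_mono[OF norm_triangle_ineq]])
      (use dA b1 b2 in linarith)
  moreover have "norm ((1 + A * z) * (1 + A' * z)) \<ge> 1/2 * (1/2)"
    unfolding norm_mult using den by (intro mult_mono) auto
  ultimately have "norm (\<phi> j s z - \<phi> j p z) \<le> (4 * d) / (1/2 * (1/2))"
    unfolding eq norm_divide using order_trans[OF norm_ge_zero dY] by (intro frac_le) auto
  then show ?thesis by (simp add: d_def)
qed

text \<open>The difference is a multiple of \<open>x\<close> over a denominator that may be as small
  as \<open>dip k / 2\<close>. The tolerance is chosen as
  \<open>\<epsilon> / 4 * (dip k)\<^sup>2\<close>, so the quotient is still of order
  \<open>dip k\<close>.\<close>

lemma phi_near_a:
  assumes "norm x \<le> 2 * \<tau> k" "Re s \<ge> 0"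
  shows "norm (\<phi> k s x - a k s) \<le> 2 * dip k"
proof -
  have x1: "norm x \<le> 1" using assms(1) tol_le'[of k] by linarith
  have d: "dip k > 0" by (rule dip_pos)
  have eq: "\<phi> k s x - a k s = (Z k s ^ 2 - a k s ^ 2) * x / (1 + a k s * x)"
    using phi_diff[OF x1, of 0 s k] assms(2) by (simp add: \<phi>_def)
  have "norm (Z k s ^ 2 - a k s ^ 2) \<le> norm (Z k s ^ 2) + norm (a k s ^ 2)" by (rule norm_triangle_ineq4)
  also have "\<dots> \<le> 1 + 1"
  proof (rule add_mono)
    show "norm (a k s ^ 2) \<le> 1"
      unfolding norm_power using norm_a_le[OF assms(2), of k] d by (intro power_le_one) auto
  qed (rule norm_Z2_le[OF assms(2)])
  finally have "norm ((Z k s ^ 2 - a k s ^ 2) * x) \<le> 2 * (2 * \<tau> k)"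
    unfolding norm_mult using assms(1) by (intro mult_mono) auto
  moreover have "norm (1 + a k s * x) \<ge> dip k / 2"
    using denom_ge[OF x1, of k s] norm_a_le[OF assms(2), of k] by linarith
  ultimately have "norm (\<phi> k s x - a k s) \<le> (2 * (2 * \<tau> k)) / (dip k / 2)"
    unfolding eq norm_divide using d tol_pos[of k] by (intro frac_le) auto
  also have "\<dots> = 2 * \<epsilon> * dip k"
  proof -
    have "\<tau> k = \<epsilon> / 4 * (dip k * dip k)"
      by (simp add: tol_def dip_def power_add power_mult_distrib[symmetric])
    then show ?thesis using d by (simp only:) (simp add: field_simps)
  qed
  also have "\<dots> \<le> 2 * 1 * dip k" using eps d by (intro mult_right_mono mult_left_mono) auto
  finally show ?thesis by simp
qed

text \<open>With \<open>s = p + v / \<Lambda> k\<close> the carrier becomes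
  \<open>exp (- v)\<close>. Levels after \<open>k\<close> are negligible, level \<open>k\<close> is
  close to its carrier, and the levels before \<open>k\<close> are frozen at \<open>p\<close>. The
  error collects \<open>2 * dip k\<close> from \<open>phi_near_a\<close>, \<open>3 * dip k\<close>
  from the window and \<open>16 * V / k\<close> from the motion of the earlier levels; the outer 2
  bounds \<open>1 + 8 * \<tau> 0\<close>.\<close>

lemma tower_lim_near_model:
  fixes t0 :: real
  defines "p \<equiv> \<i> * of_real t0"
  assumes k: "k \<ge> 1" and Zp: "Z k p = 1"
    and good: "\<And>j s. j \<noteq> k \<Longrightarrow> Re s \<ge> 0 \<Longrightarrow> norm (s - p) \<le> V / \<Lambda> k \<Longrightarrow> norm (a j s) \<le> \<tau> j"
    and win: "\<And>s. Re s \<ge> 0 \<Longrightarrow> norm (s - p) \<le> V / \<Lambda> k \<Longrightarrow> norm (a k s - Z k s) \<le> 3 * dip k"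
    and v: "Re v > 0" "norm v \<le> V"
  shows "norm (tower_lim 0 (p + v / \<Lambda> k) - tower p 0 k (exp (- v))) \<le> 2 * (5 * dip k + 16 * V / k)"
proof -
  define s where "s = p + v / \<Lambda> k"
  have L: "\<Lambda> k > 0" by (rule Lam_pos)
  have Rp: "Re p = 0" by (simp add: p_def)
  have Rs: "Re s > 0" using v L by (simp add: s_def Rp)
  have "norm (s - p) = norm v / \<Lambda> k" using L by (simp add: s_def norm_divide)
  then have ns: "norm (s - p) \<le> V / \<Lambda> k" using v L by (simp add: divide_right_mono)
  have np: "norm (p - p) \<le> V / \<Lambda> k" using V_ge L by simp
  have Zs: "Z k s = exp (- v)"
  proof -
    have "Z k s = Z k p * exp (of_real (- \<Lambda> k) * (v / \<Lambda> k))"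
      unfolding Z_def s_def distrib_left exp_add ..
    also have "of_real (- \<Lambda> k) * (v / \<Lambda> k) = - v" using L by simp
    finally show ?thesis by (simp add: Zp)
  qed
  have "norm (tower_lim (Suc k) s) \<le> 8 * \<tau> (Suc k)"
    by (rule norm_tower_lim_le_tol[OF _ Rs]) (use good Rs ns in auto)
  then have "norm (tower_lim (Suc k) s) \<le> 2 * \<tau> k" by (simp add: tol_Suc)
  from phi_near_a[OF this] have "norm (tower_lim k s - a k s) \<le> 2 * dip k"
    using Rs by (subst tower_lim_rec) auto
  moreover have "norm (a k s - exp (- v)) \<le> 3 * dip k" using win[of s] Rs ns by (simp add: Zs)
  ultimately have xq: "norm (tower_lim k s - exp (- v)) \<le> 5 * dip k"
    using norm_triangle_ineq[of "tower_lim k s - a k s" "a k s - exp (- v)"] by simp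
  have q: "norm (exp (- v)) \<le> 1" using v by (simp add: norm_exp_eq_Re)
  define \<kappa> where "\<kappa> j = 16 * D j * (V / \<Lambda> k)" for j
  have V0: "V / \<Lambda> k \<ge> 0" using V_ge L by simp
  have pert: "norm (tower s 0 k (tower_lim k s) - tower p 0 k (exp (- v))) \<le>
      (1 + 8 * \<tau> 0) * (norm (tower_lim k s - exp (- v)) + (\<Sum>j=0..<0+k. \<kappa> j))"
  proof (rule tower_perturbation)
    show "norm (\<phi> j s z - \<phi> j p z) \<le> \<kappa> j" if "0 \<le> j" "j < 0 + k" "norm z \<le> 1" for j z
    proof -
      have "norm (\<phi> j s z - \<phi> j p z) \<le> 16 * D j * norm (s - p)"
        by (rule phi_variation) (use that good Rs Rp ns np in auto)
      also have "\<dots> \<le> \<kappa> j" unfolding \<kappa>_def using ns D_nonneg[of j] by (intro mult_left_mono) auto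
      finally show ?thesis .
    qed
    show "\<kappa> j \<ge> 0" for j unfolding \<kappa>_def using D_nonneg[of j] V0 by (intro mult_nonneg_nonneg) auto
  qed (use Rs Rp q norm_tower_lim_le[OF Rs] norm_tower_le[OF Rs] norm_tower_imag_le good ns in auto)
  have "(\<Sum>j=0..<0+k. \<kappa> j) = 16 * (V / \<Lambda> k) * (\<Sum>j<k. D j)"
    unfolding \<kappa>_def sum_distrib_left by (intro sum.cong) (auto simp: atLeast0LessThan)
  \<comment> \<open>\<open>Lam_Suc\<close> bounds the Lipschitz constants of all earlier levels
    together by \<open>\<Lambda> k / k\<close>.\<close>
  also have "\<dots> \<le> 16 * V / k"
  proof -
    have "(\<Sum>j<k. D j) \<le> \<Lambda> k / k" using Lam_Suc[of k] k by (simp add: field_simps)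
    then have "16 * (V / \<Lambda> k) * (\<Sum>j<k. D j) \<le> 16 * (V / \<Lambda> k) * (\<Lambda> k / k)"
      using V0 by (intro mult_left_mono) auto
    then show ?thesis using L by simp
  qed
  finally have sk: "(\<Sum>j=0..<0+k. \<kappa> j) \<le> 16 * V / k" .
  have "(1 + 8 * \<tau> 0) * (norm (tower_lim k s - exp (- v)) + (\<Sum>j=0..<0+k. \<kappa> j)) \<le> 2 * (5 * dip k + 16 * V / k)"
  proof (rule mult_mono)
    show "1 + 8 * \<tau> 0 \<le> 2" using tol_le'[of 0] by simp
    show "norm (tower_lim k s - exp (- v)) + (\<Sum>j=0..<0+k. \<kappa> j) \<le> 5 * dip k + 16 * V / k" using xq sk by linarith
    show "0 \<le> norm (tower_lim k s - exp (- v)) + (\<Sum>j=0..<0+k. \<kappa> j)"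
      unfolding \<kappa>_def using D_nonneg V0 by (intro add_nonneg_nonneg sum_nonneg mult_nonneg_nonneg) auto
  qed simp
  with pert tower_lim_eq_tower[OF Rs, of 0 k] show ?thesis unfolding s_def by simp
qed

lemma xi_point_exists:
  fixes t0 :: real
  defines "p \<equiv> \<i> * of_real t0"
  assumes k: "k \<ge> 1" and Zp: "Z k p = 1"
    and good: "\<And>j s. j \<noteq> k \<Longrightarrow> Re s \<ge> 0 \<Longrightarrow> norm (s - p) \<le> V / \<Lambda> k \<Longrightarrow> norm (a j s) \<le> \<tau> j"
    and win: "\<And>s. Re s \<ge> 0 \<Longrightarrow> norm (s - p) \<le> V / \<Lambda> k \<Longrightarrow> norm (a k s - Z k s) \<le> 3 * dip k"
    and \<xi>: "\<epsilon> < norm \<xi>" "norm \<xi> < 1"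
    and err: "2 * (5 * dip k + 16 * V / k) < \<epsilon> * (1 - norm \<xi>) / 128"
  obtains s where "tower_lim 0 s = \<xi>" "Re s \<ge> (1 - norm \<xi>) / (8 * \<Lambda> k)" "\<bar>Im s - t0\<bar> \<le> 5 / \<Lambda> k"
proof -
  define e where "e = 2 * (5 * dip k + 16 * V / k)"
  define \<rho> where "\<rho> = (1 - norm \<xi>) / 8"
  have \<rho>: "0 < \<rho>" "\<rho> \<le> 1/8" using \<xi> by (auto simp: \<rho>_def)
  have L: "\<Lambda> k > 0" by (rule Lam_pos)
  have Rp: "Re p = 0" by (simp add: p_def)
  have small: "norm (a j p) \<le> \<tau> j" if "j < k" for j
    using good[of j p] that Rp V_ge L by simp
  obtain \<zeta> where \<zeta>: "norm \<zeta> < 1" "tower p 0 k \<zeta> = \<xi>"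
    "1 - (norm \<zeta>)\<^sup>2 \<ge> (1 - 8 * \<tau> 0) * (1 - (norm \<xi>)\<^sup>2)" "norm \<zeta> \<ge> norm \<xi> - 8 * \<tau> 0"
    using tower_imag_surj[OF Rp, of 0 k \<xi>] small \<xi>(2) by auto
  have \<zeta>eps: "norm \<zeta> \<ge> \<epsilon> / 2" using \<zeta>(4) tol_le[of 0] \<xi>(1) eps by linarith
  then have \<zeta>0: "\<zeta> \<noteq> 0" using eps by auto
  define v0 where "v0 = - Ln \<zeta>"
  have ev0: "exp (- v0) = \<zeta>" using \<zeta>0 by (simp add: v0_def)
  have Rv0: "Re v0 = - ln (norm \<zeta>)" using \<zeta>0 by (simp add: v0_def)
  have Iv0: "\<bar>Im v0\<bar> \<le> pi" using Im_Ln_le_pi[OF \<zeta>0] mpi_less_Im_Ln[OF \<zeta>0] by (simp add: v0_def abs_le_iff)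
  \<comment> \<open>\<open>- ln (norm \<zeta>) \<ge> 1 - norm \<zeta> \<ge> (1 - (norm
    \<zeta>)\<^sup>2) / 2 \<ge> 7/16 * (1 - norm \<xi>)\<close>, so the disc of radius \<rho> about
    \<open>v0\<close> stays in \<open>Re v \<ge> \<rho>\<close>.\<close>
  have lam: "Re v0 \<ge> 2 * \<rho>"
  proof -
    have 1: "7/8 * (1 - (norm \<xi>)\<^sup>2) \<le> (1 - 8 * \<tau> 0) * (1 - (norm \<xi>)\<^sup>2)"
      using tol_le'[of 0] \<xi> by (intro mult_right_mono) (auto simp: abs_square_le_1)
    have "(norm \<xi>)\<^sup>2 \<le> norm \<xi>" using \<xi> by (simp add: power2_eq_square mult_left_le)
    then have "7/8 * (1 - norm \<xi>) \<le> 7/8 * (1 - (norm \<xi>)\<^sup>2)" by simp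
    from order_trans[OF this order_trans[OF 1 \<zeta>(3)]]
    have "1 - (norm \<zeta>)\<^sup>2 \<ge> 7/8 * (1 - norm \<xi>)" .
    moreover have "1 - (norm \<zeta>)\<^sup>2 \<le> 2 * (1 - norm \<zeta>)"
      using zero_le_power2[of "1 - norm \<zeta>"] by (simp add: power2_eq_square algebra_simps)
    moreover have "ln (norm \<zeta>) \<le> norm \<zeta> - 1" using \<zeta>0 by (intro ln_le_minus_one) simp
    ultimately show ?thesis unfolding Rv0 \<rho>_def using \<xi> by argo
  qed
  have Rv0_le: "Re v0 \<le> ln (2 / \<epsilon>)"
  proof -
    have "ln (\<epsilon> / 2) \<le> ln (norm \<zeta>)" using \<zeta>eps eps \<zeta>0 by (subst ln_le_cancel_iff) auto
    then show ?thesis unfolding Rv0 using eps by (simp add: ln_div)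
  qed
  have ball: "Re v \<ge> \<rho> \<and> norm v \<le> V" if "norm (v - v0) \<le> \<rho>" for v
  proof
    have "\<bar>Re (v - v0)\<bar> \<le> \<rho>" using abs_Re_le_cmod[of "v - v0"] that by linarith
    then show "Re v \<ge> \<rho>" using lam by (auto simp: abs_le_iff)
    have "norm v0 \<le> \<bar>Re v0\<bar> + \<bar>Im v0\<bar>" by (rule cmod_le)
    also have "\<dots> \<le> ln (2 / \<epsilon>) + pi" using Rv0_le Iv0 lam \<rho> by simp
    finally have "norm v0 \<le> ln (2 / \<epsilon>) + pi" .
    moreover have "norm v \<le> norm v0 + norm (v - v0)" using norm_triangle_ineq[of v0 "v - v0"] by simp
    ultimately show "norm v \<le> V" unfolding V_def using that \<rho> pi_less_4 by linarith
  qed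
  have near: "norm (tower_lim 0 (p + v / \<Lambda> k) - tower p 0 k (exp (- v))) \<le> e"
    if "norm (v - v0) \<le> \<rho>" for v
    unfolding e_def p_def
    by (rule tower_lim_near_model) (use k Zp good win ball[OF that] \<rho> in \<open>auto simp: p_def\<close>)
  define F where "F v = tower_lim 0 (p + v / of_real (\<Lambda> k)) - \<xi>" for v
  have Fhol: "F holomorphic_on {v. Re v > 0}"
  proof -
    have "(\<lambda>v. p + v / of_real (\<Lambda> k)) holomorphic_on {v. Re v > 0}" using L by (intro holomorphic_intros) auto
    moreover have "(\<lambda>v. p + v / of_real (\<Lambda> k)) ` {v. Re v > 0} \<subseteq> halfplane 0" using L Rp by auto
    ultimately show ?thesis unfolding F_def
      using holomorphic_on_compose_gen[OF _ tower_lim_holomorphic[of 0]] by (intro holomorphic_intros) (auto simp: o_def)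
  qed
  have sub: "cball v0 \<rho> \<subseteq> {v. Re v > 0}"
    using ball \<rho> by (force simp: dist_norm norm_minus_commute)
  obtain v where v: "v \<in> ball v0 \<rho>" "F v = 0"
  proof (rule holomorphic_contract_to_zero[of v0 \<rho> F])
    show "continuous_on (cball v0 \<rho>) F"
      using holomorphic_on_imp_continuous_on[OF Fhol] sub continuous_on_subset by blast
    show "F holomorphic_on ball v0 \<rho>"
      using Fhol sub ball_subset_cball holomorphic_on_subset by blast
    show "0 < \<rho>" by (rule \<rho>(1))
    fix v assume "norm (v0 - v) = \<rho>"
    then have nv: "norm (v - v0) = \<rho>" by (simp add: norm_minus_commute)
    have F0: "norm (F v0) \<le> e" using near[of v0] \<rho> unfolding F_def ev0 \<zeta>(2) by simp
    have ev: "exp (- v) = \<zeta> * exp (v0 - v)" by (simp add: ev0[symmetric] exp_add[symmetric])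
    then have "exp (- v) - \<zeta> = \<zeta> * (exp (v0 - v) - 1)" by (simp add: right_diff_distrib)
    then have "norm (exp (- v) - \<zeta>) = norm \<zeta> * norm (exp (v0 - v) - 1)" by (simp add: norm_mult)
    also have "\<dots> \<ge> \<epsilon> / 2 * (\<rho> / 2)"
      using norm_exp_minus_one_ge[of "v0 - v"] nv \<rho> \<zeta>eps eps
      by (intro mult_mono) (auto simp: norm_minus_commute)
    finally have g: "norm (exp (- v) - \<zeta>) \<ge> \<epsilon> / 2 * (\<rho> / 2)" .
    have "Re v > 0" using ball[of v] nv \<rho> by auto
    then have "norm (exp (- v)) \<le> 1" by (simp add: norm_exp_eq_Re)
    then have "norm (tower p 0 k (exp (- v)) - \<xi>) \<ge> (1 - 8 * \<tau> 0) * norm (exp (- v) - \<zeta>)"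
      using tower_imag_expand[OF Rp, of 0 k "exp (- v)" \<zeta>] small \<zeta>(1) unfolding \<zeta>(2) by simp
    moreover have "(1 - 8 * \<tau> 0) * norm (exp (- v) - \<zeta>) \<ge> 7/8 * (\<epsilon> / 2 * (\<rho> / 2))"
      using g tol_le'[of 0] eps \<rho> by (intro mult_mono) auto
    moreover have "norm (tower p 0 k (exp (- v)) - \<xi>) \<le> norm (F v) + e"
    proof -
      have "norm (tower p 0 k (exp (- v)) - \<xi>) \<le> norm (F v) + norm (tower_lim 0 (p + v / \<Lambda> k) - tower p 0 k (exp (- v)))"
        using norm_triangle_ineq4[of "F v" "tower_lim 0 (p + v / \<Lambda> k) - tower p 0 k (exp (- v))"]
        by (simp add: F_def)
      then show ?thesis using near[of v] nv by simp
    qed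
    ultimately have "norm (F v) \<ge> 7/8 * (\<epsilon> / 2 * (\<rho> / 2)) - e" by linarith
    \<comment> \<open>Here the number 128 in \<open>err\<close> is used: it reads
      \<open>e < \<epsilon> * \<rho> / 16\<close>, while the right-hand side is
      \<open>7/32 * \<epsilon> * \<rho>\<close>.\<close>
    moreover have "2 * e < 7/8 * (\<epsilon> / 2 * (\<rho> / 2))"
    proof -
      have "e < \<epsilon> * \<rho> / 16" using err by (simp add: e_def \<rho>_def)
      moreover have "\<epsilon> * \<rho> > 0" using eps \<rho> by simp
      ultimately show ?thesis by simp
    qed
    ultimately show "norm (F v0) < norm (F v)" using F0 by linarith
  qed
  have nv: "norm (v - v0) \<le> \<rho>" using v(1) by (simp add: dist_norm norm_minus_commute)
  show thesis
  proof (rule that[of "p + v / \<Lambda> k"])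
    show "tower_lim 0 (p + v / \<Lambda> k) = \<xi>" using v(2) by (simp add: F_def)
    have "Re (p + v / \<Lambda> k) = Re v / \<Lambda> k" by (simp add: Rp)
    also have "\<dots> \<ge> \<rho> / \<Lambda> k" using ball[OF nv] L by (intro divide_right_mono) auto
    finally show "Re (p + v / \<Lambda> k) \<ge> (1 - norm \<xi>) / (8 * \<Lambda> k)" by (simp add: \<rho>_def)
    have "\<bar>Im (v - v0)\<bar> \<le> \<rho>" using abs_Im_le_cmod[of "v - v0"] nv by linarith
    then have "\<bar>Im v\<bar> \<le> 5" using Iv0 \<rho> pi_less_4 unfolding minus_complex.sel by linarith
    then show "\<bar>Im (p + v / \<Lambda> k) - t0\<bar> \<le> 5 / \<Lambda> k" using L by (simp add: p_def abs_divide divide_right_mono)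
  qed
qed

section \<open>Counting the points where the value is taken\<close>

lemmas win_pos = win_bounds(1)[OF eps] and win_le = win_bounds(2)[OF eps]

lemma win_antimono: "j \<le> k \<Longrightarrow> \<delta> k \<le> \<delta> j"
  unfolding win_def by (intro mult_left_mono power_decreasing) auto

lemma sum_win_le: "(\<Sum>j<k. \<delta> j) \<le> \<epsilon>\<^sup>2 / 100000"
proof -
  have "(\<Sum>j<k. (1/2::real) ^ Suc j) \<le> 1"
  proof -
    have "(\<Sum>j<k. (1/2::real) ^ Suc j) = 1/2 * (\<Sum>j<k. (1/2) ^ j)" by (simp add: sum_distrib_left)
    also have "(\<Sum>j<k. (1/2::real) ^ j) = (1 - (1/2) ^ k) / (1 - 1/2)" by (subst sum_gp_strict) auto
    finally have "(\<Sum>j<k. (1/2::real) ^ Suc j) = 1 - (1/2) ^ k" by simp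
    moreover have "(1/2::real) ^ k \<ge> 0" by simp
    ultimately show ?thesis by linarith
  qed
  from mult_left_mono[OF this, of "\<epsilon>\<^sup>2 / 100000"] show ?thesis
    by (simp add: win_def sum_distrib_left)
qed

lemma u_Suc_le: "u (Suc k) \<le> u k"
proof -
  have "1 * u (Suc k) \<le> 2 * pi * u (Suc k)" using u_pos[of "Suc k"] pi_gt3 by (intro mult_right_mono) auto
  also have "\<dots> \<le> \<delta> (Suc k) / 2 * u k" by (rule u_Suc)
  also have "\<dots> \<le> 1 * u k" using u_pos[of k] win_le[of "Suc k"] by (intro mult_right_mono) auto
  finally show ?thesis by simp
qed

lemma u_antimono: "j \<le> k \<Longrightarrow> u k \<le> u j"
  using lift_Suc_antimono_le[of u j k] u_Suc_le by blast

lemma u_gap: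
  assumes "j < k"
  shows "2 * pi * u k \<le> \<delta> k / 2 * u j"
proof -
  obtain m where m: "k = Suc m" using assms by (cases k) auto
  have "2 * pi * u k \<le> \<delta> k / 2 * u m" unfolding m by (rule u_Suc)
  also have "\<dots> \<le> \<delta> k / 2 * u j" using assms m u_antimono[of j m] win_pos[of k] by (intro mult_left_mono) auto
  finally show ?thesis .
qed

text \<open>Up to height \<open>2 * pi / u k\<close> the phase \<open>u j * Im s\<close> of a later
  level has not left the initial interval below its first window, where \<open>r_near_0\<close>
  applies.\<close>

lemma norm_a_le_tol_late:
  assumes "j > k" "Re s \<ge> 0" "\<bar>Im s\<bar> \<le> 2 * pi / u k"
  shows "norm (a j s) \<le> \<tau> j"
proof (rule norm_a_le_small_r[OF assms(2) r_near_0])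
  have "\<bar>u j * Im s\<bar> = u j * \<bar>Im s\<bar>" using u_pos[of j] by (simp add: abs_mult)
  also have "\<dots> \<le> u j * (2 * pi / u k)" using assms u_pos[of j] by (intro mult_left_mono) auto
  also have "\<dots> = 2 * pi * u j / u k" by simp
  also have "\<dots> \<le> \<delta> j / 2" using u_gap[OF assms(1)] u_pos[of k] by (simp add: divide_le_eq)
  finally show "\<bar>u j * Im s\<bar> \<le> \<delta> j / 2" .
qed

text \<open>Outside these windows every level is within its tolerance, and the value would be at
  most \<open>8 * \<tau> 0 \<le> \<epsilon> / 8\<close>.\<close>

lemma xi_point_in_window:
  assumes "Re s > 0" "tower_lim 0 s = \<xi>" "\<epsilon> < norm \<xi>" "\<bar>Im s\<bar> < 2 * pi / u k"
  obtains j l where "j \<le> k" "\<bar>u j * Im s - 2 * pi * of_int l\<bar> < 3 * \<delta> j"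
proof (rule ccontr)
  assume "\<not> thesis"
  then have off: "\<forall>l::int. \<bar>u j * Im s - 2 * pi * of_int l\<bar> \<ge> 3 * \<delta> j" if "j \<le> k" for j
    using that \<open>\<And>j l. j \<le> k \<Longrightarrow> \<bar>u j * Im s - 2 * pi * of_int l\<bar> < 3 * \<delta> j \<Longrightarrow> thesis\<close>
    by (meson linorder_not_less)
  have "norm (a j s) \<le> \<tau> j" for j
  proof (cases "j \<le> k")
    case True
    then show ?thesis using norm_a_le_small_r[OF _ r_off[OF off]] assms(1) by simp
  next
    case False
    then show ?thesis using assms by (intro norm_a_le_tol_late[of k]) auto
  qed
  then have "norm (tower_lim 0 s) \<le> 8 * \<tau> 0" using assms(1) by (intro norm_tower_lim_le_tol) auto
  then show False using assms tol_le[of 0] eps by simp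
qed

text \<open>Boxes over the windows of the levels \<open>j \<le> k\<close> cover all \<xi>-points. A
  box with \<open>R = 4 * \<delta> j / u j\<close> contributes at most
  \<open>10 * R * (1 - norm \<xi>) / \<epsilon>\<^sup>2\<close>, and there are at most
  \<open>u j * T\<close> of them, so level \<open>j\<close> costs
  \<open>40 * T * (1 - norm \<xi>) / \<epsilon>\<^sup>2 * \<delta> j\<close>. The sum
  \<open>\<epsilon>\<^sup>2 / 100000\<close> of the \<delta> j cancels
  \<open>\<epsilon>\<^sup>2\<close> and leaves 1/2500.\<close>

lemma sum_xi_points_le:
  assumes \<xi>: "\<epsilon> < norm \<xi>" "norm \<xi> < 1" and F: "finite F"
    "\<And>s. s \<in> F \<Longrightarrow> Re s > 0 \<and> tower_lim 0 s = \<xi> \<and> \<bar>Im s\<bar> < 2 * pi / u k"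
  shows "(\<Sum>s\<in>F. nat (zorder (\<lambda>z. tower_lim 0 z - \<xi>) s) * Re s) \<le> 2 * pi / u k * (1 - norm \<xi>) / 2500"
proof -
  define T where "T = 2 * pi / u k"
  define g where "g s = nat (zorder (\<lambda>z. tower_lim 0 z - \<xi>) s) * Re s" for s
  have g0: "g s \<ge> 0" if "s \<in> F" for s using F(2)[OF that] by (simp add: g_def)
  have T: "T > 0" using u_pos[of k] by (simp add: T_def)
  have uT: "u j * T \<ge> 2 * pi" if "j \<le> k" for j
  proof -
    have "u k * T \<le> u j * T" using u_antimono[OF that] T by (intro mult_right_mono) auto
    then show ?thesis using u_pos[of k] by (simp add: T_def)
  qed
  define I where "I j = {l::int. - ((u j * T + 3 * \<delta> j) / (2 * pi)) \<le> l \<and> l \<le> (u j * T + 3 * \<delta> j) / (2 * pi)}" for j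
  define S where "S j l = {s\<in>F. \<bar>u j * Im s - 2 * pi * of_int l\<bar> < 3 * \<delta> j}" for j and l :: int
  have Ifin: "finite (I j)" and Icard: "j \<le> k \<Longrightarrow> real (card (I j)) \<le> u j * T" for j
  proof -
    define X where "X = (u j * T + 3 * \<delta> j) / (2 * pi)"
    have X: "X \<ge> 0" using u_pos[of j] T win_pos[of j] by (simp add: X_def)
    have I: "I j = {l::int. - X \<le> l \<and> l \<le> X}" by (simp add: I_def X_def)
    show "finite (I j)" unfolding I using X by (intro card_int_between_le) auto
    show "real (card (I j)) \<le> u j * T" if "j \<le> k"
    proof -
      have "real (card (I j)) \<le> X - (- X) + 1" unfolding I using X by (intro card_int_between_le) auto
      also have "\<dots> = (u j * T + 3 * \<delta> j) / pi + 1" by (simp add: X_def)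
      also have "\<dots> \<le> (u j * T + 3 * \<delta> j) / 3 + 1"
        using pi_gt3 u_pos[of j] T win_pos[of j] by (intro add_mono divide_left_mono) auto
      \<comment> \<open>As \<open>u j * T \<ge> 2 * pi > 6\<close>, the slack
        \<open>2/3 * (u j * T)\<close> absorbs the boundary terms.\<close>
      also have "\<dots> \<le> u j * T" using uT[OF that] win_le[of j] pi_gt3 by (simp add: field_simps)
      finally show ?thesis .
    qed
  qed
  have piece: "(\<Sum>s\<in>S j l. g s) \<le> 10 * (4 * \<delta> j / u j) * (1 - norm \<xi>) / \<epsilon>\<^sup>2" for j l
    unfolding g_def
  proof (rule sum_zorder_strip_le[OF tower_lim_holomorphic norm_tower_lim_less eps(1) \<xi>, where t = "2 * pi * l / u j"])
    show R0: "4 * \<delta> j / u j > 0" using win_pos[of j] u_pos[of j] by simp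
    show "norm (tower_lim 0 (Complex (4 * \<delta> j / u j) (2 * pi * l / u j))) \<le> \<epsilon> / 2"
      using win_large[of j] by (intro norm_tower_lim_far) simp
    show "finite (S j l)" using F(1) by (simp add: S_def)
    fix s assume s: "s \<in> S j l"
    then have sF: "s \<in> F" "\<bar>u j * Im s - 2 * pi * of_int l\<bar> < 3 * \<delta> j" by (auto simp: S_def)
    \<comment> \<open>Further to the right the values are at most \<open>\<epsilon> / 2\<close>; by
      \<open>win_large\<close> the remaining strip is no wider than \<open>R\<close>.\<close>
    have "Re s \<le> ln (64 / \<epsilon>)"
    proof (rule ccontr)
      assume "\<not> Re s \<le> ln (64 / \<epsilon>)"
      then have "norm (tower_lim 0 s) \<le> \<epsilon> / 2" by (intro norm_tower_lim_far) simp
      then show False using F(2)[OF sF(1)] \<xi>(1) eps by auto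
    qed
    moreover have "\<bar>Im s - 2 * pi * l / u j\<bar> \<le> 4 * \<delta> j / u j"
    proof -
      have "Im s - 2 * pi * l / u j = (u j * Im s - 2 * pi * l) / u j"
        using u_pos[of j] by (simp add: field_simps)
      then have "\<bar>Im s - 2 * pi * l / u j\<bar> = \<bar>u j * Im s - 2 * pi * l\<bar> / u j"
        using u_pos[of j] by (simp add: abs_divide)
      also have "\<dots> \<le> 4 * \<delta> j / u j" using sF(2) win_pos[of j] u_pos[of j] by (intro divide_right_mono) auto
      finally show ?thesis .
    qed
    ultimately show "0 < Re s \<and> Re s \<le> 4 * \<delta> j / u j \<and> \<bar>Im s - 2 * pi * l / u j\<bar> \<le> 4 * \<delta> j / u j"
      using win_large[of j] F(2)[OF sF(1)] by linarith
  qed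
  have cover: "\<exists>j<Suc k. \<exists>l\<in>I j. s \<in> S j l" if s: "s \<in> F" for s
  proof -
    obtain j l where jl: "j \<le> k" "\<bar>u j * Im s - 2 * pi * of_int l\<bar> < 3 * \<delta> j"
      using xi_point_in_window[of s \<xi> k] F(2)[OF s] \<xi> by metis
    have "\<bar>Im s\<bar> \<le> T" using F(2)[OF s] by (simp add: T_def)
    then have "\<bar>u j * Im s\<bar> \<le> u j * T" using u_pos[of j] by (simp add: abs_mult)
    then have "\<bar>2 * pi * of_int l\<bar> \<le> u j * T + 3 * \<delta> j" using jl(2) by linarith
    then have "\<bar>real_of_int l\<bar> \<le> (u j * T + 3 * \<delta> j) / (2 * pi)"
      using pi_gt_zero by (simp add: pos_le_divide_eq abs_mult mult.commute)
    then have "l \<in> I j" unfolding I_def by (simp only: mem_Collect_eq) linarith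
    then show ?thesis using jl s by (intro exI[of _ j] conjI bexI[of _ l]) (auto simp: S_def)
  qed
  \<comment> \<open>A point lying in several windows is counted once for each, which is harmless for
    an upper bound.\<close>
  have "(\<Sum>s\<in>F. g s) \<le> (\<Sum>s\<in>F. \<Sum>j<Suc k. \<Sum>l\<in>I j. if s \<in> S j l then g s else 0)"
  proof (rule sum_mono)
    fix s assume s: "s \<in> F"
    obtain j l where jl: "j < Suc k" "l \<in> I j" "s \<in> S j l" using cover[OF s] by blast
    have "g s = (if s \<in> S j l then g s else 0)" using jl by simp
    also have "\<dots> \<le> (\<Sum>l\<in>I j. if s \<in> S j l then g s else 0)"
      using jl Ifin g0[OF s] by (intro member_le_sum) auto
    also have "\<dots> \<le> (\<Sum>j<Suc k. \<Sum>l\<in>I j. if s \<in> S j l then g s else 0)"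
      using jl g0[OF s] by (intro member_le_sum[of j "{..<Suc k}" "\<lambda>j. \<Sum>l\<in>I j. if s \<in> S j l then g s else 0"] sum_nonneg) auto
    finally show "g s \<le> (\<Sum>j<Suc k. \<Sum>l\<in>I j. if s \<in> S j l then g s else 0)" .
  qed
  also have "\<dots> = (\<Sum>j<Suc k. \<Sum>l\<in>I j. \<Sum>s\<in>F. if s \<in> S j l then g s else 0)"
    by (subst sum.swap, rule sum.cong[OF refl], subst sum.swap, rule refl)
  also have "\<dots> = (\<Sum>j<Suc k. \<Sum>l\<in>I j. \<Sum>s\<in>S j l. g s)"
  proof (rule sum.cong[OF refl], rule sum.cong[OF refl])
    fix j l
    have "S j l = {s\<in>F. s \<in> S j l}" by (auto simp: S_def)
    then show "(\<Sum>s\<in>F. if s \<in> S j l then g s else 0) = (\<Sum>s\<in>S j l. g s)"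
      using sum.inter_filter[OF F(1), of g "\<lambda>s. s \<in> S j l"] by simp
  qed
  also have "\<dots> \<le> (\<Sum>j<Suc k. \<Sum>l\<in>I j. 10 * (4 * \<delta> j / u j) * (1 - norm \<xi>) / \<epsilon>\<^sup>2)"
    by (intro sum_mono piece)
  also have "\<dots> \<le> (\<Sum>j<Suc k. 40 * T * (1 - norm \<xi>) / \<epsilon>\<^sup>2 * \<delta> j)"
  proof (rule sum_mono)
    fix j assume "j \<in> {..<Suc k}"
    then have "real (card (I j)) * (10 * (4 * \<delta> j / u j) * (1 - norm \<xi>) / \<epsilon>\<^sup>2)
        \<le> (u j * T) * (10 * (4 * \<delta> j / u j) * (1 - norm \<xi>) / \<epsilon>\<^sup>2)"
      using Icard[of j] \<xi> win_pos[of j] u_pos[of j] by (intro mult_right_mono) auto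
    also have "\<dots> = 40 * T * (1 - norm \<xi>) / \<epsilon>\<^sup>2 * \<delta> j" using u_pos[of j] by simp
    finally show "(\<Sum>l\<in>I j. 10 * (4 * \<delta> j / u j) * (1 - norm \<xi>) / \<epsilon>\<^sup>2) \<le> 40 * T * (1 - norm \<xi>) / \<epsilon>\<^sup>2 * \<delta> j"
      by simp
  qed
  also have "\<dots> = 40 * T * (1 - norm \<xi>) / \<epsilon>\<^sup>2 * (\<Sum>j<Suc k. \<delta> j)" by (simp only: sum_distrib_left)
  also have "\<dots> \<le> 40 * T * (1 - norm \<xi>) / \<epsilon>\<^sup>2 * (\<epsilon>\<^sup>2 / 100000)"
    using \<xi> T by (intro mult_left_mono sum_win_le) auto
  also have "\<dots> = T * (1 - norm \<xi>) / 2500" using eps by simp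
  finally show ?thesis by (simp add: g_def T_def)
qed

lemma Nf_upper:
  assumes \<xi>: "\<epsilon> < norm \<xi>" "norm \<xi> < 1"
  shows "Nf (tower_lim 0) \<xi> (2 * pi / u k) \<le> ennreal ((1 - norm \<xi>) / 500)"
proof -
  define T where "T = 2 * pi / u k"
  have T: "T > 0" using u_pos[of k] by (simp add: T_def)
  have "Nf (tower_lim 0) \<xi> T \<le> ennreal (pi / T) * ennreal (T * (1 - norm \<xi>) / 2500)"
    unfolding Nf_def
  proof (intro mult_left_mono infsum_ennreal_le)
    fix F assume F: "finite F" "F \<subseteq> {s \<in> halfplane 0. tower_lim 0 s = \<xi> \<and> \<bar>Im s\<bar> < T}"
    show "(\<Sum>x\<in>F. real (nat (zorder (\<lambda>z. tower_lim 0 z - \<xi>) x)) * Re x) \<le> T * (1 - norm \<xi>) / 2500"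
      unfolding T_def by (rule sum_xi_points_le[OF \<xi> F(1)]) (use F(2) in \<open>auto simp: T_def\<close>)
  qed auto
  also have "\<dots> = ennreal (pi / T * (T * (1 - norm \<xi>) / 2500))"
    using T \<xi> by (intro ennreal_mult[symmetric]) auto
  also have "pi / T * (T * (1 - norm \<xi>) / 2500) = pi * (1 - norm \<xi>) / 2500" using T by simp
  also have "ennreal \<dots> \<le> ennreal (4 * (1 - norm \<xi>) / 2500)"
    using pi_less_4 \<xi> by (intro ennreal_leI divide_right_mono mult_right_mono) auto
  also have "\<dots> \<le> ennreal ((1 - norm \<xi>) / 500)" using \<xi> by (intro ennreal_leI) simp
  finally show ?thesis by (simp add: T_def)
qed

section \<open>Lower bound at the scale of a single window\<close>

lemma zorder_xi_point_ge_1: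
  assumes "Re s > 0" "tower_lim 0 s = \<xi>" "\<epsilon> < norm \<xi>"
  shows "nat (zorder (\<lambda>z. tower_lim 0 z - \<xi>) s) \<ge> 1"
proof -
  \<comment> \<open>At this point far to the right the value differs from \<xi>, so the function is
    not constantly \<xi>.\<close>
  define w where "w = complex_of_real (ln (64 / \<epsilon>))"
  have "ln (64 / \<epsilon>) > 0" using eps by (intro ln_gt_zero) (simp add: field_simps)
  then have w: "Re w > 0" by (simp add: w_def)
  have "norm (tower_lim 0 w) \<le> \<epsilon> / 2" by (rule norm_tower_lim_far) (simp add: w_def)
  then have "tower_lim 0 w - \<xi> \<noteq> 0" using assms(3) eps by auto
  moreover have hol: "(\<lambda>z. tower_lim 0 z - \<xi>) holomorphic_on halfplane 0"
    by (intro holomorphic_intros tower_lim_holomorphic)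
  ultimately have "\<forall>\<^sub>F z in at s. tower_lim 0 z - \<xi> \<noteq> 0"
    using eventually_nonzero_at[OF hol, of w s] w assms(1) by simp
  then have "\<exists>\<^sub>F z in at s. tower_lim 0 z - \<xi> \<noteq> 0" by (rule eventually_frequently[rotated]) simp
  then have "zorder (\<lambda>z. tower_lim 0 z - \<xi>) s > 0"
    using zorder_pos_iff[OF hol, of s] assms(1,2) by simp
  then show ?thesis by simp
qed

lemma norm_a_minus_Z_le:
  assumes "Re s \<ge> 0" "u k * Im s \<in> {\<delta> k..2 * \<delta> k}"
  shows "norm (a k s - Z k s) \<le> 3 * dip k"
proof -
  have "norm (a k s - Z k s * of_real (r k (Im s))) \<le> dip k / 2"
    using a_approx_dip[OF assms(1), of k] by (simp add: Z_def)
  moreover have "norm (Z k s * of_real (r k (Im s)) - Z k s) \<le> 2 * dip k"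
  proof -
    have "Z k s * of_real (r k (Im s)) - Z k s = Z k s * of_real (r k (Im s) - 1)" by (simp add: algebra_simps)
    then have "norm (Z k s * of_real (r k (Im s)) - Z k s) = norm (Z k s) * \<bar>r k (Im s) - 1\<bar>"
      by (simp only: norm_mult norm_of_real)
    also have "\<dots> \<le> 1 * (2 * dip k)"
      using norm_Z_le[OF assms(1)] r_window[OF assms(2)] r_le[of k "Im s"] dip_pos[of k] by (intro mult_mono) auto
    finally show ?thesis by simp
  qed
  ultimately show ?thesis
    using norm_triangle_ineq[of "a k s - Z k s * of_real (r k (Im s))" "Z k s * of_real (r k (Im s)) - Z k s"]
      dip_pos[of k] by simp
qed

text \<open>Two periods \<open>2\<pi>/\<Lambda>\<^sub>k\<close> between nodes keep the points found near different nodes distinct.\<close>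
definition node where "node k m = 4 * pi * of_int m / \<Lambda> k" for k and m :: int

text \<open>The margin \<open>V / \<Lambda> k\<close> at both ends keeps the whole neighbourhood
  used by the local model inside the window.\<close>

definition nodes where
  "nodes k = {m. \<delta> k / u k + V / \<Lambda> k \<le> node k m \<and> node k m \<le> 2 * \<delta> k / u k - V / \<Lambda> k}"

text \<open>The radius exceeds the \<open>3 * \<delta> j\<close> of \<open>r_off\<close> by one
  \<delta> j, which covers a displacement by \<open>V / \<Lambda> k\<close> from the node.\<close>

definition bad_nodes where
  "bad_nodes k j = {m\<in>nodes k. \<exists>l::int. \<bar>u j * node k m - 2 * pi * of_int l\<bar> < 4 * \<delta> j}"

text \<open>The length \<open>\<delta> k / u k\<close> of the window in units of
  \<open>1 / \<Lambda> k\<close>; about \<open>4 * pi\<close> times the number of nodes.\<close>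

definition scale where "scale k = \<delta> k * \<Lambda> k / u k"

lemma scale_ge: "j \<le> k \<Longrightarrow> \<delta> j * \<Lambda> k / u j \<ge> 1000 * V"
proof -
  assume "j \<le> k"
  have "1000 * V \<le> \<delta> k * \<Lambda> k" using Lam_win[of k] by (simp add: V_def mult.commute)
  also have "\<dots> \<le> \<delta> j * \<Lambda> k" using win_antimono[OF \<open>j \<le> k\<close>] Lam_pos[of k] by (intro mult_right_mono) auto
  also have "\<dots> \<le> \<delta> j * \<Lambda> k / u j"
    using u_le[of j] u_pos[of j] win_pos[of j] Lam_pos[of k] by (simp add: le_divide_eq mult_left_le)
  finally show ?thesis .
qed

lemma nodes_eq:
  "nodes k = {m::int. (scale k + V) / (4 * pi) \<le> m \<and> m \<le> (2 * scale k - V) / (4 * pi)}"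
proof -
  have L: "\<Lambda> k > 0" and up: "u k > 0" by (rule Lam_pos, rule u_pos)
  have "\<delta> k / u k + V / \<Lambda> k = (scale k + V) / \<Lambda> k" "2 * \<delta> k / u k - V / \<Lambda> k = (2 * scale k - V) / \<Lambda> k"
    using L up by (auto simp: scale_def field_simps)
  moreover have "x / \<Lambda> k \<le> node k m \<longleftrightarrow> x / (4 * pi) \<le> m" "node k m \<le> x / \<Lambda> k \<longleftrightarrow> m \<le> x / (4 * pi)" for x m
  proof -
    have "x / \<Lambda> k \<le> node k m \<longleftrightarrow> x \<le> 4 * pi * m" unfolding node_def using L by (simp add: divide_le_cancel)
    also have "\<dots> \<longleftrightarrow> x / (4 * pi) \<le> m" by (simp add: pos_divide_le_eq mult.commute)
    finally show "x / \<Lambda> k \<le> node k m \<longleftrightarrow> x / (4 * pi) \<le> m" .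
    have "node k m \<le> x / \<Lambda> k \<longleftrightarrow> 4 * pi * m \<le> x" unfolding node_def using L by (simp add: divide_le_cancel)
    also have "\<dots> \<longleftrightarrow> m \<le> x / (4 * pi)" by (simp add: pos_le_divide_eq mult.commute)
    finally show "node k m \<le> x / \<Lambda> k \<longleftrightarrow> m \<le> x / (4 * pi)" .
  qed
  ultimately show ?thesis by (simp only: nodes_def)
qed

lemma scale_ge_V: "scale k \<ge> 1000 * V" and scale_large: "scale k \<ge> 5000"
  using scale_ge[of k k] V_ge by (auto simp: scale_def)

lemma finite_nodes: "finite (nodes k)" and card_nodes: "real (card (nodes k)) \<ge> scale k / 20"
proof -
  define x where "x = (scale k + V) / (4 * pi)"
  define y where "y = (2 * scale k - V) / (4 * pi)"
  have sV: "scale k \<ge> 1000 * V" "V \<ge> 5" by (rule scale_ge_V, rule V_ge)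
  have "y - x = (scale k - 2 * V) / (4 * pi)"
    unfolding x_def y_def by (simp add: diff_divide_distrib[symmetric])
  also have "\<dots> \<ge> (scale k - 2 * V) / 16"
    using sV pi_less_4 by (intro divide_left_mono) auto
  finally have yx: "y - x \<ge> (scale k - 2 * V) / 16" .
  have eq: "nodes k = {m::int. x \<le> m \<and> m \<le> y}" unfolding x_def y_def by (rule nodes_eq)
  show "finite (nodes k)" unfolding eq by (rule card_int_between_le) (use yx sV in argo)
  have "scale k / 20 \<le> y - x - 1" using yx sV by argo
  also have "\<dots> \<le> real (card (nodes k))" unfolding eq by (rule card_int_between_ge)
  finally show "real (card (nodes k)) \<ge> scale k / 20" .
qed

text \<open>Over window \<open>k\<close> the phase of level \<open>j\<close> runs through
  \<open>{A..2 * A}\<close> and comes near at most \<open>A\<close> multiples of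
  \<open>2 * pi\<close>. Around each there are at most \<open>q\<close> nodes, and
  \<open>A * q = scale k * \<delta> j\<close>: level \<open>j\<close> spoils a proportion of order
  \<delta> j.\<close>

lemma card_bad_nodes:
  assumes "j < k"
  shows "real (card (bad_nodes k j)) \<le> scale k * \<delta> j"
proof -
  have L: "\<Lambda> k > 0" and uj: "u j > 0" and uk: "u k > 0" and w: "\<delta> j > 0" and wk: "\<delta> k > 0"
    by (rule Lam_pos u_pos win_pos)+
  define A where "A = \<delta> k * u j / u k"
  define q where "q = \<delta> j * \<Lambda> k / u j"
  have q: "q \<ge> 5000" using scale_ge[of j k] assms V_ge by (simp add: q_def)
  \<comment> \<open>\<open>u_gap\<close> puts several recurrences of level \<open>j\<close> into
    window \<open>k\<close>, enough to absorb the rounding in the count of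
    \<open>Ls\<close>.\<close>
  have A: "A \<ge> 12"
  proof -
    have "4 * pi * u k \<le> \<delta> k * u j" using u_gap[OF assms] by simp
    then have "4 * pi \<le> A" using uk by (simp add: A_def le_divide_eq)
    then show ?thesis using pi_gt3 by linarith
  qed
  define x where "x = (A - 4 * \<delta> j) / (2 * pi)"
  define y where "y = (2 * A + 4 * \<delta> j) / (2 * pi)"
  define Ls where "Ls = {l::int. x \<le> l \<and> l \<le> y}"
  define M where "M l = {m::int. l * (\<Lambda> k / (2 * u j)) - q / pi \<le> m \<and> m \<le> l * (\<Lambda> k / (2 * u j)) + q / pi}" for l :: int
  have len: "y - x = (A + 8 * \<delta> j) / (2 * pi)"
    unfolding x_def y_def by (simp add: diff_divide_distrib[symmetric])
  have le: "(A + 8 * \<delta> j) / (2 * pi) \<le> (A + 8 * \<delta> j) / 6"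
    using A w pi_gt3 by (intro divide_left_mono) auto
  have yx: "y - x \<le> (A + 8 * \<delta> j) / 6" unfolding len by (rule le)
  have yx0: "y - x \<ge> 0" unfolding len using A w by (intro divide_nonneg_nonneg) auto
  have Lfin: "finite Ls" unfolding Ls_def by (rule card_int_between_le) (use yx0 in linarith)
  have "real (card Ls) \<le> y - x + 1"
    unfolding Ls_def by (rule card_int_between_le) (use yx0 in linarith)
  then have Lcard: "real (card Ls) \<le> A" using yx A win_le[of j] by argo
  have q0: "q / pi \<ge> 0" using q by simp
  have Mfin: "finite (M l)" for l unfolding M_def by (rule card_int_between_le) (use q0 in linarith)
  have Mcard: "real (card (M l)) \<le> q" for l
  proof -
    have "real (card (M l)) \<le> l * (\<Lambda> k / (2 * u j)) + q / pi - (l * (\<Lambda> k / (2 * u j)) - q / pi) + 1"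
      unfolding M_def by (rule card_int_between_le) (use q0 in linarith)
    moreover have "q / pi \<le> q / 3" using q pi_gt3 by (intro divide_left_mono) auto
    ultimately show ?thesis using q by linarith
  qed
  have "bad_nodes k j \<subseteq> (\<Union>l\<in>Ls. M l)"
  proof
    fix m assume "m \<in> bad_nodes k j"
    then obtain l :: int where m: "\<delta> k / u k + V / \<Lambda> k \<le> node k m" "node k m \<le> 2 * \<delta> k / u k - V / \<Lambda> k"
      and l: "\<bar>u j * node k m - 2 * pi * of_int l\<bar> < 4 * \<delta> j"
      unfolding bad_nodes_def nodes_def by blast
    have V0: "V / \<Lambda> k \<ge> 0" using V_ge L by simp
    have "u j * (\<delta> k / u k) \<le> u j * node k m" using m V0 uj by (intro mult_left_mono) auto
    then have lo: "A \<le> u j * node k m" by (simp add: A_def mult.commute)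
    have "u j * node k m \<le> u j * (2 * \<delta> k / u k)" using m V0 uj by (intro mult_left_mono) auto
    then have hi: "u j * node k m \<le> 2 * A" by (simp add: A_def ac_simps)
    have "A - 4 * \<delta> j \<le> 2 * pi * of_int l" using lo l by linarith
    moreover have "2 * pi * of_int l \<le> 2 * A + 4 * \<delta> j" using hi l by linarith
    ultimately have "l \<in> Ls" unfolding Ls_def x_def y_def by (simp add: pos_divide_le_eq pos_le_divide_eq mult.commute)
    moreover have "m \<in> M l"
    proof -
      define c where "c = 4 * pi * u j / \<Lambda> k"
      have c: "c > 0" using L uj by (simp add: c_def)
      have "\<bar>real_of_int m - l * (\<Lambda> k / (2 * u j))\<bar> * c = \<bar>(real_of_int m - l * (\<Lambda> k / (2 * u j))) * c\<bar>"
        using c by (simp add: abs_mult)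
      also have "(real_of_int m - l * (\<Lambda> k / (2 * u j))) * c = u j * node k m - 2 * pi * of_int l"
        using L uj by (simp add: c_def node_def field_simps)
      also have "\<bar>\<dots>\<bar> \<le> 4 * \<delta> j" using l by simp
      also have "4 * \<delta> j = q / pi * c" using L uj by (simp add: c_def q_def)
      finally have "\<bar>real_of_int m - l * (\<Lambda> k / (2 * u j))\<bar> \<le> q / pi" using c by (simp only: mult_le_cancel_right_pos)
      then show ?thesis unfolding M_def mem_Collect_eq abs_le_iff by linarith
    qed
    ultimately show "m \<in> (\<Union>l\<in>Ls. M l)" by blast
  qed
  then have "card (bad_nodes k j) \<le> card (\<Union>l\<in>Ls. M l)" using Lfin Mfin by (intro card_mono) auto
  also have "\<dots> \<le> (\<Sum>l\<in>Ls. card (M l))" by (rule card_UN_le[OF Lfin])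
  finally have "real (card (bad_nodes k j)) \<le> real (\<Sum>l\<in>Ls. card (M l))" by (rule of_nat_mono)
  also have "\<dots> = (\<Sum>l\<in>Ls. real (card (M l)))" by (rule of_nat_sum)
  also have "\<dots> \<le> (\<Sum>l\<in>Ls. q)" by (intro sum_mono Mcard)
  also have "\<dots> = real (card Ls) * q" by simp
  also have "\<dots> \<le> A * q" using Lcard q by (intro mult_right_mono) auto
  also have "\<dots> = scale k * \<delta> j" using uj by (simp add: A_def q_def scale_def)
  finally show ?thesis .
qed

definition good_nodes where "good_nodes k = nodes k - (\<Union>j<k. bad_nodes k j)"

text \<open>The small total of the \<delta> j is used here: the bad nodes of all earlier levels
  number at most \<open>scale k / 100000\<close>, against at least \<open>scale k / 20\<close>
  nodes.\<close>

lemma card_good_nodes: "real (card (good_nodes k)) \<ge> scale k / 32"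
proof -
  have fin: "finite (\<Union>j<k. bad_nodes k j)"
    by (rule finite_subset[OF _ finite_nodes[of k]]) (auto simp: bad_nodes_def)
  have "real (card (\<Union>j<k. bad_nodes k j)) \<le> real (\<Sum>j<k. card (bad_nodes k j))"
    by (intro of_nat_mono card_UN_le) simp
  also have "\<dots> = (\<Sum>j<k. real (card (bad_nodes k j)))" by (rule of_nat_sum)
  also have "\<dots> \<le> (\<Sum>j<k. scale k * \<delta> j)" by (intro sum_mono card_bad_nodes) auto
  also have "\<dots> = scale k * (\<Sum>j<k. \<delta> j)" by (simp add: sum_distrib_left)
  also have "\<dots> \<le> scale k * (1 / 100000)"
  proof (rule mult_left_mono)
    have "\<epsilon>\<^sup>2 \<le> 1" using eps by (simp add: abs_square_le_1)
    then show "(\<Sum>j<k. \<delta> j) \<le> 1 / 100000" using sum_win_le[of k] by linarith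
  qed (use scale_large[of k] in linarith)
  finally have "real (card (\<Union>j<k. bad_nodes k j)) \<le> scale k / 100000" by simp
  moreover have "card (nodes k) - card (\<Union>j<k. bad_nodes k j) \<le> card (good_nodes k)"
    unfolding good_nodes_def by (rule diff_card_le_card_Diff[OF fin])
  then have "real (card (nodes k)) \<le> real (card (\<Union>j<k. bad_nodes k j)) + real (card (good_nodes k))" by linarith
  ultimately show ?thesis using card_nodes[of k] scale_large[of k] by linarith
qed

text \<open>The hypotheses of the local model hold: earlier levels are off their windows because the
  node is good, and later ones have not reached theirs.\<close>

lemma xi_point_at_good_node:
  assumes m: "m \<in> good_nodes k" and k: "k \<ge> 1" and \<xi>: "\<epsilon> < norm \<xi>" "norm \<xi> < 1"
    and err: "2 * (5 * dip k + 16 * V / k) < \<epsilon> * (1 - norm \<xi>) / 128"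
  shows "\<exists>s. tower_lim 0 s = \<xi> \<and> Re s \<ge> (1 - norm \<xi>) / (8 * \<Lambda> k) \<and> \<bar>Im s - node k m\<bar> \<le> 5 / \<Lambda> k"
proof -
  have L: "\<Lambda> k > 0" and uk: "u k > 0" by (rule Lam_pos, rule u_pos)
  have node: "\<delta> k / u k + V / \<Lambda> k \<le> node k m" "node k m \<le> 2 * \<delta> k / u k - V / \<Lambda> k"
    using m by (auto simp: good_nodes_def nodes_def)
  have off: "\<bar>u j * node k m - 2 * pi * of_int l\<bar> \<ge> 4 * \<delta> j" if "j < k" for j and l :: int
    using m that unfolding good_nodes_def bad_nodes_def by (auto simp: not_less)
  have im: "\<bar>Im s - node k m\<bar> \<le> V / \<Lambda> k" if "norm (s - \<i> * of_real (node k m)) \<le> V / \<Lambda> k" for s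
    using abs_Im_le_cmod[of "s - \<i> * of_real (node k m)"] that by simp
  have range: "\<delta> k / u k \<le> Im s \<and> Im s \<le> 2 * \<delta> k / u k"
    if "norm (s - \<i> * of_real (node k m)) \<le> V / \<Lambda> k" for s
    using im[OF that] node by linarith
  show ?thesis
  proof (rule xi_point_exists[of k "node k m" \<xi>])
    \<comment> \<open>The phase of the carrier at the node is \<open>- 4 * pi * m\<close>, that is
      \<open>- 2 * m\<close> full turns.\<close>
    have "\<Lambda> k * node k m = 4 * pi * of_int m" using L by (simp add: node_def)
    then show "Z k (\<i> * of_real (node k m)) = 1"
      unfolding Z_def exp_eq_1 by (intro conjI exI[of _ "- 2 * m"]) simp_all
    fix s assume s: "Re s \<ge> 0" "norm (s - \<i> * of_real (node k m)) \<le> V / \<Lambda> k"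
    show "norm (a k s - Z k s) \<le> 3 * dip k"
      by (rule norm_a_minus_Z_le[OF s(1)]) (use range[OF s(2)] uk in \<open>auto simp: field_simps\<close>)
    fix j assume "j \<noteq> k"
    then consider "j < k" | "j > k" by linarith
    then show "norm (a j s) \<le> \<tau> j"
    proof cases
      case 1
      show ?thesis
      proof (rule norm_a_le_small_r[OF s(1) r_off], rule allI)
        fix l :: int
        have "V / \<Lambda> k \<le> \<delta> j"
        proof -
          have "V \<le> \<delta> k * \<Lambda> k" using Lam_win[of k] V_ge by (simp add: V_def mult.commute)
          then have "V / \<Lambda> k \<le> \<delta> k" using L by (simp add: divide_le_eq)
          then show ?thesis using win_antimono[of j k] 1 by simp
        qed
        moreover have "\<bar>u j * Im s - u j * node k m\<bar> \<le> V / \<Lambda> k"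
        proof -
          have "\<bar>u j * Im s - u j * node k m\<bar> = u j * \<bar>Im s - node k m\<bar>"
            using u_pos[of j] by (simp add: abs_mult flip: right_diff_distrib)
          also have "\<dots> \<le> 1 * (V / \<Lambda> k)" using im[OF s(2)] u_le[of j] u_pos[of j] by (intro mult_mono) auto
          finally show ?thesis by simp
        qed
        ultimately show "\<bar>u j * Im s - 2 * pi * of_int l\<bar> \<ge> 3 * \<delta> j" using off[OF 1, of l] by linarith
      qed
    next
      case 2
      show ?thesis
      proof (rule norm_a_le_tol_late[OF 2 s(1)])
        have "\<delta> k / u k > 0" using win_pos[of k] uk by simp
        then have "\<bar>Im s\<bar> \<le> 2 * \<delta> k / u k" using range[OF s(2)] by linarith
        also have "\<dots> \<le> 2 * pi / u k" using win_le[of k] pi_gt3 uk by (intro divide_right_mono) auto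
        finally show "\<bar>Im s\<bar> \<le> 2 * pi / u k" .
      qed
    qed
  qed (use k \<xi> err in auto)
qed

text \<open>At least \<open>scale k / 32\<close> nodes each give a \<xi>-point of real part at least
  \<open>(1 - norm \<xi>) / (8 * \<Lambda> k)\<close>. In terms of
  \<open>T = 2 * \<delta> k / u k\<close> the total is \<open>T * (1 - norm \<xi>) / 512\<close>,
  and \<open>pi / 512 > 1 / 200\<close>.\<close>

lemma Nf_lower:
  assumes k: "k \<ge> 1" and \<xi>: "\<epsilon> < norm \<xi>" "norm \<xi> < 1"
    and err: "2 * (5 * dip k + 16 * V / k) < \<epsilon> * (1 - norm \<xi>) / 128"
  shows "Nf (tower_lim 0) \<xi> (2 * \<delta> k / u k) \<ge> ennreal ((1 - norm \<xi>) / 200)"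
proof -
  define T where "T = 2 * \<delta> k / u k"
  have L: "\<Lambda> k > 0" and uk: "u k > 0" by (rule Lam_pos, rule u_pos)
  have T: "T > 0" using win_pos[of k] uk by (simp add: T_def)
  obtain \<sigma> where \<sigma>: "\<And>m. m \<in> good_nodes k \<Longrightarrow> tower_lim 0 (\<sigma> m) = \<xi> \<and>
      Re (\<sigma> m) \<ge> (1 - norm \<xi>) / (8 * \<Lambda> k) \<and> \<bar>Im (\<sigma> m) - node k m\<bar> \<le> 5 / \<Lambda> k"
    using xi_point_at_good_node[OF _ k \<xi> err] by metis
  \<comment> \<open>Distinct nodes are at least \<open>4 * pi / \<Lambda> k\<close> apart, more than
    twice the distance \<open>5 / \<Lambda> k\<close> of a point from its node.\<close>
  have inj: "inj_on \<sigma> (good_nodes k)"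
  proof (rule inj_onI, rule ccontr)
    fix m m' assume m: "m \<in> good_nodes k" "m' \<in> good_nodes k" "\<sigma> m = \<sigma> m'" "m \<noteq> m'"
    have "\<bar>node k m - node k m'\<bar> \<le> 10 / \<Lambda> k" using \<sigma>[OF m(1)] \<sigma>[OF m(2)] m(3) by (simp add: abs_le_iff)
    moreover have "node k m - node k m' = 4 * pi * of_int (m - m') / \<Lambda> k"
      by (simp add: node_def right_diff_distrib diff_divide_distrib)
    ultimately have "\<bar>4 * pi * real_of_int (m - m')\<bar> \<le> 10" using L by (simp add: abs_divide divide_le_cancel)
    moreover have "\<bar>real_of_int (m - m')\<bar> \<ge> 1" using m(4) by linarith
    then have "4 * pi * 1 \<le> 4 * pi * \<bar>real_of_int (m - m')\<bar>" by (intro mult_left_mono) auto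
    moreover have "\<bar>4 * pi * real_of_int (m - m')\<bar> = 4 * pi * \<bar>real_of_int (m - m')\<bar>" by (simp add: abs_mult)
    ultimately show False using pi_gt3 by linarith
  qed
  have pos: "(1 - norm \<xi>) / (8 * \<Lambda> k) > 0" using \<xi> L by simp
  define g where "g s = nat (zorder (\<lambda>z. tower_lim 0 z - \<xi>) s) * Re s" for s
  have sub: "\<sigma> ` good_nodes k \<subseteq> {s\<in>halfplane 0. tower_lim 0 s = \<xi> \<and> \<bar>Im s\<bar> < T}"
  proof (rule image_subsetI)
    fix m assume m: "m \<in> good_nodes k"
    have node: "\<delta> k / u k + V / \<Lambda> k \<le> node k m" "node k m \<le> 2 * \<delta> k / u k - V / \<Lambda> k"
      using m by (auto simp: good_nodes_def nodes_def)
    \<comment> \<open>Strictness matters: \<open>Nf\<close> counts only points with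
      \<open>\<bar>Im s\<bar> < T\<close>.\<close>
    have "V > 5" unfolding V_def using eps by simp
    then have "5 / \<Lambda> k < V / \<Lambda> k" using L by (simp add: divide_strict_right_mono)
    moreover have "\<delta> k / u k > 0" using win_pos[of k] uk by simp
    ultimately have "\<bar>Im (\<sigma> m)\<bar> < T" unfolding T_def using \<sigma>[OF m] node by linarith
    then show "\<sigma> m \<in> {s\<in>halfplane 0. tower_lim 0 s = \<xi> \<and> \<bar>Im s\<bar> < T}"
      using \<sigma>[OF m] pos by auto
  qed
  have g: "g (\<sigma> m) \<ge> (1 - norm \<xi>) / (8 * \<Lambda> k)" if m: "m \<in> good_nodes k" for m
  proof -
    have R: "Re (\<sigma> m) > 0" using \<sigma>[OF m] pos by linarith
    have "1 * Re (\<sigma> m) \<le> g (\<sigma> m)" unfolding g_def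
      using zorder_xi_point_ge_1[OF R _ \<xi>(1)] \<sigma>[OF m] R by (intro mult_right_mono) auto
    then show ?thesis using \<sigma>[OF m] by linarith
  qed
  have "T * (1 - norm \<xi>) / 512 = scale k / 32 * ((1 - norm \<xi>) / (8 * \<Lambda> k))"
    using L uk by (simp add: T_def scale_def field_simps)
  also have "\<dots> \<le> real (card (good_nodes k)) * ((1 - norm \<xi>) / (8 * \<Lambda> k))"
    using card_good_nodes[of k] pos by (intro mult_right_mono) auto
  also have "\<dots> = (\<Sum>m\<in>good_nodes k. (1 - norm \<xi>) / (8 * \<Lambda> k))" by simp
  also have "\<dots> \<le> (\<Sum>m\<in>good_nodes k. g (\<sigma> m))" by (intro sum_mono g)
  also have "\<dots> = (\<Sum>s\<in>\<sigma> ` good_nodes k. g s)" by (simp add: sum.reindex[OF inj])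
  finally have sum: "T * (1 - norm \<xi>) / 512 \<le> (\<Sum>s\<in>\<sigma> ` good_nodes k. g s)" .
  have "(1 - norm \<xi>) / 200 \<le> pi / T * (T * (1 - norm \<xi>) / 512)"
  proof -
    have "pi / T * (T * (1 - norm \<xi>) / 512) = pi * (1 - norm \<xi>) / 512" using T by simp
    moreover have "3 * (1 - norm \<xi>) / 512 \<le> pi * (1 - norm \<xi>) / 512"
      using \<xi> pi_gt3 by (intro divide_right_mono mult_right_mono) auto
    ultimately show ?thesis using \<xi> by simp
  qed
  then have "ennreal ((1 - norm \<xi>) / 200) \<le> ennreal (pi / T * (T * (1 - norm \<xi>) / 512))" by (rule ennreal_leI)
  also have "\<dots> = ennreal (pi / T) * ennreal (T * (1 - norm \<xi>) / 512)" using T \<xi> by (intro ennreal_mult) auto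
  also have "\<dots> \<le> Nf (tower_lim 0) \<xi> T"
    unfolding Nf_def
  proof (rule mult_left_mono)
    have "ennreal (T * (1 - norm \<xi>) / 512) \<le> ennreal (\<Sum>s\<in>\<sigma> ` good_nodes k. g s)"
      by (rule ennreal_leI[OF sum])
    also have "\<dots> \<le> (\<Sum>\<^sub>\<infinity>s\<in>{s\<in>halfplane 0. tower_lim 0 s = \<xi> \<and> \<bar>Im s\<bar> < T}. ennreal (g s))"
    proof (rule le_infsum_ennreal)
      show "finite (\<sigma> ` good_nodes k)" using finite_nodes[of k] by (simp add: good_nodes_def)
    qed (use sub in \<open>auto simp: g_def\<close>)
    finally show "ennreal (T * (1 - norm \<xi>) / 512) \<le>
       (\<Sum>\<^sub>\<infinity>s\<in>{s\<in>halfplane 0. tower_lim 0 s = \<xi> \<and> \<bar>Im s\<bar> < T}.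
          ennreal (real (nat (zorder (\<lambda>z. tower_lim 0 z - \<xi>) s)) * Re s))"
      unfolding g_def .
  qed simp
  finally show ?thesis by (simp add: T_def)
qed

section \<open>Both scales tend to infinity, and the limit fails to exist\<close>

lemma u_le_power: "u k \<le> (1/2) ^ k"
proof (induction k)
  case 0
  show ?case using u_le[of 0] by simp
next
  case (Suc k)
  have "2 * u (Suc k) \<le> 2 * pi * u (Suc k)" using u_pos[of "Suc k"] pi_gt3 by (intro mult_right_mono) auto
  also have "\<dots> \<le> \<delta> (Suc k) / 2 * u k" by (rule u_Suc)
  also have "\<dots> \<le> 1 * u k" using u_pos[of k] win_le[of "Suc k"] by (intro mult_right_mono) auto
  finally show ?case using Suc by simp
qed

lemma inverse_u_at_top: "filterlim (\<lambda>k. 1 / u k) at_top sequentially"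
proof (rule filterlim_at_top_mono)
  show "filterlim (\<lambda>k. (2::real) ^ k) at_top sequentially"
    using filterlim_at_infinity_imp_filterlim_at_top[OF filterlim_realpow_sequentially_gt1[of "2::real"]] by simp
  show "\<forall>\<^sub>F k in sequentially. (2::real) ^ k \<le> 1 / u k"
  proof (rule always_eventually, rule allI)
    fix k
    have "2 ^ k * u k \<le> 2 ^ k * (1/2) ^ k" using u_le_power[of k] by (intro mult_left_mono) auto
    also have "\<dots> = 1" by (simp flip: power_mult_distrib)
    finally show "2 ^ k \<le> 1 / u k" using u_pos[of k] by (simp add: le_divide_eq)
  qed
qed

lemma upper_scale_at_top: "filterlim (\<lambda>k. 2 * pi / u k) at_top sequentially"
  using filterlim_tendsto_pos_mult_at_top[OF tendsto_const _ inverse_u_at_top, of "2 * pi"] by simp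

text \<open>Since \<delta> k tends to 0, growth of \<open>1 / u k\<close> alone does not suffice. By
  \<open>u_Suc\<close> the scale of level \<open>k + 1\<close> is at least \<open>1 / u k\<close>,
  whence the shift by one.\<close>

lemma lower_scale_at_top: "filterlim (\<lambda>k. 2 * \<delta> k / u k) at_top sequentially"
proof -
  have "filterlim (\<lambda>k. 2 * \<delta> (Suc k) / u (Suc k)) at_top sequentially"
  proof (rule filterlim_at_top_mono[OF inverse_u_at_top], rule always_eventually, rule allI)
    fix k
    have "2 * 3 * u (Suc k) \<le> 2 * pi * u (Suc k)" using pi_gt3 u_pos[of "Suc k"] by (intro mult_right_mono) auto
    moreover have "0 < \<delta> (Suc k) * u k" using u_pos[of k] win_pos[of "Suc k"] by simp
    moreover have "\<delta> (Suc k) / 2 * u k = (\<delta> (Suc k) * u k) / 2" by simp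
    ultimately have "u (Suc k) \<le> 2 * (\<delta> (Suc k) * u k)"
      using u_Suc[of k] u_pos[of "Suc k"] by linarith
    then show "1 / u k \<le> 2 * \<delta> (Suc k) / u (Suc k)"
      using u_pos[of k] u_pos[of "Suc k"] by (simp add: field_simps)
  qed
  then show ?thesis by (rule filterlim_sequentially_Suc[THEN iffD1])
qed

lemma err_eventually_small:
  assumes "e > 0"
  shows "\<forall>\<^sub>F k in sequentially. 2 * (5 * dip k + 16 * V / real k) < e"
proof -
  have "(\<lambda>k. (1/4) * (1/2::real) ^ k) \<longlonglongrightarrow> 1/4 * 0"
    by (intro tendsto_intros LIMSEQ_power_zero) simp
  then have "dip \<longlonglongrightarrow> 0" by (simp add: dip_def[abs_def] power_add power2_eq_square)
  moreover have "(\<lambda>k. 16 * V / real k) \<longlonglongrightarrow> 0" by (rule lim_const_over_n)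
  ultimately have "(\<lambda>k. 2 * (5 * dip k + 16 * V / real k)) \<longlonglongrightarrow> 2 * (5 * 0 + 0)"
    by (intro tendsto_intros)
  then show ?thesis using assms order_tendstoD(2)[of _ "2 * (5 * 0 + 0)" sequentially e] by simp
qed

text \<open>The limit \<open>L\<close> ranges over \<open>ennreal\<close>, so divergence to infinity
  is excluded as well.\<close>

lemma Nf_not_tendsto:
  assumes \<xi>: "\<epsilon> < norm \<xi>" "norm \<xi> < 1"
  shows "\<not> ((\<lambda>T. Nf (tower_lim 0) \<xi> T) \<longlongrightarrow> L) at_top"
proof
  assume lim: "((\<lambda>T. Nf (tower_lim 0) \<xi> T) \<longlongrightarrow> L) at_top"
  have "((\<lambda>k. Nf (tower_lim 0) \<xi> (2 * pi / u k)) \<longlongrightarrow> L) sequentially"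
    by (rule filterlim_compose[OF lim upper_scale_at_top])
  then have up: "L \<le> ennreal ((1 - norm \<xi>) / 500)"
    by (rule tendsto_upperbound) (auto intro: always_eventually Nf_upper[OF \<xi>])
  have "((\<lambda>k. Nf (tower_lim 0) \<xi> (2 * \<delta> k / u k)) \<longlongrightarrow> L) sequentially"
    by (rule filterlim_compose[OF lim lower_scale_at_top])
  moreover have "\<forall>\<^sub>F k in sequentially. ennreal ((1 - norm \<xi>) / 200) \<le> Nf (tower_lim 0) \<xi> (2 * \<delta> k / u k)"
  proof -
    have "\<epsilon> * (1 - norm \<xi>) / 128 > 0" using eps \<xi> by simp
    from err_eventually_small[OF this] eventually_ge_at_top[of 1] show ?thesis
      by eventually_elim (rule Nf_lower[OF _ \<xi>], auto)
  qed
  ultimately have "ennreal ((1 - norm \<xi>) / 200) \<le> L" by (rule tendsto_lowerbound) auto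
  also note up
  finally have "ennreal ((1 - norm \<xi>) / 200) \<le> ennreal ((1 - norm \<xi>) / 500)" .
  then show False using \<xi> by (subst (asm) ennreal_le_iff) auto
qed

end

section \<open>Choice of the frequencies\<close>

text \<open>A single large \<open>N\<close> meets all demands, since the frequency is at least
  \<open>ln N\<close> and the gap at most \<open>1 / N\<close>.\<close>

lemma block_size_exists:
  fixes B g :: real
  assumes "g > 0"
  obtains N where "N \<ge> 3" "block_freq n N \<ge> B" "block_gap N \<le> g" "real N \<ge> B"
proof -
  define N where "N = nat \<lceil>max 3 (max (exp B) (max (1 / g) B))\<rceil>"
  have "real N \<ge> max 3 (max (exp B) (max (1 / g) B))"
    unfolding N_def by (rule real_nat_ceiling_ge)
  then have N: "real N \<ge> 3" "real N \<ge> exp B" "real N \<ge> 1 / g" "real N \<ge> B" by auto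
  then have N3: "N \<ge> 3" by simp
  have "B \<le> ln (real N)" using N by (subst ln_ge_iff) auto
  then have "block_freq n N \<ge> B" using block_freq_ge(2)[OF N3, of n] by linarith
  moreover have "1 / real N \<le> g" using N(1,3) assms by (simp add: field_simps)
  then have "block_gap N \<le> g" using block_gap_bounds(2)[OF N3] by linarith
  ultimately show thesis using that[OF N3] N(4) by simp
qed

lemma block_lipschitz_constant:
  assumes "N \<ge> 3"
  obtains D where "D \<ge> 0"
    "\<And>s s'. Re s \<ge> 0 \<Longrightarrow> Re s' \<ge> 0 \<Longrightarrow> norm (block c n N s - block c n N s') \<le> D * norm (s - s')"
    "\<And>s s'. Re s \<ge> 0 \<Longrightarrow> Re s' \<ge> 0 \<Longrightarrow>
      norm (block_carrier n N s ^ 2 - block_carrier n N s' ^ 2) \<le> D * norm (s - s')"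
proof -
  obtain D1 where D1: "D1 \<ge> 0" "\<And>s s'. Re s \<ge> 0 \<Longrightarrow> Re s' \<ge> 0 \<Longrightarrow> norm (block c n N s - block c n N s') \<le> D1 * norm (s - s')"
    using bounded_lipschitz_block(1)[OF assms, of c n] unfolding bounded_lipschitz_def by blast
  obtain D2 where D2: "D2 \<ge> 0" "\<And>s s'. Re s \<ge> 0 \<Longrightarrow> Re s' \<ge> 0 \<Longrightarrow>
      norm (block_carrier n N s ^ 2 - block_carrier n N s' ^ 2) \<le> D2 * norm (s - s')"
    using bounded_lipschitz_block(2)[OF assms, of n] unfolding bounded_lipschitz_def by blast
  show thesis
  proof (rule that[of "D1 + D2"])
    fix s s' :: complex assume s: "Re s \<ge> 0" "Re s' \<ge> 0"
    have "D1 * norm (s - s') \<le> (D1 + D2) * norm (s - s')" "D2 * norm (s - s') \<le> (D1 + D2) * norm (s - s')"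
      using D1(1) D2(1) by (auto intro!: mult_right_mono)
    then show "norm (block c n N s - block c n N s') \<le> (D1 + D2) * norm (s - s')"
      "norm (block_carrier n N s ^ 2 - block_carrier n N s' ^ 2) \<le> (D1 + D2) * norm (s - s')"
      using D1(2)[OF s] D2(2)[OF s] by linarith+
  qed (use D1 D2 in auto)
qed

text \<open>The polynomials depend only on \<epsilon> and the level, so they are fixed in advance.
  The sizes \<open>N\<close> need dependent choice: \<open>u_Suc\<close> involves the previous gap,
  and \<open>Lam_Suc\<close> the Lipschitz constants of all earlier blocks.\<close>

lemma moebius_tower_exists:
  assumes eps: "0 < \<epsilon>" "\<epsilon> < 1"
  shows "\<exists>a r u \<Lambda> D. moebius_tower \<epsilon> a r u \<Lambda> D"
proof -
  note win0 = win_bounds(1)[OF eps]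
  have win1: "win \<epsilon> k \<le> 1" for k using win_bounds(2)[OF eps, of k] by linarith
  have tol0: "tol \<epsilon> k > 0" for k using eps by (simp add: tol_def)
  note dip0 = dip_pos
  have dip1: "dip k \<le> 1/2" for k using dip_le[of k] by linarith
  define P where "P k c n \<longleftrightarrow>
    (\<forall>\<theta>. \<bar>cosine_poly c n \<theta>\<bar> \<le> 1 - dip k) \<and>
    (\<forall>\<theta>. \<theta> \<in> {win \<epsilon> k..2 * win \<epsilon> k} \<longrightarrow> cosine_poly c n \<theta> \<ge> 1 - 2 * dip k) \<and>
    (\<forall>\<theta>. (\<forall>l::int. \<bar>\<theta> - 2 * pi * of_int l\<bar> \<ge> 3 * win \<epsilon> k) \<longrightarrow> \<bar>cosine_poly c n \<theta>\<bar> \<le> tol \<epsilon> k / 2) \<and>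
    (\<forall>\<theta>. \<bar>\<theta>\<bar> \<le> win \<epsilon> k / 2 \<longrightarrow> \<bar>cosine_poly c n \<theta>\<bar> \<le> tol \<epsilon> k / 2)" for k c n
  have "\<forall>k. \<exists>c n. P k c n"
  proof
    fix k
    obtain c n where "\<And>\<theta>. \<bar>\<Sum>i\<le>n. c i * cos \<theta> ^ i\<bar> \<le> 1 - dip k"
      "\<And>\<theta>. \<theta> \<in> {win \<epsilon> k..2 * win \<epsilon> k} \<Longrightarrow> (\<Sum>i\<le>n. c i * cos \<theta> ^ i) \<ge> 1 - 2 * dip k"
      "\<And>\<theta>. (\<forall>l::int. \<bar>\<theta> - 2 * pi * of_int l\<bar> \<ge> 3 * win \<epsilon> k) \<Longrightarrow> \<bar>\<Sum>i\<le>n. c i * cos \<theta> ^ i\<bar> \<le> tol \<epsilon> k / 2"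
      "\<And>\<theta>. \<bar>\<theta>\<bar> \<le> win \<epsilon> k / 2 \<Longrightarrow> \<bar>\<Sum>i\<le>n. c i * cos \<theta> ^ i\<bar> \<le> tol \<epsilon> k / 2"
      by (rule window_cosine_polynomial[of "win \<epsilon> k" "dip k" "tol \<epsilon> k / 2"])
        (use win0 win1 dip0 dip1 tol0 in auto)
    then have "P k c n" unfolding P_def cosine_poly_def by blast
    then show "\<exists>c n. P k c n" by blast
  qed
  from choice[OF this] obtain c where "\<forall>k. \<exists>n. P k (c k) n" by blast
  from choice[OF this] obtain n where P: "\<And>k. P k (c k) (n k)" by blast
  \<comment> \<open>\<open>B\<close> gathers the lower bounds for the frequency and for
    \<open>N\<close>; its last entry brings the Dirichlet norms below 1/8. \<open>g\<close> gathers
    the upper bounds for the gap; its last entry controls the approximation errors.\<close>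
  define B where "B k = max (max (real k + 2) (1000 * (ln (2 / \<epsilon>) + 5) / win \<epsilon> k)) (8 * ((\<Sum>i\<le>n k. \<bar>c k i\<bar>) + 1))" for k
  define g where "g k = min (4 * win \<epsilon> k / ln (64 / \<epsilon>)) (min (tol \<epsilon> k / 2) (dip k / 4) / (cosine_poly_lip (c k) (n k) + 1))" for k
  have ln64: "ln (64 / \<epsilon>) > 0" using eps by (intro ln_gt_zero) (simp add: field_simps)
  have lip0: "cosine_poly_lip (c k) (n k) \<ge> 0" for k by (rule cosine_poly_lip_nonneg)
  have lip1: "cosine_poly_lip (c k) (n k) + 1 > 0" for k using lip0[of k] by linarith
  have g0: "g k > 0" for k
    unfolding g_def using win0[of k] tol0[of k] dip0[of k] ln64 lip1[of k] by simp
  define ok where "ok k N D \<longleftrightarrow> N \<ge> 3 \<and> block_freq (n k) N \<ge> B k \<and> block_gap N \<le> g k \<and> real N \<ge> B k \<and> D \<ge> 0 \<and>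
    (\<forall>s s'. Re s \<ge> 0 \<longrightarrow> Re s' \<ge> 0 \<longrightarrow> norm (block (c k) (n k) N s - block (c k) (n k) N s') \<le> D * norm (s - s')) \<and>
    (\<forall>s s'. Re s \<ge> 0 \<longrightarrow> Re s' \<ge> 0 \<longrightarrow>
      norm (block_carrier (n k) N s ^ 2 - block_carrier (n k) N s' ^ 2) \<le> D * norm (s - s'))" for k N D
  have ok_exists: "\<exists>N D. ok k N D \<and> block_freq (n k) N \<ge> B' \<and> block_gap N \<le> g'" if g': "g' > 0" for k B' g'
  proof -
    obtain N where N: "N \<ge> 3" "block_freq (n k) N \<ge> max (B k) B'" "block_gap N \<le> min (g k) g'" "real N \<ge> max (B k) B'"
      by (rule block_size_exists[where g = "min (g k) g'" and n = "n k" and B = "max (B k) B'"])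
        (use g0[of k] g' in auto)
    obtain D where "D \<ge> 0"
      "\<And>s s'. Re s \<ge> 0 \<Longrightarrow> Re s' \<ge> 0 \<Longrightarrow> norm (block (c k) (n k) N s - block (c k) (n k) N s') \<le> D * norm (s - s')"
      "\<And>s s'. Re s \<ge> 0 \<Longrightarrow> Re s' \<ge> 0 \<Longrightarrow>
        norm (block_carrier (n k) N s ^ 2 - block_carrier (n k) N s' ^ 2) \<le> D * norm (s - s')"
      using block_lipschitz_constant[OF N(1), of "c k" "n k"] by blast
    then have "ok k N D \<and> block_freq (n k) N \<ge> B' \<and> block_gap N \<le> g'" using N unfolding ok_def by auto
    then show ?thesis by blast
  qed
  \<comment> \<open>The third component carries the sum of the earlier Lipschitz constants, so that
    a step of the choice sees it without the whole history.\<close>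
  define PP where "PP k x \<longleftrightarrow> (case x of (N, D, E) \<Rightarrow> ok k N D \<and> (k = 0 \<longrightarrow> E = (0::real)))" for k x
  define QQ where "QQ k x y \<longleftrightarrow> (case x of (N, D, E) \<Rightarrow> case y of (N', D', E') \<Rightarrow>
      E' = E + D \<and> block_freq (n (Suc k)) N' \<ge> real (Suc k) * (E + D) \<and>
      2 * pi * block_gap N' \<le> win \<epsilon> (Suc k) / 2 * block_gap N)"
    for k and x :: "nat \<times> real \<times> real" and y :: "nat \<times> real \<times> real"
  have "\<exists>h. \<forall>k. PP k (h k) \<and> QQ k (h k) (h (Suc k))"
  proof (rule dependent_nat_choice)
    obtain N D where "ok 0 N D" using ok_exists[of 1 0 0] by auto
    then show "\<exists>x. PP 0 x" unfolding PP_def by (intro exI[of _ "(N, D, 0)"]) auto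
    fix x k assume PPx: "PP k x"
    obtain N D E where x: "x = (N, D, E)" by (cases x)
    have okN: "ok k N D" using PPx by (simp add: PP_def x)
    then have "block_gap N > 0" using block_gap_bounds(1)[of N] by (auto simp: ok_def)
    then have "win \<epsilon> (Suc k) / 2 * block_gap N / (2 * pi) > 0" using win0[of "Suc k"] by simp
    from ok_exists[OF this, of "Suc k" "real (Suc k) * (E + D)"]
    obtain N' D' where N': "ok (Suc k) N' D'" "block_freq (n (Suc k)) N' \<ge> real (Suc k) * (E + D)"
      "block_gap N' \<le> win \<epsilon> (Suc k) / 2 * block_gap N / (2 * pi)" by blast
    have "2 * pi * block_gap N' \<le> win \<epsilon> (Suc k) / 2 * block_gap N"
      using N'(3) pi_gt_zero by (simp add: pos_le_divide_eq ac_simps)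
    then show "\<exists>y. PP (Suc k) y \<and> QQ k x y"
      using N' by (intro exI[of _ "(N', D', E + D)"]) (auto simp: PP_def QQ_def x)
  qed
  then obtain h where h: "\<And>k. PP k (h k)" "\<And>k. QQ k (h k) (h (Suc k))" by blast
  define N where "N k = fst (h k)" for k
  define D where "D k = fst (snd (h k))" for k
  define E where "E k = snd (snd (h k))" for k
  have hk: "h k = (N k, D k, E k)" for k by (simp add: N_def D_def E_def)
  have okk: "ok k (N k) (D k)" for k using h(1)[of k] by (simp add: hk PP_def)
  have E_Suc: "E (Suc k) = E k + D k" and freq_Suc: "block_freq (n (Suc k)) (N (Suc k)) \<ge> real (Suc k) * (E k + D k)"
    and gap_Suc: "2 * pi * block_gap (N (Suc k)) \<le> win \<epsilon> (Suc k) / 2 * block_gap (N k)" for k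
    using h(2)[of k] by (auto simp: hk QQ_def)
  have "E 0 = 0" using h(1)[of 0] by (simp add: hk PP_def)
  then have E: "E k = (\<Sum>j<k. D j)" for k by (induction k) (auto simp: E_Suc)
  have N3: "N k \<ge> 3" and freqB: "block_freq (n k) (N k) \<ge> B k" and gapg: "block_gap (N k) \<le> g k"
    and NB: "real (N k) \<ge> B k" and D0: "D k \<ge> 0" for k
    using okk[of k] by (auto simp: ok_def)
  have gap0: "block_gap (N k) > 0" for k by (rule block_gap_bounds(1)[OF N3])
  let ?a = "\<lambda>k. block (c k) (n k) (N k)" and ?Z = "\<lambda>k. block_carrier (n k) (N k)"
    and ?r = "\<lambda>k t. cosine_poly (c k) (n k) (block_gap (N k) * t)"
    and ?u = "\<lambda>k. block_gap (N k)" and ?\<Lambda> = "\<lambda>k. block_freq (n k) (N k)"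
    and ?L = "\<lambda>k. cosine_poly_lip (c k) (n k)"
  have lipgap: "?L k * ?u k \<le> tol \<epsilon> k / 2"
    "?L k * ?u k \<le> dip k / 4" for k
  proof -
    have "?L k * ?u k \<le> (?L k + 1) * ?u k"
      using gap0[of k] by (intro mult_right_mono) auto
    also have "\<dots> \<le> (?L k + 1) * (min (tol \<epsilon> k / 2) (dip k / 4) / (?L k + 1))"
      using gapg[of k] lip1[of k] by (intro mult_left_mono) (auto simp: g_def)
    also have "\<dots> = min (tol \<epsilon> k / 2) (dip k / 4)" using lip1[of k] by simp
    finally show "?L k * ?u k \<le> tol \<epsilon> k / 2"
      "?L k * ?u k \<le> dip k / 4" by auto
  qed
  have approx: "norm (?a k s - ?Z k s *
      of_real (?r k (Im s))) \<le> ?L k * ?u k"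
    if "Re s \<ge> 0" for k s by (rule block_approx_uniform[OF that N3])
  have "moebius_tower \<epsilon> ?a ?r ?u ?\<Lambda> D"
  proof (unfold_locales, unfold block_carrier_def[symmetric])
    fix k
    show "?\<Lambda> k \<ge> real k + 2" using freqB[of k] by (simp add: B_def)
    have "1000 * (ln (2 / \<epsilon>) + 5) / win \<epsilon> k \<le> ?\<Lambda> k" using freqB[of k] by (simp add: B_def)
    then show "1000 * (ln (2 / \<epsilon>) + 5) \<le> ?\<Lambda> k * win \<epsilon> k"
      using win0[of k] by (simp add: pos_divide_le_eq)
    show "?u k > 0" by (rule gap0)
    show "?u k \<le> 1" by (rule block_gap_bounds(3)[OF N3])
    have "?u k \<le> 4 * win \<epsilon> k / ln (64 / \<epsilon>)" using gapg[of k] by (simp add: g_def)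
    then show "ln (64 / \<epsilon>) \<le> 4 * win \<epsilon> k / ?u k"
      using ln64 gap0[of k] by (simp add: field_simps)
    show "2 * pi * block_gap (N (Suc k)) \<le> win \<epsilon> (Suc k) / 2 * ?u k" by (rule gap_Suc)
    show "D k \<ge> 0" by (rule D0)
    show "real k * (\<Sum>j<k. D j) \<le> ?\<Lambda> k"
    proof (cases k)
      case 0
      then show ?thesis using block_freq_ge(1)[OF N3[of k], of "n k"] by simp
    next
      case (Suc m)
      show ?thesis using freq_Suc[of m] unfolding E Suc by (simp only: sum.lessThan_Suc)
    qed
    show "?a k holomorphic_on halfplane 0" by (rule block_holomorphic)
    show "?a k (\<i> * of_real t) = ?Z k (\<i> * of_real t) *
        of_real (?r k t)" for t by (rule block_imag)
    show "\<bar>?r k t\<bar> \<le> 1 - dip k" for t using P[of k] by (simp add: P_def)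
    show "1 - 2 * dip k \<le> ?r k t"
      if "?u k * t \<in> {win \<epsilon> k..2 * win \<epsilon> k}" for t using P[of k] that unfolding P_def by blast
    show "\<bar>?r k t\<bar> \<le> tol \<epsilon> k / 2"
      if "\<forall>l::int. 3 * win \<epsilon> k \<le> \<bar>?u k * t - 2 * pi * of_int l\<bar>" for t
      using P[of k] that unfolding P_def by blast
    show "\<bar>?r k t\<bar> \<le> tol \<epsilon> k / 2"
      if "\<bar>?u k * t\<bar> \<le> win \<epsilon> k / 2" for t
      using P[of k] that unfolding P_def by blast
    have B8: "8 * ((\<Sum>i\<le>n k. \<bar>c k i\<bar>) + 1) \<le> real (N k)" using NB[of k] by (simp add: B_def)
    have c0: "(\<Sum>i\<le>n k. \<bar>c k i\<bar>) \<ge> 0" by (intro sum_nonneg) auto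
    have Np: "real (N k) > 0" using N3[of k] by simp
    show "abs_dirichlet (?a k) (1/8)"
    proof (rule abs_dirichlet_cong[OF abs_dirichlet_block(1)[OF N3] refl])
      show "(\<Sum>i\<le>n k. \<bar>c k i\<bar>) / real (N k) \<le> 1/8" using B8 Np by (simp add: pos_divide_le_eq)
    qed
    show "abs_dirichlet (\<lambda>s. ?Z k s ^ 2) (1/8)"
    proof (rule abs_dirichlet_cong[OF abs_dirichlet_block(2)[OF N3] refl])
      have "8 \<le> real (N k)" by (rule order_trans[OF _ B8]) (use c0 in simp)
      then show "1 / real (N k) \<le> 1/8" using Np by (simp add: pos_divide_le_eq)
    qed
    fix s :: complex
    show "norm (?a k s + ?Z k s ^ 2 * x) < norm (1 + ?a k s * x)"
      if "Re s > 0" "norm x \<le> 1" for x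
      by (rule block_moebius_contractive[OF that(1) N3 that(2) dip0])
        (use P[of k] dip1[of k] lipgap(2)[of k] in \<open>auto simp: P_def\<close>)
    show "norm (?a k s - ?a k s') \<le> D k * norm (s - s')"
      if "Re s \<ge> 0" "Re s' \<ge> 0" for s' using okk[of k] that by (simp add: ok_def)
    show "norm (?Z k s ^ 2 - ?Z k s' ^ 2) \<le> D k * norm (s - s')"
      if "Re s \<ge> 0" "Re s' \<ge> 0" for s' using okk[of k] that by (simp add: ok_def)
    show "norm (?a k s - ?Z k s *
        of_real (?r k (Im s))) \<le> tol \<epsilon> k / 2" if "Re s \<ge> 0"
      using approx[OF that, of k] lipgap(1)[of k] by linarith
    show "norm (?a k s - ?Z k s *
        of_real (?r k (Im s))) \<le> dip k / 2" if "Re s \<ge> 0"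
      using approx[OF that, of k] lipgap(2)[of k] dip0[of k] by linarith
  qed (use eps in auto)
  then show ?thesis by blast
qed

lemma log_capacity_zero_empty: "log_capacity_zero {}"
  unfolding log_capacity_zero_def by auto

theorem theorem1p7:
  fixes \<epsilon> :: real
  assumes "0 < \<epsilon>" and "\<epsilon> < 1"
  shows "\<exists>f. dirichlet_series_to_disc f \<and>
           log_capacity_zero {\<xi>. \<epsilon> < cmod \<xi> \<and> cmod \<xi> < 1 \<and>
              (\<exists>L::real. ((\<lambda>T. Nf f \<xi> T) \<longlongrightarrow> ennreal L) at_top)}"
proof -
  obtain a r u \<Lambda> D where "moebius_tower \<epsilon> a r u \<Lambda> D"
    using moebius_tower_exists[OF assms] by blast
  then interpret moebius_tower \<epsilon> a r u \<Lambda> D .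
  have empty: "{\<xi>. \<epsilon> < cmod \<xi> \<and> cmod \<xi> < 1 \<and>
      (\<exists>L::real. ((\<lambda>T. Nf (tower_lim 0) \<xi> T) \<longlongrightarrow> ennreal L) at_top)} = {}"
    using Nf_not_tendsto by blast
  show ?thesis
    by (intro exI[of _ "tower_lim 0"] conjI dirichlet_series_to_disc_tower_lim, unfold empty)
      (rule log_capacity_zero_empty)
qed

end
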